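(* Let $S=\Bbbk[x_1,\dots,x_n]$ be a polynomial ring over a field $\Bbbk$. Let $I$ be a monomial ideal of $S$ and let $M$ be a finitely generated multigraded ($\mathbb N^n$-graded) $S$-module such that $\mathrm{Gens}(M)\cap\mathrm{Gens}(I)=\emptyset$. Then (a) $\operatorname{proj\,dim}(M/IM)\le \operatorname{proj\,dim}(M)+\operatorname{proj\,dim}(I)+1$; and (b) $\operatorname{reg}(IM)\le \operatorname{reg}(I)+\operatorname{reg}(M)$.
   Context: "Multigraded" means $\mathbb N^n$-graded, with $x_i$ of degree the $i$-th unit vector. For a homogeneous element $m$ of degree $(a_1,\dots,a_n)\in\mathbb N^n$ in a multigraded module, $u_m=x_1^{a_1}\cdots x_n^{a_n}$. For a finitely generated multigraded $S$-module $M$, $\mathrm{Gens}(M)$ is the set of variables $x_i$ such that $x_i$ divides $u_m$ for some member $m$ of a minimal (multihomogeneous) generating set of $M$; it is empty if $M$ is generated in degree zero. For a monomial ideal $I$, $\mathrm{Gens}(I)$ is the set of variables occurring in the minimal monomial generators of $I$. Projective dimension is over $S$. A multigraded module is regarded as graded by total degree. For a finitely generated graded $S$-module $L$, $M_i(L)$ denotes the highest shift appearing in homological degree $i$ of the graded minimal $S$-free resolution of $L$ (i.e. the largest degree of a basis element of the $i$-th free module), and the Castelnuovo-Mumford regularity is $\operatorname{reg}(L)=\max\{M_i(L)-i : i\ge 0\}$. Conventions for the zero module: $\operatorname{reg}(0)=-\infty$ and $\operatorname{proj\,dim}(0)=-1$. *)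

theory Defs
  imports
    "HOL-Algebra.Module"
    "HOL-Algebra.Ideal"
    "HOL-Algebra.Generated_Groups"
    "HOL-Library.Poly_Mapping"
    "HOL-Library.Extended_Real"
begin

section \<open>The polynomial ring\<close>

text \<open>
  \<open>S = k[x_1, \<dots>, x_n]\<close>: the variables are indexed by a finite type \<open>'n\<close>, the monomials are the
  exponent vectors \<open>'n \<Rightarrow>\<^sub>0 nat\<close>, and a polynomial is a finitely supported family of coefficients;
  the convolution product is the multiplication of \<open>HOL-Library.Poly_Mapping\<close>.
\<close>

type_synonym ('n, 'k) mpoly = "('n \<Rightarrow>\<^sub>0 nat) \<Rightarrow>\<^sub>0 'k"

definition poly_ring :: "('n, 'k::field) mpoly ring" where
  "poly_ring = \<lparr>carrier = UNIV, mult = (*), one = 1, zero = 0, add = (+)\<rparr>"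

definition poly_module :: "(('n, 'k::field) mpoly, ('n, 'k) mpoly) module" where
  "poly_module = \<lparr>carrier = UNIV, mult = (*), one = 1, zero = 0, add = (+), smult = (*)\<rparr>"

definition monomial :: "('n \<Rightarrow>\<^sub>0 nat) \<Rightarrow> ('n, 'k::field) mpoly" where
  "monomial a = Poly_Mapping.single a 1"

definition total_degree :: "('n::finite \<Rightarrow>\<^sub>0 nat) \<Rightarrow> nat" where
  "total_degree a = (\<Sum>i\<in>UNIV. Poly_Mapping.lookup a i)"

definition irrelevant_ideal :: "('n, 'k::field) mpoly set" where
  "irrelevant_ideal = genideal poly_ring (range (\<lambda>i. monomial (Poly_Mapping.single i 1)))"

definition generated_by_monomials ::
    "('n, 'k::field) mpoly set \<Rightarrow> ('n \<Rightarrow>\<^sub>0 nat) set \<Rightarrow> bool" where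
  "generated_by_monomials I A \<longleftrightarrow> I = genideal poly_ring (monomial ` A)"

definition monomial_ideal :: "('n, 'k::field) mpoly set \<Rightarrow> bool" where
  "monomial_ideal I \<longleftrightarrow> (\<exists>A. generated_by_monomials I A)"

text \<open>The minimal set of monomial generators is unique, so the quantifier over \<open>A\<close> is harmless.\<close>

definition Gens_ideal :: "('n, 'k::field) mpoly set \<Rightarrow> 'n set" where
  "Gens_ideal I = {i. \<exists>A. generated_by_monomials I A \<and> (\<forall>B. B \<subset> A \<longrightarrow> \<not> generated_by_monomials I B)
      \<and> (\<exists>a\<in>A. Poly_Mapping.lookup a i > 0)}"


section \<open>Modules\<close>

text \<open>
  Module records inherit the fields \<^const>\<open>mult\<close> and \<^const>\<open>one\<close> from ring records. They play no role
  in the locale \<^locale>\<open>Module.module\<close> and are left \<^const>\<open>undefined\<close> below.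
\<close>

definition linear_maps ::
    "('r, 'c) ring_scheme \<Rightarrow> ('r, 'a, 'x) module_scheme \<Rightarrow> ('r, 'b, 'y) module_scheme \<Rightarrow> ('a \<Rightarrow> 'b) set" where
  "linear_maps R M N = {h \<in> carrier M \<rightarrow> carrier N.
      (\<forall>x\<in>carrier M. \<forall>y\<in>carrier M. h (x \<oplus>\<^bsub>M\<^esub> y) = h x \<oplus>\<^bsub>N\<^esub> h y) \<and>
      (\<forall>r\<in>carrier R. \<forall>x\<in>carrier M. h (r \<odot>\<^bsub>M\<^esub> x) = r \<odot>\<^bsub>N\<^esub> h x)}"

definition module_span ::
    "('r, 'c) ring_scheme \<Rightarrow> ('r, 'a, 'x) module_scheme \<Rightarrow> 'a set \<Rightarrow> 'a set" where
  "module_span R M A = \<Inter>{N. submodule N R M \<and> A \<subseteq> N}"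

definition finitely_generated ::
    "('r, 'c) ring_scheme \<Rightarrow> ('r, 'a, 'x) module_scheme \<Rightarrow> bool" where
  "finitely_generated R M \<longleftrightarrow> (\<exists>A. finite A \<and> A \<subseteq> carrier M \<and> module_span R M A = carrier M)"

definition ideal_smult ::
    "('r, 'c) ring_scheme \<Rightarrow> 'r set \<Rightarrow> ('r, 'a, 'x) module_scheme \<Rightarrow> 'a set" where
  "ideal_smult R I M = module_span R M {f \<odot>\<^bsub>M\<^esub> x | f x. f \<in> I \<and> x \<in> carrier M}"

definition quotient_module :: "('r, 'a, 'x) module_scheme \<Rightarrow> 'a set \<Rightarrow> ('r, 'a set) module" where
  "quotient_module M N = \<lparr>carrier = a_rcosets\<^bsub>M\<^esub> N, mult = undefined, one = undefined,
      zero = N, add = set_add M, smult = (\<lambda>f X. \<Union>x\<in>X. N +>\<^bsub>M\<^esub> (f \<odot>\<^bsub>M\<^esub> x))\<rparr>"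

definition free_module :: "'x set \<Rightarrow> ('r::comm_ring_1, 'x \<Rightarrow>\<^sub>0 'r) module" where
  "free_module X = \<lparr>carrier = {v. Poly_Mapping.keys v \<subseteq> X}, mult = undefined, one = undefined,
      zero = 0, add = (+), smult = (\<lambda>f. Poly_Mapping.map ((*) f))\<rparr>"

text \<open>
  Projective means: direct summand of a free module. It suffices to consider bases inside the type
  \<open>'a\<close> of the elements of \<open>P\<close>, since the canonical surjection from the free module on
  \<open>carrier P\<close> onto a projective module \<open>P\<close> splits.
\<close>

definition projective_module :: "(('n, 'k::field) mpoly, 'a) module \<Rightarrow> bool" where
  "projective_module P \<longleftrightarrow> Module.module poly_ring P \<and>
    (\<exists>(X :: 'a set) s r. s \<in> linear_maps poly_ring P (free_module X) \<and>
      r \<in> linear_maps poly_ring (free_module X) P \<and> (\<forall>x\<in>carrier P. r (s x) = x))"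


section \<open>Resolutions and projective dimension\<close>

text \<open>Exactness of \<open>\<dots> \<rightarrow> F 2 \<rightarrow> F 1 \<rightarrow> F 0 \<rightarrow> L \<rightarrow> 0\<close>, where \<open>d i : F (i + 1) \<rightarrow> F i\<close> and \<open>\<epsilon> : F 0 \<rightarrow> L\<close>.\<close>

definition resolution ::
    "('r, 'c) ring_scheme \<Rightarrow> (nat \<Rightarrow> ('r, 'p) module) \<Rightarrow> (nat \<Rightarrow> 'p \<Rightarrow> 'p) \<Rightarrow> ('p \<Rightarrow> 'a)
      \<Rightarrow> ('r, 'a) module \<Rightarrow> bool" where
  "resolution R F d \<epsilon> L \<longleftrightarrow>
    (\<forall>i. Module.module R (F i)) \<and>
    \<epsilon> \<in> linear_maps R (F 0) L \<and>
    (\<forall>i. d i \<in> linear_maps R (F (Suc i)) (F i)) \<and>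
    \<epsilon> ` carrier (F 0) = carrier L \<and>
    d 0 ` carrier (F (Suc 0)) = a_kernel (F 0) L \<epsilon> \<and>
    (\<forall>i. d (Suc i) ` carrier (F (Suc (Suc i))) = a_kernel (F (Suc i)) (F i) (d i))"

text \<open>
  The modules of the resolution range over all modules carried by subsets of \<open>nat \<Rightarrow>\<^sub>0 S\<close>. Every
  countably generated projective module is isomorphic to one of these (a direct summand of a free
  module of countable rank), so for finitely generated \<open>L\<close>, the only case of interest, this is no
  restriction.
\<close>

definition has_projective_resolution_of_length ::
    "(('n, 'k::field) mpoly, 'a) module \<Rightarrow> nat \<Rightarrow> bool" where
  "has_projective_resolution_of_length L p \<longleftrightarrow>
    (\<exists>(P :: nat \<Rightarrow> (('n, 'k) mpoly, nat \<Rightarrow>\<^sub>0 ('n, 'k) mpoly) module) d \<epsilon>.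
      resolution poly_ring P d \<epsilon> L \<and> (\<forall>i. projective_module (P i)) \<and>
      (\<forall>i>p. carrier (P i) = {\<zero>\<^bsub>P i\<^esub>}))"

definition proj_dim :: "(('n, 'k::field) mpoly, 'a) module \<Rightarrow> ereal" where
  "proj_dim L = (if carrier L = {\<zero>\<^bsub>L\<^esub>} then -1
     else Inf {ereal (real p) | p. has_projective_resolution_of_length L p})"


section \<open>Multigraded modules\<close>

definition multigraded ::
    "(('n, 'k::field) mpoly, 'a) module \<Rightarrow> (('n \<Rightarrow>\<^sub>0 nat) \<Rightarrow> 'a set) \<Rightarrow> bool" where
  "multigraded M G \<longleftrightarrow> Module.module poly_ring M \<and>
    (\<forall>a. subgroup (G a) (add_monoid M)) \<and>
    (\<forall>a b c. \<forall>x\<in>G b. Poly_Mapping.single a c \<odot>\<^bsub>M\<^esub> x \<in> G (a + b)) \<and>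
    (\<forall>x\<in>carrier M. \<exists>!f. (\<forall>a. f a \<in> G a) \<and> finite {a. f a \<noteq> \<zero>\<^bsub>M\<^esub>} \<and>
        x = (\<Oplus>\<^bsub>M\<^esub>a\<in>{a. f a \<noteq> \<zero>\<^bsub>M\<^esub>}. f a))"

definition minimal_homogeneous_generators ::
    "(('n, 'k::field) mpoly, 'a) module \<Rightarrow> (('n \<Rightarrow>\<^sub>0 nat) \<Rightarrow> 'a set) \<Rightarrow> 'a set \<Rightarrow> bool" where
  "minimal_homogeneous_generators M G B \<longleftrightarrow> B \<subseteq> (\<Union>a. G a) \<and>
    module_span poly_ring M B = carrier M \<and>
    (\<forall>C. C \<subset> B \<longrightarrow> module_span poly_ring M C \<noteq> carrier M)"

text \<open>
  A member of a minimal generating set is nonzero and hence has only one degree. The degrees of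
  such a set do not depend on its choice, so the quantifier over \<open>B\<close> is harmless.
\<close>

definition Gens ::
    "(('n, 'k::field) mpoly, 'a) module \<Rightarrow> (('n \<Rightarrow>\<^sub>0 nat) \<Rightarrow> 'a set) \<Rightarrow> 'n set" where
  "Gens M G = {i. \<exists>B. minimal_homogeneous_generators M G B \<and>
      (\<exists>m\<in>B. \<exists>a. m \<in> G a \<and> Poly_Mapping.lookup a i > 0)}"

definition induced_grading :: "('d \<Rightarrow> 'a set) \<Rightarrow> 'a set \<Rightarrow> 'd \<Rightarrow> 'a set" where
  "induced_grading G N a = G a \<inter> N"

definition poly_grading :: "('n \<Rightarrow>\<^sub>0 nat) \<Rightarrow> ('n, 'k::field) mpoly set" where
  "poly_grading a = {f. Poly_Mapping.keys f \<subseteq> {a}}"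

text \<open>The component of total degree \<open>e\<close> is the sum of the components of multidegrees of total degree \<open>e\<close>.\<close>

definition total_grading ::
    "('r, 'a) module \<Rightarrow> (('n::finite \<Rightarrow>\<^sub>0 nat) \<Rightarrow> 'a set) \<Rightarrow> nat \<Rightarrow> 'a set" where
  "total_grading M G e = generate (add_monoid M) (\<Union>a\<in>{a. total_degree a = e}. G a)"


section \<open>Graded minimal free resolutions and regularity\<close>

text \<open>
  The list \<open>bs\<close> stands for the graded free module \<open>\<Oplus>\<^sub>j S(- bs ! j)\<close>, whose \<open>j\<close>-th basis element has
  degree \<open>bs ! j\<close>; \<open>shifted_component bs e\<close> is its component of degree \<open>e\<close>.
\<close>

definition shifted_component ::
    "nat list \<Rightarrow> nat \<Rightarrow> (nat \<Rightarrow>\<^sub>0 ('n::finite, 'k::field) mpoly) set" where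
  "shifted_component bs e = {v \<in> carrier (free_module {..<length bs}).
      \<forall>j<length bs. \<forall>a\<in>Poly_Mapping.keys (Poly_Mapping.lookup v j). total_degree a + bs ! j = e}"

text \<open>
  \<open>H\<close> is the \<open>\<nat>\<close>-grading of \<open>L\<close>, and \<open>\<beta> i\<close> lists the shifts in homological degree \<open>i\<close>. Since \<open>L\<close> lives in
  nonnegative degrees, so do the shifts of a minimal resolution.
\<close>

definition minimal_graded_free_resolution ::
    "(('n::finite, 'k::field) mpoly, 'a) module \<Rightarrow> (nat \<Rightarrow> 'a set) \<Rightarrow> (nat \<Rightarrow> nat list) \<Rightarrow>
     (nat \<Rightarrow> (nat \<Rightarrow>\<^sub>0 ('n, 'k) mpoly) \<Rightarrow> (nat \<Rightarrow>\<^sub>0 ('n, 'k) mpoly)) \<Rightarrow>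
     ((nat \<Rightarrow>\<^sub>0 ('n, 'k) mpoly) \<Rightarrow> 'a) \<Rightarrow> bool" where
  "minimal_graded_free_resolution L H \<beta> d \<epsilon> \<longleftrightarrow>
    resolution poly_ring (\<lambda>i. free_module {..<length (\<beta> i)}) d \<epsilon> L \<and>
    (\<forall>e. \<epsilon> ` shifted_component (\<beta> 0) e \<subseteq> H e) \<and>
    (\<forall>i e. d i ` shifted_component (\<beta> (Suc i)) e \<subseteq> shifted_component (\<beta> i) e) \<and>
    (\<forall>i. d i ` carrier (free_module {..<length (\<beta> (Suc i))})
        \<subseteq> ideal_smult poly_ring irrelevant_ideal (free_module {..<length (\<beta> i)}))"

text \<open>The minimal resolution is unique up to isomorphism; its shifts are unique up to order.\<close>

definition resolution_shifts ::
    "(('n::finite, 'k::field) mpoly, 'a) module \<Rightarrow> (nat \<Rightarrow> 'a set) \<Rightarrow> nat \<Rightarrow> nat list" where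
  "resolution_shifts L H = (SOME \<beta>. \<exists>d \<epsilon>. minimal_graded_free_resolution L H \<beta> d \<epsilon>)"

text \<open>This is \<open>- \<infinity>\<close> if the \<open>i\<close>-th module of the resolution is zero.\<close>

definition highest_shift ::
    "(('n::finite, 'k::field) mpoly, 'a) module \<Rightarrow> (nat \<Rightarrow> 'a set) \<Rightarrow> nat \<Rightarrow> ereal" where
  "highest_shift L H i = (SUP b\<in>set (resolution_shifts L H i). ereal (real b))"

text \<open>
  For a multigraded module with multigrading \<open>G\<close>; the resolution only sees the total degree. The
  supremum is a maximum, as the resolution has finite length, and \<open>- \<infinity>\<close> for the zero module.
\<close>

definition regularity ::
    "(('n::finite, 'k::field) mpoly, 'a) module \<Rightarrow> (('n \<Rightarrow>\<^sub>0 nat) \<Rightarrow> 'a set) \<Rightarrow> ereal" where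
  "regularity L G = (SUP i. highest_shift L (total_grading L G) i - ereal (real i))"

end

theory Submission
  imports Defs
begin

text \<open>
  Both inequalities are read off from explicit free resolutions of \<open>IM\<close> and of \<open>M/IM\<close>, which are
  built from the minimal multigraded resolutions of \<open>I\<close> and \<open>M\<close>.

  The disjointness of \<open>Gens M\<close> and \<open>Gens I\<close> enters once, in \<open>ideal_smult_supported\<close>: the component of
  \<open>IM\<close> in multidegree \<open>b\<close> is all of \<open>M\<^sub>b\<close> if \<open>x\<^sup>b \<in> I\<close>, and zero otherwise. Indeed \<open>M\<^sub>b\<close> is spanned by
  the elements \<open>x^(b - d) m\<close> with \<open>m\<close> a generator of degree \<open>d\<close> dividing \<open>b\<close>. If \<open>x\<^sup>b \<in> I\<close>, choose a minimal
  generator \<open>x\<^sup>a\<close> of \<open>I\<close> dividing \<open>x\<^sup>b\<close>; since \<open>a\<close> and \<open>d\<close> involve different variables, \<open>x\<^sup>a\<close> divides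
  \<open>x^(b - d)\<close>. So in each multidegree \<open>IM\<close> is the tensor product over the field of \<open>I\<close> and \<open>M\<close>, and
  \<open>M/IM\<close> is that of \<open>S/I\<close> and \<open>M\<close>.

  The resolutions follow this pattern. A complex of multigraded free modules is determined by the
  degrees of its basis elements and a matrix of scalars, here called a frame; its strand in
  multidegree \<open>b\<close> is the complex of vector spaces on the basis elements whose degrees divide \<open>b\<close>. The
  product of two frames has the pairs of basis elements as its basis, the least common multiple of
  two degrees as the degree of a pair, and the usual boundary of a tensor product. (Iterated
  products of the resolutions of \<open>S/(x^a)\<close> are the Taylor complexes.) A least common multiple
  divides \<open>b\<close> exactly when both degrees do, so each strand of the product is the tensor product of the
  strands. By the Kuenneth formula over a field, proved as \<open>product_exact\<close> and \<open>product_boundaries\<close>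
  with an explicit homotopy, the product with the frame of \<open>M\<close> resolves \<open>IM\<close> when the other factor
  is the frame of \<open>I\<close>, and \<open>M/IM\<close> when it is the frame of \<open>S/I\<close>, which is that of \<open>I\<close> with \<open>S\<close> put in front.

  Homological degrees add up in the product. The resolution of \<open>M/IM\<close> therefore has length at most
  \<open>proj_dim M + (proj_dim I + 1)\<close>. The total degree of a least common multiple is at most the sum of the
  total degrees, so a shift of the resolution of \<open>IM\<close> in homological degree \<open>j + k\<close> is at most the sum of
  a shift of \<open>I\<close> in degree \<open>j\<close> and a shift of \<open>M\<close> in degree \<open>k\<close>, and hence at most
  \<open>reg I + reg M + j + k\<close>.

  Two general facts connect resolutions with the invariants: a minimal resolution is no longer than
  any projective resolution (\<open>minimal_resolution_length\<close>), and its shifts occur in every graded free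
  resolution (\<open>minimal_resolution_shifts\<close>). Both hold because a self-map of a minimal resolution that
  lifts the identity is the identity modulo the irrelevant ideal. Minimal frames exist
  (\<open>minimal_frame_exists\<close>) because, by Dickson's lemma, new relations are required in finitely many
  multidegrees only.
\<close>

section \<open>Finitely supported functions\<close>

abbreviation lookup where "lookup \<equiv> Poly_Mapping.lookup"
abbreviation keys where "keys \<equiv> Poly_Mapping.keys"
abbreviation single where "single \<equiv> Poly_Mapping.single"
abbreviation scal :: "'r::comm_ring_1 \<Rightarrow> ('x \<Rightarrow>\<^sub>0 'r) \<Rightarrow> 'x \<Rightarrow>\<^sub>0 'r" where
  "scal a \<equiv> Poly_Mapping.map ((*) a)"

lemma lookup_scal [simp]: "lookup (scal a v) x = a * lookup v x"
  by (simp add: Poly_Mapping.map.rep_eq when_def)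

lemma single_eq_0_iff: "single x a = 0 \<longleftrightarrow> a = 0"
  by (auto simp: poly_mapping_eq_iff fun_eq_iff lookup_single when_def)

lemma scal_add: "scal a (u + v) = scal a u + scal a v"
  by (rule poly_mapping_eqI) (simp add: lookup_add algebra_simps)

lemma add_scal: "scal (a + b) v = scal a v + scal b v"
  by (rule poly_mapping_eqI) (simp add: lookup_add algebra_simps)

lemma scal_scal [simp]: "scal a (scal b v) = scal (a * b) v"
  by (rule poly_mapping_eqI) (simp add: algebra_simps)

lemma scal_one [simp]: "scal 1 v = v"
  by (rule poly_mapping_eqI) simp

lemma scal_zero [simp]: "scal a 0 = 0" "scal 0 v = 0"
  by (rule poly_mapping_eqI; simp)+

lemma scal_uminus: "scal (- a) v = - scal a v" "scal a (- v) = - scal a v"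
  by (rule poly_mapping_eqI; simp)+

lemma scal_minus: "scal a (u - v) = scal a u - scal a v"
  by (rule poly_mapping_eqI) (simp add: lookup_minus algebra_simps)

lemma scal_single [simp]: "scal a (single x b) = single x (a * b)"
  by (simp add: map_single)

lemma scal_sum: "scal a (sum f A) = (\<Sum>x\<in>A. scal a (f x))"
  by (rule poly_mapping_eqI) (simp add: lookup_sum sum_distrib_left)

lemma keys_scal: "keys (scal a v) \<subseteq> keys v"
  by (auto simp: in_keys_iff)

lemma keys_minus: "keys (u - v) \<subseteq> keys u \<union> keys (v :: 'x \<Rightarrow>\<^sub>0 'r::ab_group_add)"
  by (auto simp: in_keys_iff lookup_minus)

lemma keys_sum: "keys (sum f A) \<subseteq> (\<Union>a\<in>A. keys (f a))"
proof
  fix k assume "k \<in> keys (sum f A)"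
  then have "(\<Sum>a\<in>A. lookup (f a) k) \<noteq> 0" by (simp add: in_keys_iff lookup_sum)
  then obtain a where "a \<in> A" "lookup (f a) k \<noteq> 0" by (meson sum.neutral)
  then show "k \<in> (\<Union>a\<in>A. keys (f a))" by (auto simp: in_keys_iff)
qed

lemma poly_mapping_sum_singles:
  fixes v :: "'x \<Rightarrow>\<^sub>0 'r::comm_monoid_add"
  assumes "finite A" "keys v \<subseteq> A" shows "v = (\<Sum>x\<in>A. single x (lookup v x))"
proof (rule poly_mapping_eqI)
  fix k
  show "lookup v k = lookup (\<Sum>x\<in>A. single x (lookup v x)) k"
    using assms by (auto simp: lookup_sum lookup_single when_def in_keys_iff)
qed

lemma poly_mapping_add_induct [consumes 1, case_names zero single add]:
  fixes v :: "'x \<Rightarrow>\<^sub>0 'r::comm_monoid_add"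
  assumes "keys v \<subseteq> X" "P 0" "\<And>x a. x \<in> X \<Longrightarrow> P (single x a)"
    and "\<And>u v. keys u \<subseteq> X \<Longrightarrow> keys v \<subseteq> X \<Longrightarrow> P u \<Longrightarrow> P v \<Longrightarrow> P (u + v)"
  shows "P v"
proof -
  have "P (\<Sum>x\<in>A. single x (lookup v x)) \<and> keys (\<Sum>x\<in>A. single x (lookup v x)) \<subseteq> X"
    if "finite A" "A \<subseteq> X" for A
    using that
  proof (induction A rule: finite_induct)
    case (insert x A)
    have "keys (single x (lookup v x) + (\<Sum>x\<in>A. single x (lookup v x))) \<subseteq> X"
      using insert keys_add[of "single x (lookup v x)" "\<Sum>x\<in>A. single x (lookup v x)"] by (auto split: if_splits)
    then show ?case using insert assms(3)[of x] assms(4)[of "single x (lookup v x)"] by auto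
  qed (use assms in auto)
  from this[of "keys v"] show ?thesis using poly_mapping_sum_singles[of "keys v" v] assms(1) by simp
qed

lemma mpoly_vector_induct [consumes 1, case_names zero single add]:
  fixes v :: "'x \<Rightarrow>\<^sub>0 ('n, 'k::field) mpoly"
  assumes "keys v \<subseteq> X" "P 0" "\<And>x a k. x \<in> X \<Longrightarrow> P (single x (single a k))"
    and "\<And>u v. keys u \<subseteq> X \<Longrightarrow> keys v \<subseteq> X \<Longrightarrow> P u \<Longrightarrow> P v \<Longrightarrow> P (u + v)"
  shows "P v"
  using assms(1)
proof (induction rule: poly_mapping_add_induct)
  case (single x f)
  have "keys f \<subseteq> UNIV" by simp
  then show ?case
  proof (induction rule: poly_mapping_add_induct)
    case (add f g)
    have "P (single x f + single x g)" using add single by (intro assms(4)) auto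
    then show ?case by (simp add: single_add)
  qed (use assms single in auto)
qed (use assms in auto)

definition lin_ext :: "('x \<Rightarrow> 'y \<Rightarrow>\<^sub>0 'r::comm_ring_1) \<Rightarrow> ('x \<Rightarrow>\<^sub>0 'r) \<Rightarrow> 'y \<Rightarrow>\<^sub>0 'r" where
  "lin_ext f v = (\<Sum>x\<in>keys v. scal (lookup v x) (f x))"

lemma lin_ext_superset:
  assumes "finite A" "keys v \<subseteq> A" shows "lin_ext f v = (\<Sum>x\<in>A. scal (lookup v x) (f x))"
  unfolding lin_ext_def using assms
  by (intro sum.mono_neutral_left) (auto simp: in_keys_iff)

lemma lin_ext_add: "lin_ext f (u + v) = lin_ext f u + lin_ext f v"
proof -
  let ?A = "keys u \<union> keys v"
  have "keys (u + v) \<subseteq> ?A" by (rule keys_add)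
  then show ?thesis
    by (simp add: lin_ext_superset[of ?A] lookup_add add_scal sum.distrib)
qed

lemma lin_ext_scal: "lin_ext f (scal a v) = scal a (lin_ext f v)"
  by (simp add: lin_ext_superset[of "keys v"] keys_scal scal_sum)

lemma lin_ext_single [simp]: "lin_ext f (single x a) = scal a (f x)"
  by (simp add: lin_ext_superset[of "{x}"])

lemma lin_ext_zero [simp]: "lin_ext f 0 = 0"
  by (simp add: lin_ext_def)

lemma lin_ext_uminus: "lin_ext f (- v) = - lin_ext f v"
  using lin_ext_scal[of f "-1" v] by (simp add: scal_uminus)

lemma lin_ext_minus: "lin_ext f (u - v) = lin_ext f u - lin_ext f v"
  using lin_ext_add[of f u "- v"] by (simp add: lin_ext_uminus)

lemma lin_ext_sum: "lin_ext f (sum g A) = (\<Sum>a\<in>A. lin_ext f (g a))"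
  by (induction A rule: infinite_finite_induct) (auto simp: lin_ext_add)

lemma keys_lin_ext: "keys (lin_ext f v) \<subseteq> (\<Union>x\<in>keys v. keys (f x))"
proof -
  have "keys (lin_ext f v) \<subseteq> (\<Union>x\<in>keys v. keys (scal (lookup v x) (f x)))"
    unfolding lin_ext_def by (rule keys_sum)
  also have "\<dots> \<subseteq> (\<Union>x\<in>keys v. keys (f x))" using keys_scal by fast
  finally show ?thesis .
qed

section \<open>Free modules\<close>

lemma poly_ring_simps [simp]:
  "carrier poly_ring = UNIV" "mult poly_ring = (*)" "one poly_ring = 1"
  "zero poly_ring = 0" "add poly_ring = (+)"
  by (simp_all add: poly_ring_def)

lemma free_module_simps [simp]:
  "carrier (free_module X) = {v. keys v \<subseteq> X}" "zero (free_module X) = 0"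
  "add (free_module X) = (+)" "smult (free_module X) = scal"
  by (simp_all add: free_module_def)

lemma poly_ring_cring: "cring (poly_ring :: ('n, 'k::field) mpoly ring)"
proof (rule cringI)
  show "abelian_group (poly_ring :: ('n, 'k) mpoly ring)"
    by (rule abelian_groupI) (auto simp: algebra_simps intro: exI[of _ "- x" for x])
  show "comm_monoid (poly_ring :: ('n, 'k) mpoly ring)"
    by (rule comm_monoidI) (auto simp: algebra_simps)
qed (auto simp: algebra_simps)

lemma free_module_is_module:
  "Module.module (poly_ring :: ('n, 'k::field) mpoly ring) (free_module X)"
proof (rule Module.moduleI)
  show "cring (poly_ring :: ('n, 'k) mpoly ring)" by (rule poly_ring_cring)
  show "abelian_group (free_module X :: (('n, 'k) mpoly, _) module)"
  proof (rule abelian_groupI)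
    fix x :: "'a \<Rightarrow>\<^sub>0 ('n, 'k) mpoly" assume "x \<in> carrier (free_module X)"
    then show "\<exists>y\<in>carrier (free_module X). y \<oplus>\<^bsub>free_module X\<^esub> x = \<zero>\<^bsub>free_module X\<^esub>"
      by (intro bexI[of _ "- x"]) auto
  qed (auto simp: algebra_simps dest: keys_add[THEN subsetD])
qed (use keys_scal in \<open>fastforce simp: scal_add add_scal\<close>)+

lemma linear_mapsD:
  assumes "h \<in> linear_maps R M N"
  shows "x \<in> carrier M \<Longrightarrow> h x \<in> carrier N"
    and "x \<in> carrier M \<Longrightarrow> y \<in> carrier M \<Longrightarrow> h (x \<oplus>\<^bsub>M\<^esub> y) = h x \<oplus>\<^bsub>N\<^esub> h y"
    and "r \<in> carrier R \<Longrightarrow> x \<in> carrier M \<Longrightarrow> h (r \<odot>\<^bsub>M\<^esub> x) = r \<odot>\<^bsub>N\<^esub> h x"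
  using assms by (auto simp: linear_maps_def)

lemma linear_mapsI:
  assumes "\<And>x. x \<in> carrier M \<Longrightarrow> h x \<in> carrier N"
    and "\<And>x y. x \<in> carrier M \<Longrightarrow> y \<in> carrier M \<Longrightarrow> h (x \<oplus>\<^bsub>M\<^esub> y) = h x \<oplus>\<^bsub>N\<^esub> h y"
    and "\<And>r x. r \<in> carrier R \<Longrightarrow> x \<in> carrier M \<Longrightarrow> h (r \<odot>\<^bsub>M\<^esub> x) = r \<odot>\<^bsub>N\<^esub> h x"
  shows "h \<in> linear_maps R M N"
  using assms by (auto simp: linear_maps_def)

lemma linear_maps_comp:
  assumes "f \<in> linear_maps R M N" "g \<in> linear_maps R N P"
  shows "(\<lambda>x. g (f x)) \<in> linear_maps R M P"
  using assms by (auto simp: linear_maps_def Pi_def)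

lemma linear_maps_zero:
  assumes "h \<in> linear_maps R M N" "Module.module R M" "Module.module R N"
  shows "h \<zero>\<^bsub>M\<^esub> = \<zero>\<^bsub>N\<^esub>"
proof -
  interpret M: Module.module R M by fact
  interpret N: Module.module R N by fact
  have "h \<zero>\<^bsub>M\<^esub> \<in> carrier N" using assms(1) by (auto simp: linear_maps_def)
  moreover have "h (\<zero>\<^bsub>M\<^esub> \<oplus>\<^bsub>M\<^esub> \<zero>\<^bsub>M\<^esub>) = h \<zero>\<^bsub>M\<^esub> \<oplus>\<^bsub>N\<^esub> h \<zero>\<^bsub>M\<^esub>"
    using assms(1) by (intro linear_mapsD(2)) auto
  ultimately show ?thesis by (simp add: N.add.r_cancel_one')
qed

lemma linear_maps_free_sum:
  assumes "h \<in> linear_maps poly_ring (free_module X) (free_module Y)" "\<And>a. a \<in> A \<Longrightarrow> keys (f a) \<subseteq> X"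
  shows "h (sum f A) = (\<Sum>a\<in>A. h (f a)) \<and> keys (sum f A) \<subseteq> X"
  using assms(2)
proof (induction A rule: infinite_finite_induct)
  case (insert a A)
  have "keys (f a + sum f A) \<subseteq> X" using keys_add[of "f a" "sum f A"] insert by auto
  then show ?case using linear_mapsD(2)[OF assms(1), of "f a" "sum f A"] insert by auto
qed (use linear_maps_zero[OF assms(1) free_module_is_module free_module_is_module] in auto)

lemma linear_maps_free_eqI:
  fixes f g :: "('x \<Rightarrow>\<^sub>0 ('n,'k::field) mpoly) \<Rightarrow> 'a"
  assumes "f \<in> linear_maps poly_ring (free_module X) N" "g \<in> linear_maps poly_ring (free_module X) N"
    and "Module.module poly_ring N" and "\<And>x. x \<in> X \<Longrightarrow> f (single x 1) = g (single x 1)"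
    and "keys v \<subseteq> X"
  shows "f v = g v"
  using assms(5)
proof (induction rule: poly_mapping_add_induct)
  case zero
  show ?case using linear_maps_zero[OF assms(1) free_module_is_module assms(3)]
      linear_maps_zero[OF assms(2) free_module_is_module assms(3)] by simp
next
  case (single x a)
  have "f (scal a (single x 1)) = g (scal a (single x 1))"
    using linear_mapsD(3)[OF assms(1), of a "single x 1"] linear_mapsD(3)[OF assms(2), of a "single x 1"]
      assms(4)[OF single] single by simp
  then show ?case by simp
next
  case (add u v)
  then show ?case using linear_mapsD(2)[OF assms(1), of u v] linear_mapsD(2)[OF assms(2), of u v] by simp
qed

text \<open>Module records carry their own addition, so linear maps into them are summed by \<open>finsum\<close>;
  this is the counterpart of \<open>lin_ext\<close> for such targets.\<close>

definition lin_ext_to :: "('r, 'a) module \<Rightarrow> ('x \<Rightarrow> 'a) \<Rightarrow> ('x \<Rightarrow>\<^sub>0 'r::comm_ring_1) \<Rightarrow> 'a" where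
  "lin_ext_to N f v = finsum N (\<lambda>x. lookup v x \<odot>\<^bsub>N\<^esub> f x) (keys v)"

lemma lin_ext_to_superset:
  assumes "Module.module poly_ring N" "finite A" "keys v \<subseteq> A" "\<And>x. x \<in> A \<Longrightarrow> f x \<in> carrier N"
  shows "lin_ext_to N f v = finsum N (\<lambda>x. lookup v x \<odot>\<^bsub>N\<^esub> f x) A"
proof -
  interpret N: Module.module poly_ring N by fact
  show ?thesis unfolding lin_ext_to_def
    using assms(2-4) N.smult_l_null by (intro N.add.finprod_mono_neutral_cong_left) (auto simp: in_keys_iff)
qed

lemma lin_ext_to_linear:
  fixes N :: "(('n,'k::field) mpoly, 'a) module"
  assumes N: "Module.module poly_ring N" and f: "\<And>x. x \<in> X \<Longrightarrow> f x \<in> carrier N"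
  shows "lin_ext_to N f \<in> linear_maps poly_ring (free_module X) N"
proof -
  interpret N: Module.module poly_ring N by fact
  show ?thesis
  proof (rule linear_mapsI)
    fix u :: "_ \<Rightarrow>\<^sub>0 ('n,'k) mpoly" assume "u \<in> carrier (free_module X)"
    then show "lin_ext_to N f u \<in> carrier N"
      unfolding lin_ext_to_def using f by (intro N.finsum_closed) auto
  next
    fix u v :: "_ \<Rightarrow>\<^sub>0 ('n,'k) mpoly"
    assume uv: "u \<in> carrier (free_module X)" "v \<in> carrier (free_module X)"
    let ?A = "keys u \<union> keys v"
    have A: "finite ?A" "keys (u + v) \<subseteq> ?A" "keys u \<subseteq> ?A" "keys v \<subseteq> ?A"
      "\<And>x. x \<in> ?A \<Longrightarrow> f x \<in> carrier N" using keys_add[of u v] uv f by auto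
    have "lin_ext_to N f (u + v) = finsum N (\<lambda>x. lookup (u + v) x \<odot>\<^bsub>N\<^esub> f x) ?A"
      using A by (intro lin_ext_to_superset N) auto
    also have "\<dots> = finsum N (\<lambda>x. lookup u x \<odot>\<^bsub>N\<^esub> f x \<oplus>\<^bsub>N\<^esub> lookup v x \<odot>\<^bsub>N\<^esub> f x) ?A"
      using A(5) N.smult_l_distr by (intro N.finsum_cong') (auto simp: lookup_add)
    also have "\<dots> = finsum N (\<lambda>x. lookup u x \<odot>\<^bsub>N\<^esub> f x) ?A \<oplus>\<^bsub>N\<^esub> finsum N (\<lambda>x. lookup v x \<odot>\<^bsub>N\<^esub> f x) ?A"
      using A(5) by (intro N.finsum_addf) auto
    also have "\<dots> = lin_ext_to N f u \<oplus>\<^bsub>N\<^esub> lin_ext_to N f v"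
      using lin_ext_to_superset[OF N A(1) A(3) A(5)] lin_ext_to_superset[OF N A(1) A(4) A(5)] by simp
    finally show "lin_ext_to N f (u \<oplus>\<^bsub>free_module X\<^esub> v) = lin_ext_to N f u \<oplus>\<^bsub>N\<^esub> lin_ext_to N f v"
      by simp
  next
    fix a :: "('n,'k) mpoly" and u :: "_ \<Rightarrow>\<^sub>0 ('n,'k) mpoly"
    assume u: "u \<in> carrier (free_module X)"
    then have fu: "\<And>x. x \<in> keys u \<Longrightarrow> f x \<in> carrier N" using f by auto
    have "lin_ext_to N f (scal a u) = finsum N (\<lambda>x. lookup (scal a u) x \<odot>\<^bsub>N\<^esub> f x) (keys u)"
      using fu by (intro lin_ext_to_superset N keys_scal) auto
    also have "\<dots> = finsum N (\<lambda>x. a \<odot>\<^bsub>N\<^esub> (lookup u x \<odot>\<^bsub>N\<^esub> f x)) (keys u)"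
      using fu N.smult_assoc1 by (intro N.finsum_cong') auto
    also have "\<dots> = a \<odot>\<^bsub>N\<^esub> lin_ext_to N f u"
      unfolding lin_ext_to_def using fu by (intro N.finsum_smult_ldistr[symmetric]) auto
    finally show "lin_ext_to N f (a \<odot>\<^bsub>free_module X\<^esub> u) = a \<odot>\<^bsub>N\<^esub> lin_ext_to N f u" by simp
  qed
qed

lemma lin_ext_to_single [simp]:
  assumes "Module.module poly_ring N" "f x \<in> carrier N"
  shows "lin_ext_to N f (single x a) = a \<odot>\<^bsub>N\<^esub> f x"
proof -
  interpret N: Module.module poly_ring N by fact
  show ?thesis using assms lin_ext_to_superset[of N "{x}" "single x a" f] by simp
qed

lemma lin_ext_linear:
  assumes "\<And>x. x \<in> X \<Longrightarrow> keys (f x) \<subseteq> Y"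
  shows "lin_ext f \<in> linear_maps poly_ring (free_module X) (free_module Y)"
proof (rule linear_mapsI)
  fix v :: "'a \<Rightarrow>\<^sub>0 ('c, 'd) mpoly" assume "v \<in> carrier (free_module X)"
  then have "(\<Union>x\<in>keys v. keys (f x)) \<subseteq> Y" using assms by auto
  then show "lin_ext f v \<in> carrier (free_module Y)" using keys_lin_ext[of f v] by auto
qed (auto simp: lin_ext_add lin_ext_scal)

section \<open>Comparison of resolutions\<close>

text \<open>The preimages of the values on the basis can be chosen freely. The condition \<open>T\<close> records a
  property of the choice; the graded comparison takes homogeneous preimages.\<close>

lemma free_lift:
  fixes N1 :: "(('n,'k::field) mpoly, 'a) module" and N2 :: "(('n,'k) mpoly, 'b) module"
    and X :: "'x set"
  assumes N: "Module.module poly_ring N1" "Module.module poly_ring N2"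
    and g: "g \<in> linear_maps poly_ring N1 N2" and f: "f \<in> linear_maps poly_ring (free_module X) N2"
    and ex: "\<And>x. x \<in> X \<Longrightarrow> \<exists>y\<in>carrier N1. g y = f (single x 1) \<and> T x y"
  shows "\<exists>f'\<in>linear_maps poly_ring (free_module X) N1.
    (\<forall>v. keys v \<subseteq> X \<longrightarrow> g (f' v) = f v) \<and> (\<forall>x\<in>X. T x (f' (single x 1)))"
proof -
  interpret N1: Module.module poly_ring N1 by fact
  obtain y where y: "\<And>x. x \<in> X \<Longrightarrow> y x \<in> carrier N1 \<and> g (y x) = f (single x 1) \<and> T x (y x)"
    using ex by metis
  let ?f = "lin_ext_to N1 y"
  have lin: "?f \<in> linear_maps poly_ring (free_module X) N1"
    using y by (intro lin_ext_to_linear N) auto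
  have val: "?f (single x 1) = y x" if "x \<in> X" for x
    using y[OF that] N(1) N1.smult_one[of "y x"] by simp
  have "g (?f v) = f v" if "keys v \<subseteq> X" for v
    by (rule linear_maps_free_eqI[OF linear_maps_comp[OF lin g] f N(2) _ that]) (simp add: val y)
  then show ?thesis using lin y by (intro bexI[of _ ?f] conjI allI impI ballI) (simp_all only: val)
qed

lemma projective_lift:
  fixes P :: "(('n,'k::field) mpoly, 'c) module"
    and N1 :: "(('n,'k) mpoly, 'a) module" and N2 :: "(('n,'k) mpoly, 'b) module"
  assumes P: "projective_module P"
    and N: "Module.module poly_ring N1" "Module.module poly_ring N2"
    and g: "g \<in> linear_maps poly_ring N1 N2" and f: "f \<in> linear_maps poly_ring P N2"
    and im: "f ` carrier P \<subseteq> g ` carrier N1"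
  shows "\<exists>f'\<in>linear_maps poly_ring P N1. \<forall>v\<in>carrier P. g (f' v) = f v"
proof -
  obtain X :: "'c set" and s r where s: "s \<in> linear_maps poly_ring P (free_module X)"
    and r: "r \<in> linear_maps poly_ring (free_module X) P" and rs': "\<forall>x\<in>carrier P. r (s x) = x"
    using P unfolding projective_module_def by (elim conjE exE)
  note rs = rs'[rule_format]
  have "\<exists>y\<in>carrier N1. g y = f (r (single x 1)) \<and> True" if "x \<in> X" for x
  proof -
    have "r (single x 1) \<in> carrier P" using linear_mapsD(1)[OF r, of "single x 1"] that by simp
    then have "f (r (single x 1)) \<in> g ` carrier N1" by (intro subsetD[OF im] imageI)
    then show ?thesis by auto
  qed
  from free_lift[OF N g linear_maps_comp[OF r f] this]
  obtain h where h: "h \<in> linear_maps poly_ring (free_module X) N1"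
    "\<And>v. keys v \<subseteq> X \<Longrightarrow> g (h v) = f (r v)"
    by blast
  have "g (h (s v)) = f v" if "v \<in> carrier P" for v
  proof -
    have "keys (s v) \<subseteq> X" using linear_mapsD(1)[OF s that] by simp
    from h(2)[OF this] show ?thesis by (simp only: rs[OF that])
  qed
  then show ?thesis by (intro bexI[OF _ linear_maps_comp[OF s h(1)]] ballI)
qed

lemma resolutionD:
  assumes "resolution R F d \<epsilon> L"
  shows "Module.module R (F i)" "\<epsilon> \<in> linear_maps R (F 0) L" "d i \<in> linear_maps R (F (Suc i)) (F i)"
    and "\<epsilon> ` carrier (F 0) = carrier L"
    and "v \<in> carrier (F 0) \<Longrightarrow> \<epsilon> v = \<zero>\<^bsub>L\<^esub> \<longleftrightarrow> v \<in> d 0 ` carrier (F (Suc 0))"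
    and "v \<in> carrier (F (Suc i)) \<Longrightarrow> d i v = \<zero>\<^bsub>F i\<^esub> \<longleftrightarrow> v \<in> d (Suc i) ` carrier (F (Suc (Suc i)))"
  using assms unfolding resolution_def a_kernel_def' by auto

lemma resolutionI:
  assumes "\<And>i. Module.module R (F i)" "\<epsilon> \<in> linear_maps R (F 0) L"
    "\<And>i. d i \<in> linear_maps R (F (Suc i)) (F i)"
    and "carrier L \<subseteq> \<epsilon> ` carrier (F 0)"
    and "\<And>v. v \<in> carrier (F 0) \<Longrightarrow> \<epsilon> v = \<zero>\<^bsub>L\<^esub> \<longleftrightarrow> v \<in> d 0 ` carrier (F (Suc 0))"
    and "\<And>v i. v \<in> carrier (F (Suc i)) \<Longrightarrow> d i v = \<zero>\<^bsub>F i\<^esub> \<longleftrightarrow> v \<in> d (Suc i) ` carrier (F (Suc (Suc i)))"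
  shows "resolution R F d \<epsilon> L"
proof -
  have 1: "\<epsilon> ` carrier (F 0) = carrier L"
    using linear_mapsD(1)[OF assms(2)] assms(4) by (intro equalityI image_subsetI)
  have im: "d i v \<in> carrier (F i)" if "v \<in> carrier (F (Suc i))" for i v
    by (rule linear_mapsD(1)[OF assms(3) that])
  have 2: "d 0 ` carrier (F (Suc 0)) = a_kernel (F 0) L \<epsilon>"
    unfolding a_kernel_def'
  proof (intro Set.set_eqI iffI)
    fix v assume "v \<in> d 0 ` carrier (F (Suc 0))"
    then have "v \<in> carrier (F 0)" "v \<in> d 0 ` carrier (F (Suc 0))" using im by auto
    then show "v \<in> {v \<in> carrier (F 0). \<epsilon> v = \<zero>\<^bsub>L\<^esub>}" by (simp add: assms(5))
  next
    fix v assume "v \<in> {v \<in> carrier (F 0). \<epsilon> v = \<zero>\<^bsub>L\<^esub>}"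
    then show "v \<in> d 0 ` carrier (F (Suc 0))" using assms(5)[of v] by simp
  qed
  have 3: "d (Suc i) ` carrier (F (Suc (Suc i))) = a_kernel (F (Suc i)) (F i) (d i)" for i
    unfolding a_kernel_def'
  proof (intro Set.set_eqI iffI)
    fix v assume "v \<in> d (Suc i) ` carrier (F (Suc (Suc i)))"
    then have "v \<in> carrier (F (Suc i))" "v \<in> d (Suc i) ` carrier (F (Suc (Suc i)))" using im by auto
    then show "v \<in> {v \<in> carrier (F (Suc i)). d i v = \<zero>\<^bsub>F i\<^esub>}" by (simp add: assms(6))
  next
    fix v assume "v \<in> {v \<in> carrier (F (Suc i)). d i v = \<zero>\<^bsub>F i\<^esub>}"
    then show "v \<in> d (Suc i) ` carrier (F (Suc (Suc i)))" using assms(6)[of v i] by simp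
  qed
  show ?thesis
    unfolding resolution_def by (intro conjI allI assms(1-3) 1 2 3)
qed

text \<open>The induction of the comparison theorem. The lifting of a single map is left to \<open>base\<close> and
  \<open>step\<close>, so that it may come from a free module, from a projective module, or respect a grading;
  \<open>S\<close> is what one step guarantees to the next.\<close>

lemma comparison_map:
  fixes P :: "nat \<Rightarrow> (('n,'k::field) mpoly, 'p) module" and Q :: "nat \<Rightarrow> (('n,'k) mpoly, 'q) module"
    and L :: "(('n,'k) mpoly, 'a) module"
  assumes P: "resolution poly_ring P d \<epsilon> L" and Q: "resolution poly_ring Q d' \<epsilon>' L"
    and L: "Module.module poly_ring L"
    and base: "\<exists>\<phi>\<in>linear_maps poly_ring (P 0) (Q 0). S 0 \<phi> \<and> (\<forall>v\<in>carrier (P 0). \<epsilon>' (\<phi> v) = \<epsilon> v)"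
    and step: "\<And>i \<psi>. \<psi> \<in> linear_maps poly_ring (P i) (Q i) \<Longrightarrow> S i \<psi> \<Longrightarrow>
      (\<And>v. v \<in> carrier (P (Suc i)) \<Longrightarrow> \<psi> (d i v) \<in> d' i ` carrier (Q (Suc i))) \<Longrightarrow>
      \<exists>\<phi>\<in>linear_maps poly_ring (P (Suc i)) (Q (Suc i)). S (Suc i) \<phi> \<and>
        (\<forall>v\<in>carrier (P (Suc i)). d' i (\<phi> v) = \<psi> (d i v))"
  shows "\<exists>\<phi>. (\<forall>i. \<phi> i \<in> linear_maps poly_ring (P i) (Q i) \<and> S i (\<phi> i)) \<and>
    (\<forall>v\<in>carrier (P 0). \<epsilon>' (\<phi> 0 v) = \<epsilon> v) \<and>
    (\<forall>i. \<forall>v\<in>carrier (P (Suc i)). d' i (\<phi> (Suc i) v) = \<phi> i (d i v))"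
proof -
  \<comment> \<open>Besides linearity, the induction carries that cycles go to cycles, by which the next step can be lifted.\<close>
  define good where "good i \<psi> \<longleftrightarrow> \<psi> \<in> linear_maps poly_ring (P i) (Q i) \<and> S i \<psi> \<and>
    (case i of 0 \<Rightarrow> (\<forall>v\<in>carrier (P 0). \<epsilon>' (\<psi> v) = \<epsilon> v)
      | Suc j \<Rightarrow> (\<forall>v\<in>carrier (P (Suc j)). d j v = \<zero>\<^bsub>P j\<^esub> \<longrightarrow> d' j (\<psi> v) = \<zero>\<^bsub>Q j\<^esub>))" for i \<psi>
  have "\<exists>\<phi>. \<forall>i. good i (\<phi> i) \<and>
    (\<forall>v\<in>carrier (P (Suc i)). d' i (\<phi> (Suc i) v) = \<phi> i (d i v))"
  proof (rule dependent_nat_choice)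
    obtain \<phi> where "\<phi> \<in> linear_maps poly_ring (P 0) (Q 0)" "S 0 \<phi>" "\<forall>v\<in>carrier (P 0). \<epsilon>' (\<phi> v) = \<epsilon> v"
      using base by (elim bexE conjE)
    then have "good 0 \<phi>" by (simp add: good_def)
    then show "\<exists>\<phi>. good 0 \<phi>" by (rule exI[of _ \<phi>])
  next
    fix \<psi> i assume \<psi>: "good i \<psi>"
    then have lin: "\<psi> \<in> linear_maps poly_ring (P i) (Q i)" by (simp add: good_def)
    have zero: "\<psi> \<zero>\<^bsub>P i\<^esub> = \<zero>\<^bsub>Q i\<^esub>"
      by (rule linear_maps_zero[OF lin resolutionD(1)[OF P] resolutionD(1)[OF Q]])
    have im: "\<psi> (d i v) \<in> d' i ` carrier (Q (Suc i))" if v: "v \<in> carrier (P (Suc i))" for v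
    proof -
      have dv: "d i v \<in> carrier (P i)" by (rule linear_mapsD(1)[OF resolutionD(3)[OF P] v])
      then have c: "\<psi> (d i v) \<in> carrier (Q i)" by (rule linear_mapsD(1)[OF lin])
      show ?thesis
      proof (cases i)
        case 0
        then have "\<epsilon> (d i v) = \<zero>\<^bsub>L\<^esub>" using resolutionD(5)[OF P, of "d i v"] dv v by auto
        then show ?thesis using resolutionD(5)[OF Q, of "\<psi> (d i v)"] c \<psi> 0 dv by (auto simp: good_def)
      next
        case (Suc j)
        then have "d j (d i v) = \<zero>\<^bsub>P j\<^esub>" using resolutionD(6)[OF P, of "d i v" j] dv v by auto
        then show ?thesis using resolutionD(6)[OF Q, of "\<psi> (d i v)" j] c \<psi> Suc dv by (auto simp: good_def)
      qed
    qed
    obtain \<phi> where \<phi>: "\<phi> \<in> linear_maps poly_ring (P (Suc i)) (Q (Suc i))" "S (Suc i) \<phi>"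
      "\<And>v. v \<in> carrier (P (Suc i)) \<Longrightarrow> d' i (\<phi> v) = \<psi> (d i v)"
      using step[OF lin _ im] \<psi> by (auto simp: good_def)
    then show "\<exists>\<phi>. good (Suc i) \<phi> \<and> (\<forall>v\<in>carrier (P (Suc i)). d' i (\<phi> v) = \<psi> (d i v))"
      using zero by (intro exI[of _ \<phi>]) (auto simp: good_def)
  qed
  then obtain \<phi> where "\<forall>i. good i (\<phi> i)"
    "\<forall>i. \<forall>v\<in>carrier (P (Suc i)). d' i (\<phi> (Suc i) v) = \<phi> i (d i v)" by blast
  then show ?thesis using \<open>\<forall>i. good i (\<phi> i)\<close>[rule_format, of 0] by (intro exI[of _ \<phi>]) (auto simp: good_def)
qed

lemma comparison_map_projective:
  fixes P :: "nat \<Rightarrow> (('n,'k::field) mpoly, 'p) module" and Q :: "nat \<Rightarrow> (('n,'k) mpoly, 'q) module"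
    and L :: "(('n,'k) mpoly, 'a) module"
  assumes P: "resolution poly_ring P d \<epsilon> L" and Q: "resolution poly_ring Q d' \<epsilon>' L"
    and L: "Module.module poly_ring L" and proj: "\<And>i. projective_module (P i)"
  shows "\<exists>\<phi>. (\<forall>i. \<phi> i \<in> linear_maps poly_ring (P i) (Q i)) \<and>
    (\<forall>v\<in>carrier (P 0). \<epsilon>' (\<phi> 0 v) = \<epsilon> v) \<and>
    (\<forall>i. \<forall>v\<in>carrier (P (Suc i)). d' i (\<phi> (Suc i) v) = \<phi> i (d i v))"
proof -
  have "\<exists>\<phi>\<in>linear_maps poly_ring (P 0) (Q 0). \<forall>v\<in>carrier (P 0). \<epsilon>' (\<phi> v) = \<epsilon> v"
    using resolutionD(4)[OF Q] linear_mapsD(1)[OF resolutionD(2)[OF P]]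
    by (intro projective_lift[OF proj resolutionD(1)[OF Q] L resolutionD(2)[OF Q] resolutionD(2)[OF P]]) auto
  moreover have "\<exists>\<phi>\<in>linear_maps poly_ring (P (Suc i)) (Q (Suc i)).
        (\<forall>v\<in>carrier (P (Suc i)). d' i (\<phi> v) = \<psi> (d i v))"
    if "\<psi> \<in> linear_maps poly_ring (P i) (Q i)"
      "\<And>v. v \<in> carrier (P (Suc i)) \<Longrightarrow> \<psi> (d i v) \<in> d' i ` carrier (Q (Suc i))" for i \<psi>
    by (rule projective_lift[OF proj resolutionD(1)[OF Q] resolutionD(1)[OF Q] resolutionD(3)[OF Q]
          linear_maps_comp[OF resolutionD(3)[OF P] that(1)]]) (use that(2) in auto)
  ultimately show ?thesis using comparison_map[OF P Q L, of "\<lambda>_ _. True"] by auto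
qed

text \<open>The difference of \<open>\<theta>\<close> and the identity lifts the zero map of \<open>L\<close>. The homotopy is chosen on
  the basis: once \<open>h\<close> is known in degree \<open>i\<close>, the vector \<open>v - \<theta> v - h (d v)\<close> in degree \<open>i + 1\<close> is
  a cycle, hence a boundary.\<close>

lemma free_homotopy:
  fixes X :: "nat \<Rightarrow> 'x set" and L :: "(('n,'k::field) mpoly, 'a) module"
  assumes F: "resolution poly_ring (\<lambda>i. free_module (X i)) d \<epsilon> L"
    and L: "Module.module poly_ring L"
    and lin: "\<And>i. \<theta> i \<in> linear_maps poly_ring (free_module (X i)) (free_module (X i))"
    and aug: "\<And>v. keys v \<subseteq> X 0 \<Longrightarrow> \<epsilon> (\<theta> 0 v) = \<epsilon> v"
    and comm: "\<And>i v. keys v \<subseteq> X (Suc i) \<Longrightarrow> d i (\<theta> (Suc i) v) = \<theta> i (d i v)"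
  shows "\<exists>h. (\<forall>i. h i \<in> linear_maps poly_ring (free_module (X i)) (free_module (X (Suc i)))) \<and>
    (\<forall>v. keys v \<subseteq> X 0 \<longrightarrow> v - \<theta> 0 v = d 0 (h 0 v)) \<and>
    (\<forall>i v. keys v \<subseteq> X (Suc i) \<longrightarrow> v - \<theta> (Suc i) v = d (Suc i) (h (Suc i) v) + h i (d i v))"
proof -
  interpret L: Module.module poly_ring L by fact
  note d = resolutionD(3)[OF F]
  have dD: "keys (d i v) \<subseteq> X i" if "keys v \<subseteq> X (Suc i)" for i v
    using linear_mapsD(1)[OF d, of v] that by auto
  have \<theta>D: "keys (\<theta> i v) \<subseteq> X i" if "keys v \<subseteq> X i" for i v
    using linear_mapsD(1)[OF lin, of v] that by auto
  have minus: "h (u - v) = h u - h v"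
    if "h \<in> linear_maps poly_ring (free_module A) (free_module B)" "keys u \<subseteq> A" "keys v \<subseteq> A"
    for h :: "('x \<Rightarrow>\<^sub>0 ('n,'k) mpoly) \<Rightarrow> 'x \<Rightarrow>\<^sub>0 ('n,'k) mpoly" and A B u v
  proof -
    have "keys (u - v) \<subseteq> A" using keys_minus[of u v] that(2,3) by blast
    then have "h (u - v) + h v = h ((u - v) + v)"
      using linear_mapsD(2)[OF that(1), of "u - v" v] that(2,3) by simp
    then show ?thesis by (simp add: eq_diff_eq)
  qed
  \<comment> \<open>On boundaries the term \<open>h (d v)\<close> of the homotopy equation vanishes; the last conjunct is what makes the next vector a cycle.\<close>
  define good where "good i h \<longleftrightarrow> h \<in> linear_maps poly_ring (free_module (X i)) (free_module (X (Suc i))) \<and>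
    (i = 0 \<longrightarrow> (\<forall>v. keys v \<subseteq> X 0 \<longrightarrow> v - \<theta> 0 v = d 0 (h v))) \<and>
    (\<forall>v. v \<in> d i ` {v. keys v \<subseteq> X (Suc i)} \<longrightarrow> v - \<theta> i v = d i (h v))" for i h
  have "\<exists>h. \<forall>i. good i (h i) \<and>
    (\<forall>v. keys v \<subseteq> X (Suc i) \<longrightarrow> v - \<theta> (Suc i) v = d (Suc i) (h (Suc i) v) + h i (d i v))"
  proof (rule dependent_nat_choice)
    have diff: "(\<lambda>v. v - \<theta> 0 v) \<in> linear_maps poly_ring (free_module (X 0)) (free_module (X 0))"
    proof (rule linear_mapsI)
      fix v :: "'x \<Rightarrow>\<^sub>0 ('n,'k) mpoly" assume "v \<in> carrier (free_module (X 0))"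
      then show "v - \<theta> 0 v \<in> carrier (free_module (X 0))"
        using keys_minus[of v "\<theta> 0 v"] \<theta>D[of v 0] by auto
    next
      fix u v :: "'x \<Rightarrow>\<^sub>0 ('n,'k) mpoly"
      assume "u \<in> carrier (free_module (X 0))" "v \<in> carrier (free_module (X 0))"
      then show "u \<oplus>\<^bsub>free_module (X 0)\<^esub> v - \<theta> 0 (u \<oplus>\<^bsub>free_module (X 0)\<^esub> v)
        = (u - \<theta> 0 u) \<oplus>\<^bsub>free_module (X 0)\<^esub> (v - \<theta> 0 v)"
        using linear_mapsD(2)[OF lin[of 0], of u v] by simp
    next
      fix a :: "('n,'k) mpoly" and v :: "'x \<Rightarrow>\<^sub>0 ('n,'k) mpoly"
      assume "v \<in> carrier (free_module (X 0))"
      then show "a \<odot>\<^bsub>free_module (X 0)\<^esub> v - \<theta> 0 (a \<odot>\<^bsub>free_module (X 0)\<^esub> v)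
        = a \<odot>\<^bsub>free_module (X 0)\<^esub> (v - \<theta> 0 v)"
        using linear_mapsD(3)[OF lin[of 0], of a v] by (simp add: scal_minus)
    qed
    have "\<exists>y\<in>carrier (free_module (X (Suc 0))). d 0 y = single x 1 - \<theta> 0 (single x 1) \<and> True"
      if "x \<in> X 0" for x
    proof -
      let ?e = "single x 1" let ?v = "?e - \<theta> 0 ?e"
      have k: "keys ?e \<subseteq> X 0" using that by simp
      then have kv: "keys ?v \<subseteq> X 0" using keys_minus[of ?e "\<theta> 0 ?e"] \<theta>D[of ?e 0] by blast
      have "\<epsilon> (?v + \<theta> 0 ?e) = \<epsilon> ?v \<oplus>\<^bsub>L\<^esub> \<epsilon> (\<theta> 0 ?e)"
        using linear_mapsD(2)[OF resolutionD(2)[OF F], of ?v "\<theta> 0 ?e"] kv \<theta>D[OF k] by simp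
      then have "\<epsilon> ?v \<oplus>\<^bsub>L\<^esub> \<epsilon> ?e = \<epsilon> ?e" using aug[OF k] by simp
      then have "\<epsilon> ?v = \<zero>\<^bsub>L\<^esub>"
        using linear_mapsD(1)[OF resolutionD(2)[OF F], of ?v] linear_mapsD(1)[OF resolutionD(2)[OF F], of ?e] kv k
          L.add.r_cancel_one[of "\<epsilon> ?e" "\<epsilon> ?v"] that by auto
      then show ?thesis using resolutionD(5)[OF F, of ?v] kv by auto
    qed
    then obtain h where h: "h \<in> linear_maps poly_ring (free_module (X 0)) (free_module (X (Suc 0)))"
      "\<And>v. keys v \<subseteq> X 0 \<Longrightarrow> d 0 (h v) = v - \<theta> 0 v"
      using free_lift[OF free_module_is_module free_module_is_module d diff, of "\<lambda>_ _. True"] by auto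
    then have "good 0 h" using dD[of _ 0] by (auto simp: good_def)
    then show "\<exists>h. good 0 h" by (rule exI[of _ h])
  next
    fix h i assume "good i h"
    then have h: "h \<in> linear_maps poly_ring (free_module (X i)) (free_module (X (Suc i)))"
      and hd: "\<And>v. keys v \<subseteq> X (Suc i) \<Longrightarrow> d i v - \<theta> i (d i v) = d i (h (d i v))"
      by (auto simp: good_def)
    have hdk: "keys (h (d i v)) \<subseteq> X (Suc i)" if "keys v \<subseteq> X (Suc i)" for v
      using linear_mapsD(1)[OF h, of "d i v"] dD[OF that] by simp
    let ?r = "\<lambda>v. (v - \<theta> (Suc i) v) - h (d i v)"
    have kr: "keys (?r v) \<subseteq> X (Suc i)" if "keys v \<subseteq> X (Suc i)" for v
      using keys_minus[of v "\<theta> (Suc i) v"] keys_minus[of "v - \<theta> (Suc i) v" "h (d i v)"]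
        \<theta>D[OF that] hdk[OF that] that by blast
    have r: "?r \<in> linear_maps poly_ring (free_module (X (Suc i))) (free_module (X (Suc i)))"
    proof (rule linear_mapsI)
      fix u v :: "'x \<Rightarrow>\<^sub>0 ('n,'k) mpoly"
      assume "u \<in> carrier (free_module (X (Suc i)))" "v \<in> carrier (free_module (X (Suc i)))"
      then show "?r (u \<oplus>\<^bsub>free_module (X (Suc i))\<^esub> v) = ?r u \<oplus>\<^bsub>free_module (X (Suc i))\<^esub> ?r v"
        using linear_mapsD(2)[OF lin[of "Suc i"], of u v] linear_mapsD(2)[OF linear_maps_comp[OF d[of i] h], of u v]
        by simp
    next
      fix a :: "('n,'k) mpoly" and v :: "'x \<Rightarrow>\<^sub>0 ('n,'k) mpoly"
      assume "v \<in> carrier (free_module (X (Suc i)))"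
      then show "?r (a \<odot>\<^bsub>free_module (X (Suc i))\<^esub> v) = a \<odot>\<^bsub>free_module (X (Suc i))\<^esub> ?r v"
        using linear_mapsD(3)[OF lin[of "Suc i"], of a v] linear_mapsD(3)[OF linear_maps_comp[OF d[of i] h], of a v]
        by (simp add: scal_minus)
    qed (use kr in auto)
    have "\<exists>y\<in>carrier (free_module (X (Suc (Suc i)))). d (Suc i) y = ?r (single x 1) \<and> True"
      if "x \<in> X (Suc i)" for x
    proof -
      let ?e = "single x 1"
      have k: "keys ?e \<subseteq> X (Suc i)" using that by simp
      have "d i (?r ?e) = (d i ?e - d i (\<theta> (Suc i) ?e)) - d i (h (d i ?e))"
      proof -
        have "keys (?e - \<theta> (Suc i) ?e) \<subseteq> X (Suc i)"
          using keys_minus[of ?e "\<theta> (Suc i) ?e"] \<theta>D[OF k] k by blast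
        then show ?thesis
          using minus[OF d, of "?e - \<theta> (Suc i) ?e" i "h (d i ?e)"] minus[OF d, of ?e i "\<theta> (Suc i) ?e"]
            \<theta>D[OF k] hdk[OF k] that by simp
      qed
      also have "\<dots> = 0" using hd[OF k] comm[OF k] by simp
      finally show ?thesis using resolutionD(6)[OF F, of "?r ?e" i] kr[OF k] by auto
    qed
    then obtain h' where h': "h' \<in> linear_maps poly_ring (free_module (X (Suc i))) (free_module (X (Suc (Suc i))))"
      "\<And>v. keys v \<subseteq> X (Suc i) \<Longrightarrow> d (Suc i) (h' v) = ?r v"
      using free_lift[OF free_module_is_module free_module_is_module d r, of "\<lambda>_ _. True"] by auto
    have h0: "h 0 = 0"
      using linear_maps_zero[OF h free_module_is_module free_module_is_module] by simp
    have "v - \<theta> (Suc i) v = d (Suc i) (h' v)" if "v \<in> d (Suc i) ` {v. keys v \<subseteq> X (Suc (Suc i))}" for v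
    proof -
      have "keys v \<subseteq> X (Suc i)" using that dD[of _ "Suc i"] by auto
      moreover from this have "d i v = 0" using resolutionD(6)[OF F, of v i] that by auto
      ultimately show ?thesis using h'(2)[of v] h0 by simp
    qed
    then have "good (Suc i) h'" using h'(1) by (auto simp: good_def)
    then show "\<exists>h'. good (Suc i) h' \<and>
      (\<forall>v. keys v \<subseteq> X (Suc i) \<longrightarrow> v - \<theta> (Suc i) v = d (Suc i) (h' v) + h (d i v))"
      using h'(2) by (intro exI[of _ h']) auto
  qed
  then obtain h where "\<forall>i. good i (h i)"
    "\<forall>i v. keys v \<subseteq> X (Suc i) \<longrightarrow> v - \<theta> (Suc i) v = d (Suc i) (h (Suc i) v) + h i (d i v)" by blast
  then show ?thesis by (intro exI[of _ h]) (auto simp: good_def)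
qed


text \<open>The irrelevant ideal consists of the polynomials with constant coefficient \<open>0\<close>, so this is
  the vanishing of all differentials modulo that ideal.\<close>

definition minimal_differentials ::
    "(nat \<Rightarrow> 'x set) \<Rightarrow> (nat \<Rightarrow> ('x \<Rightarrow>\<^sub>0 ('n,'k::field) mpoly) \<Rightarrow> 'x \<Rightarrow>\<^sub>0 ('n,'k) mpoly) \<Rightarrow> bool" where
  "minimal_differentials X d \<longleftrightarrow> (\<forall>i v y. keys v \<subseteq> X (Suc i) \<longrightarrow> lookup (lookup (d i v) y) 0 = 0)"

lemma lookup_mult_zero:
  fixes f g :: "('n, 'k::field) mpoly"
  shows "lookup (f * g) 0 = lookup f 0 * lookup g 0"
proof -
  have "keys f \<subseteq> UNIV" by simp
  then show ?thesis
  proof (induction rule: poly_mapping_add_induct)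
    case (single a r)
    have "keys g \<subseteq> UNIV" by simp
    then show ?case
    proof (induction rule: poly_mapping_add_induct)
      case (single b s)
      have "a + b = 0 \<longleftrightarrow> a = 0 \<and> b = 0"
        by (auto simp: poly_mapping_eq_iff fun_eq_iff lookup_add)
      then show ?case by (auto simp: mult_single lookup_single when_def)
    qed (auto simp: algebra_simps lookup_add)
  qed (auto simp: algebra_simps lookup_add)
qed

lemma linear_maps_const_zero:
  fixes v :: "'x \<Rightarrow>\<^sub>0 ('n, 'k::field) mpoly"
  assumes h: "h \<in> linear_maps poly_ring (free_module X) (free_module Y)"
    and v: "keys v \<subseteq> X" "\<And>x. lookup (lookup v x) 0 = 0"
  shows "lookup (lookup (h v) y) 0 = 0"
proof -
  have "h v = h (\<Sum>x\<in>keys v. single x (lookup v x))"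
    using poly_mapping_sum_singles[of "keys v" v] by simp
  also have "\<dots> = (\<Sum>x\<in>keys v. h (single x (lookup v x)))"
    using v(1) by (intro linear_maps_free_sum[OF h, THEN conjunct1]) auto
  also have "\<dots> = (\<Sum>x\<in>keys v. scal (lookup v x) (h (single x 1)))"
    using linear_mapsD(3)[OF h, of _ "single _ 1"] v(1) by (intro sum.cong) auto
  finally show ?thesis using v(2) by (simp add: lookup_sum lookup_mult_zero)
qed

text \<open>By \<open>free_homotopy\<close> the difference of \<open>\<theta>\<close> and the identity is \<open>d h + h d\<close>, which vanishes modulo the
  irrelevant ideal because \<open>d\<close> does.\<close>

lemma minimal_self_map_const:
  fixes X :: "nat \<Rightarrow> 'x set" and L :: "(('n,'k::field) mpoly, 'a) module"
  assumes F: "resolution poly_ring (\<lambda>i. free_module (X i)) d \<epsilon> L"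
    and L: "Module.module poly_ring L" and minimal: "minimal_differentials X d"
    and lin: "\<And>i. \<theta> i \<in> linear_maps poly_ring (free_module (X i)) (free_module (X i))"
    and aug: "\<And>v. keys v \<subseteq> X 0 \<Longrightarrow> \<epsilon> (\<theta> 0 v) = \<epsilon> v"
    and comm: "\<And>i v. keys v \<subseteq> X (Suc i) \<Longrightarrow> d i (\<theta> (Suc i) v) = \<theta> i (d i v)"
    and x: "x \<in> X i"
  shows "lookup (lookup (\<theta> i (single x 1)) x) 0 = 1"
proof -
  obtain h where h: "\<And>i. h i \<in> linear_maps poly_ring (free_module (X i)) (free_module (X (Suc i)))"
    and h0: "\<And>v. keys v \<subseteq> X 0 \<Longrightarrow> v - \<theta> 0 v = d 0 (h 0 v)"
    and hS: "\<And>i v. keys v \<subseteq> X (Suc i) \<Longrightarrow> v - \<theta> (Suc i) v = d (Suc i) (h (Suc i) v) + h i (d i v)"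
    using free_homotopy[OF F L lin aug comm] by auto
  let ?e = "single x 1 :: 'x \<Rightarrow>\<^sub>0 ('n,'k) mpoly"
  have k: "keys ?e \<subseteq> X i" using x by simp
  have hk: "keys (h i ?e) \<subseteq> X (Suc i)" using linear_mapsD(1)[OF h, of ?e] k by simp
  have dz: "lookup (lookup (d i v) y) 0 = 0" if "keys v \<subseteq> X (Suc i)" for i v y
    using minimal that unfolding minimal_differentials_def by blast
  have "lookup (lookup (?e - \<theta> i ?e) x) 0 = 0"
  proof (cases i)
    case 0
    then show ?thesis using h0 k hk dz by auto
  next
    case (Suc j)
    have dk: "keys (d j ?e) \<subseteq> X j"
      using linear_mapsD(1)[OF resolutionD(3)[OF F], of ?e j] k Suc by simp
    have "lookup (lookup (h j (d j ?e)) x) 0 = 0"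
      using k Suc dz by (intro linear_maps_const_zero[OF h dk]) auto
    then show ?thesis using hS[of ?e j] k hk Suc dz[of "h i ?e" i] by (simp add: lookup_add)
  qed
  then show ?thesis by (simp add: lookup_minus)
qed

lemma comparison_map_free:
  fixes X :: "nat \<Rightarrow> 'x set" and Q :: "nat \<Rightarrow> (('n,'k::field) mpoly, 'q) module"
    and L :: "(('n,'k) mpoly, 'a) module"
  assumes F: "resolution poly_ring (\<lambda>i. free_module (X i)) d \<epsilon> L" and Q: "resolution poly_ring Q d' \<epsilon>' L"
    and L: "Module.module poly_ring L"
  shows "\<exists>\<phi>. (\<forall>i. \<phi> i \<in> linear_maps poly_ring (free_module (X i)) (Q i)) \<and>
    (\<forall>v. keys v \<subseteq> X 0 \<longrightarrow> \<epsilon>' (\<phi> 0 v) = \<epsilon> v) \<and>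
    (\<forall>i v. keys v \<subseteq> X (Suc i) \<longrightarrow> d' i (\<phi> (Suc i) v) = \<phi> i (d i v))"
proof -
  have "\<exists>\<phi>. (\<forall>i. \<phi> i \<in> linear_maps poly_ring (free_module (X i)) (Q i) \<and> True) \<and>
    (\<forall>v\<in>carrier (free_module (X 0)). \<epsilon>' (\<phi> 0 v) = \<epsilon> v) \<and>
    (\<forall>i. \<forall>v\<in>carrier (free_module (X (Suc i))). d' i (\<phi> (Suc i) v) = \<phi> i (d i v))"
  proof (rule comparison_map[OF F Q L])
    have "\<exists>y\<in>carrier (Q 0). \<epsilon>' y = \<epsilon> (single x 1) \<and> True" if "x \<in> X 0" for x
    proof -
      have "\<epsilon> (single x 1) \<in> \<epsilon>' ` carrier (Q 0)"
        unfolding resolutionD(4)[OF Q] using that by (intro linear_mapsD(1)[OF resolutionD(2)[OF F]]) simp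
      then show ?thesis by auto
    qed
    from free_lift[OF resolutionD(1)[OF Q] L resolutionD(2)[OF Q] resolutionD(2)[OF F] this]
    show "\<exists>\<phi>\<in>linear_maps poly_ring (free_module (X 0)) (Q 0). True \<and>
      (\<forall>v\<in>carrier (free_module (X 0)). \<epsilon>' (\<phi> v) = \<epsilon> v)" by simp
  next
    fix i \<psi> assume \<psi>: "\<psi> \<in> linear_maps poly_ring (free_module (X i)) (Q i)"
      and im: "\<And>v. v \<in> carrier (free_module (X (Suc i))) \<Longrightarrow> \<psi> (d i v) \<in> d' i ` carrier (Q (Suc i))"
    have "\<exists>y\<in>carrier (Q (Suc i)). d' i y = \<psi> (d i (single x 1)) \<and> True" if "x \<in> X (Suc i)" for x
      using im[of "single x 1"] that by auto
    from free_lift[OF resolutionD(1)[OF Q] resolutionD(1)[OF Q] resolutionD(3)[OF Q]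
        linear_maps_comp[OF resolutionD(3)[OF F] \<psi>] this]
    show "\<exists>\<phi>\<in>linear_maps poly_ring (free_module (X (Suc i))) (Q (Suc i)). True \<and>
      (\<forall>v\<in>carrier (free_module (X (Suc i))). d' i (\<phi> v) = \<psi> (d i v))" by simp
  qed
  then show ?thesis by simp
qed

text \<open>Comparison maps in both directions compose to a self-map of the minimal resolution. In
  degree \<open>i\<close> it factors through \<open>P i = 0\<close>, but it is the identity modulo the irrelevant ideal.\<close>

theorem minimal_resolution_length:
  fixes X :: "nat \<Rightarrow> 'x set" and L :: "(('n,'k::field) mpoly, 'a) module"
    and P :: "nat \<Rightarrow> (('n,'k::field) mpoly, 'p) module"
  assumes F: "resolution poly_ring (\<lambda>i. free_module (X i)) d \<epsilon> L"
    and L: "Module.module poly_ring L" and minimal: "minimal_differentials X d"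
    and P: "resolution poly_ring P d' \<epsilon>' L" and proj: "\<And>i. projective_module (P i)"
    and zero: "carrier (P i) = {\<zero>\<^bsub>P i\<^esub>}"
  shows "X i = {}"
proof (rule ccontr)
  assume "X i \<noteq> {}"
  then obtain x where x: "x \<in> X i" by blast
  obtain \<phi> where \<phi>': "\<forall>i. \<phi> i \<in> linear_maps poly_ring (free_module (X i)) (P i)"
    "\<forall>v. keys v \<subseteq> X 0 \<longrightarrow> \<epsilon>' (\<phi> 0 v) = \<epsilon> v"
    "\<forall>i v. keys v \<subseteq> X (Suc i) \<longrightarrow> d' i (\<phi> (Suc i) v) = \<phi> i (d i v)"
    using comparison_map_free[OF F P L] by (elim exE conjE)
  note \<phi> = \<phi>'[rule_format]
  obtain \<psi> where \<psi>: "\<forall>i. \<psi> i \<in> linear_maps poly_ring (P i) (free_module (X i))"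
    "\<forall>v\<in>carrier (P 0). \<epsilon> (\<psi> 0 v) = \<epsilon>' v"
    "\<forall>i. \<forall>v\<in>carrier (P (Suc i)). d i (\<psi> (Suc i) v) = \<psi> i (d' i v)"
    using comparison_map_projective[OF P F L proj] by (elim exE conjE)
  have \<phi>c: "\<phi> i v \<in> carrier (P i)" if "keys v \<subseteq> X i" for i v
    using linear_mapsD(1)[OF \<phi>(1), of v] that by simp
  have "lookup (lookup (\<psi> i (\<phi> i (single x 1))) x) 0 = 1"
    by (rule minimal_self_map_const[OF F L minimal, where \<theta> = "\<lambda>i v. \<psi> i (\<phi> i v)"])
      (use \<phi>(2,3) \<psi>(2,3) \<phi>c x linear_maps_comp[OF \<phi>(1) \<psi>(1)[rule_format]] in auto)
  moreover have "\<phi> i (single x 1) = \<zero>\<^bsub>P i\<^esub>" using \<phi>c[of "single x 1" i] x zero by simp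
  moreover have "\<psi> i \<zero>\<^bsub>P i\<^esub> = 0"
    using linear_maps_zero[OF \<psi>(1)[rule_format] resolutionD(1)[OF P] free_module_is_module] by simp
  ultimately show False by simp
qed

subsection \<open>Graded comparison\<close>

text \<open>The component of degree \<open>e\<close> of the graded free module whose basis element \<open>x\<close> has degree \<open>g
  x\<close>.\<close>

definition graded_part :: "'x set \<Rightarrow> ('x \<Rightarrow> nat) \<Rightarrow> nat \<Rightarrow> ('x \<Rightarrow>\<^sub>0 ('n::finite, 'k::field) mpoly) set" where
  "graded_part X g e = {v. keys v \<subseteq> X \<and>
    (\<forall>y\<in>X. \<forall>a\<in>keys (lookup v y). total_degree a + g y = e)}"

lift_definition keep :: "('x \<Rightarrow> bool) \<Rightarrow> ('x \<Rightarrow>\<^sub>0 'b::zero) \<Rightarrow> 'x \<Rightarrow>\<^sub>0 'b" is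
  "\<lambda>P f x. if P x then f x else 0"
  by (erule rev_finite_subset) auto

lemma lookup_keep [simp]: "lookup (keep P f) x = (if P x then lookup f x else 0)"
  by transfer simp

lemma keep_zero [simp]: "keep P 0 = 0"
  by (rule poly_mapping_eqI) simp

lift_definition graded_proj ::
    "('x \<Rightarrow> nat) \<Rightarrow> nat \<Rightarrow> ('x \<Rightarrow>\<^sub>0 ('n::finite, 'k::field) mpoly) \<Rightarrow> 'x \<Rightarrow>\<^sub>0 ('n, 'k) mpoly" is
  "\<lambda>g e v x. keep (\<lambda>a. total_degree a + g x = e) (v x)"
proof -
  fix g :: "'x \<Rightarrow> nat" and e and v :: "'x \<Rightarrow> ('n, 'k) mpoly"
  assume "finite {x. v x \<noteq> 0}"
  then show "finite {x. keep (\<lambda>a. total_degree a + g x = e) (v x) \<noteq> 0}"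
    by (rule rev_finite_subset) auto
qed

lemma lookup_graded_proj [simp]:
  "lookup (graded_proj g e v) x = keep (\<lambda>a. total_degree a + g x = e) (lookup v x)"
  by transfer simp

lemma keys_graded_proj: "keys (graded_proj g e v) \<subseteq> keys v"
  by (auto simp: in_keys_iff)

lemma keys_graded_proj_subset: "keys v \<subseteq> X \<Longrightarrow> keys (graded_proj g e v) \<subseteq> X"
  by (rule order_trans[OF keys_graded_proj])

lemma graded_proj_add: "graded_proj g e (u + v) = graded_proj g e u + graded_proj g e v"
  by (intro poly_mapping_eqI) (simp add: lookup_add)

lemma graded_proj_in: "keys v \<subseteq> X \<Longrightarrow> graded_proj g e v \<in> graded_part X g e"
  using keys_graded_proj[of g e v] by (auto simp: graded_part_def in_keys_iff split: if_splits)

lemma graded_part_add: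
  assumes p: "p \<in> graded_part Y g e" and q: "q \<in> graded_part Y g e"
  shows "p + q \<in> graded_part Y g e"
proof -
  have "total_degree a + g y = e" if "y \<in> Y" "a \<in> keys (lookup p y + lookup q y)" for y a
  proof -
    have "a \<in> keys (lookup p y) \<or> a \<in> keys (lookup q y)"
      using that(2) keys_add[of "lookup p y" "lookup q y"] by blast
    then show ?thesis using p q that(1) by (auto simp: graded_part_def)
  qed
  moreover have "keys (p + q) \<subseteq> Y"
    using p q by (intro order_trans[OF keys_add]) (auto simp: graded_part_def)
  ultimately show ?thesis by (auto simp: graded_part_def lookup_add)
qed

lemma graded_proj_of_graded:
  assumes "v \<in> graded_part X g e"
  shows "graded_proj g e' v = (if e = e' then v else 0)"
proof (intro poly_mapping_eqI)
  fix x a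
  show "lookup (lookup (graded_proj g e' v) x) a = lookup (lookup (if e = e' then v else 0) x) a"
  proof (cases "x \<in> X \<and> a \<in> keys (lookup v x)")
    case True
    then have "total_degree a + g x = e" using assms by (auto simp: graded_part_def)
    then show ?thesis by simp
  next
    case False
    then have "lookup (lookup v x) a = 0"
      using assms by (cases "x \<in> X") (auto simp: graded_part_def in_keys_iff subset_iff, metis lookup_zero)
    then show ?thesis by simp
  qed
qed

lemma single_in_graded_part:
  assumes "x \<in> X" shows "single x (single a k) \<in> graded_part X g (total_degree a + g x)"
  using assms by (auto simp: graded_part_def lookup_single when_def split: if_splits)

lemma graded_proj_commute:
  fixes f :: "('x \<Rightarrow>\<^sub>0 ('n::finite,'k::field) mpoly) \<Rightarrow> 'y \<Rightarrow>\<^sub>0 ('n,'k) mpoly"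
  assumes f: "f \<in> linear_maps poly_ring (free_module X) (free_module Y)"
    and gr: "\<And>e. f ` graded_part X g e \<subseteq> graded_part Y g' e" and v: "keys v \<subseteq> X"
  shows "f (graded_proj g e v) = graded_proj g' e (f v)"
  using v
proof (induction rule: mpoly_vector_induct)
  case zero
  have "f 0 = 0" using linear_maps_zero[OF f free_module_is_module free_module_is_module] by simp
  moreover have "graded_proj g e 0 = (0 :: 'x \<Rightarrow>\<^sub>0 ('n,'k) mpoly)"
    "graded_proj g' e 0 = (0 :: 'y \<Rightarrow>\<^sub>0 ('n,'k) mpoly)" by (rule poly_mapping_eqI; simp)+
  ultimately show ?case by simp
next
  case (single x a k)
  have s: "single x (single a k) \<in> graded_part X g (total_degree a + g x)"
    by (rule single_in_graded_part[OF single])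
  then have "f (single x (single a k)) \<in> graded_part Y g' (total_degree a + g x)"
    by (intro subsetD[OF gr] imageI)
  moreover have "f 0 = 0" using linear_maps_zero[OF f free_module_is_module free_module_is_module] by simp
  ultimately show ?case
    using graded_proj_of_graded[OF s, of e]
      graded_proj_of_graded[of "f (single x (single a k))" Y g' "total_degree a + g x" e] by auto
next
  case (add u v)
  have "keys (graded_proj g e u) \<subseteq> X" "keys (graded_proj g e v) \<subseteq> X"
    by (rule keys_graded_proj_subset, fact)+
  then show ?case using add linear_mapsD(2)[OF f, of "graded_proj g e u" "graded_proj g e v"]
      linear_mapsD(2)[OF f, of u v] by (simp add: graded_proj_add)
qed

text \<open>Independence of the components is stated by additive projections to them, because it is used by
  projecting an equation in \<open>L\<close> to one degree.\<close>

definition separated :: "('r, 'a) module \<Rightarrow> (nat \<Rightarrow> 'a set) \<Rightarrow> bool" where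
  "separated L H \<longleftrightarrow> (\<exists>p. (\<forall>e. \<forall>x\<in>carrier L. \<forall>y\<in>carrier L. p e (x \<oplus>\<^bsub>L\<^esub> y) = p e x \<oplus>\<^bsub>L\<^esub> p e y) \<and>
    (\<forall>e e'. \<forall>x\<in>H e. p e' x = (if e' = e then x else \<zero>\<^bsub>L\<^esub>)))"

text \<open>A preimage of a homogeneous element may be replaced by its component of the same degree:
  project both sides of \<open>\<epsilon> v = \<Sum> \<epsilon> (component of v)\<close>.\<close>

lemma augmentation_graded_proj:
  fixes \<epsilon> :: "('x \<Rightarrow>\<^sub>0 ('n::finite,'k::field) mpoly) \<Rightarrow> 'a" and L :: "(('n,'k) mpoly, 'a) module"
  assumes L: "Module.module poly_ring L" and sep: "separated L H"
    and \<epsilon>: "\<epsilon> \<in> linear_maps poly_ring (free_module X) L" and gr: "\<And>e. \<epsilon> ` graded_part X g e \<subseteq> H e"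
    and v: "keys v \<subseteq> X" and \<epsilon>v: "\<epsilon> v \<in> H e"
  shows "\<epsilon> (graded_proj g e v) = \<epsilon> v"
proof -
  obtain p where p: "\<forall>e. \<forall>x\<in>carrier L. \<forall>y\<in>carrier L. p e (x \<oplus>\<^bsub>L\<^esub> y) = p e x \<oplus>\<^bsub>L\<^esub> p e y"
    "\<forall>e e'. \<forall>x\<in>H e. p e' x = (if e' = e then x else \<zero>\<^bsub>L\<^esub>)"
    using sep unfolding separated_def by (elim exE conjE)
  note padd = p(1)[rule_format] and pH = p(2)[rule_format]
  note \<epsilon>0 = linear_maps_zero[OF \<epsilon> free_module_is_module L, simplified]
  have "\<epsilon> (graded_proj g e v) = p e (\<epsilon> v)"
    using v
  proof (induction rule: mpoly_vector_induct)
    case zero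
    have "(0 :: 'x \<Rightarrow>\<^sub>0 ('n,'k) mpoly) \<in> graded_part X g e" by (simp add: graded_part_def)
    then have "\<epsilon> 0 \<in> H e" by (intro subsetD[OF gr] imageI)
    moreover have "graded_proj g e 0 = (0 :: 'x \<Rightarrow>\<^sub>0 ('n,'k) mpoly)" by (rule poly_mapping_eqI; simp)
    ultimately show ?case using pH[of "\<epsilon> 0" e e] by simp
  next
    case (single x a k)
    have s: "single x (single a k) \<in> graded_part X g (total_degree a + g x)"
      by (rule single_in_graded_part[OF single])
    then have "\<epsilon> (single x (single a k)) \<in> H (total_degree a + g x)"
      by (intro subsetD[OF gr] imageI)
    from pH[OF this, of e] show ?case using graded_proj_of_graded[OF s, of e] \<epsilon>0 by auto
  next
    case (add u v)
    have "keys (graded_proj g e u) \<subseteq> X" "keys (graded_proj g e v) \<subseteq> X"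
      by (rule keys_graded_proj_subset, fact)+
    moreover have "\<epsilon> u \<in> carrier L" "\<epsilon> v \<in> carrier L"
      using linear_mapsD(1)[OF \<epsilon>, of u] linear_mapsD(1)[OF \<epsilon>, of v] add by auto
    ultimately show ?case using add linear_mapsD(2)[OF \<epsilon>, of "graded_proj g e u" "graded_proj g e v"]
        linear_mapsD(2)[OF \<epsilon>, of u v] by (simp add: graded_proj_add padd)
  qed
  then show ?thesis using pH[OF \<epsilon>v, of e] by simp
qed

lemma graded_map_from_basis:
  fixes f :: "('x \<Rightarrow>\<^sub>0 ('n::finite,'k::field) mpoly) \<Rightarrow> 'y \<Rightarrow>\<^sub>0 ('n,'k) mpoly"
  assumes f: "f \<in> linear_maps poly_ring (free_module X) (free_module Y)"
    and gr: "\<And>x. x \<in> X \<Longrightarrow> f (single x 1) \<in> graded_part Y g' (g x)"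
  shows "f ` graded_part X g e \<subseteq> graded_part Y g' e"
proof
  fix w assume "w \<in> f ` graded_part X g e"
  then obtain v where v: "v \<in> graded_part X g e" and w: "w = f v" by blast
  then have k: "keys v \<subseteq> X" by (simp add: graded_part_def)
  have "f (graded_proj g e v) \<in> graded_part Y g' e"
    using k
  proof (induction rule: mpoly_vector_induct)
    case zero
    have "graded_proj g e 0 = (0 :: 'x \<Rightarrow>\<^sub>0 ('n,'k) mpoly)" by (rule poly_mapping_eqI; simp)
    moreover have "f 0 = 0" using linear_maps_zero[OF f free_module_is_module free_module_is_module] by simp
    ultimately show ?case by (simp add: graded_part_def)
  next
    case (single x a k)
    show ?case
    proof (cases "total_degree a + g x = e")
      case True
      have "f (single x (single a k)) = scal (single a k) (f (single x 1))"
        using linear_mapsD(3)[OF f, of "single a k" "single x 1"] single by simp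
      moreover have "scal (single a k) (f (single x 1)) \<in> graded_part Y g' e"
      proof -
        have "total_degree c + g' y = e"
          if y: "y \<in> Y" and c: "c \<in> keys (single a k * lookup (f (single x 1)) y)" for y c
        proof -
          obtain b where "c = a + b" "b \<in> keys (lookup (f (single x 1)) y)"
            using c keys_mult[of "single a k" "lookup (f (single x 1)) y"] by (auto split: if_splits)
          moreover from this have "total_degree b + g' y = g x"
            using gr[OF single] y by (auto simp: graded_part_def)
          ultimately show ?thesis using True by (simp add: total_degree_def lookup_add sum.distrib)
        qed
        then show ?thesis using gr[OF single] keys_scal[of "single a k" "f (single x 1)"]
          by (auto simp: graded_part_def)
      qed
      ultimately show ?thesis
        using graded_proj_of_graded[OF single_in_graded_part[OF single, of a k g], of e] True by simp
    next
      case False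
      moreover have "f 0 = 0" using linear_maps_zero[OF f free_module_is_module free_module_is_module] by simp
      ultimately show ?thesis
        using graded_proj_of_graded[OF single_in_graded_part[OF single, of a k g], of e]
        by (simp add: graded_part_def)
    qed
  next
    case (add u v)
    have "keys (graded_proj g e u) \<subseteq> X" "keys (graded_proj g e v) \<subseteq> X"
      by (rule keys_graded_proj_subset, fact)+
    then have "f (graded_proj g e (u + v)) = f (graded_proj g e u) + f (graded_proj g e v)"
      using linear_mapsD(2)[OF f, of "graded_proj g e u" "graded_proj g e v"] by (simp add: graded_proj_add)
    then show ?case using graded_part_add[OF add(3,4)] by simp
  qed
  then show "w \<in> graded_part Y g' e" using graded_proj_of_graded[OF v, of e] w by simp
qed

text \<open>Let \<open>\<phi>\<close> be a comparison map to \<open>Y\<close> that preserves degrees and \<open>\<psi>\<close> a comparison map back.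
  Modulo the irrelevant ideal \<open>\<psi> \<circ> \<phi>\<close> is the identity, so \<open>\<phi>\<close> of the basis element \<open>x\<close> has a
  coordinate with nonzero constant coefficient. By homogeneity the basis element of that
  coordinate has the same degree as \<open>x\<close>.\<close>

theorem minimal_resolution_shifts:
  fixes X :: "nat \<Rightarrow> 'x set" and Y :: "nat \<Rightarrow> 'y set" and L :: "(('n::finite,'k::field) mpoly, 'a) module"
  assumes L: "Module.module poly_ring L" and sep: "separated L H"
    and F: "resolution poly_ring (\<lambda>i. free_module (X i)) d \<epsilon> L" and minimal: "minimal_differentials X d"
    and F_gr: "\<And>e. \<epsilon> ` graded_part (X 0) (g 0) e \<subseteq> H e"
      "\<And>i e. d i ` graded_part (X (Suc i)) (g (Suc i)) e \<subseteq> graded_part (X i) (g i) e"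
    and Q: "resolution poly_ring (\<lambda>i. free_module (Y i)) d' \<epsilon>' L"
    and Q_gr: "\<And>e. \<epsilon>' ` graded_part (Y 0) (g' 0) e \<subseteq> H e"
      "\<And>i e. d' i ` graded_part (Y (Suc i)) (g' (Suc i)) e \<subseteq> graded_part (Y i) (g' i) e"
    and x: "x \<in> X i"
  shows "\<exists>y\<in>Y i. g' i y = g i x"
proof -
  have e_gr: "(single x 1 :: 'x \<Rightarrow>\<^sub>0 ('n,'k) mpoly) \<in> graded_part (X i) (g i) (g i x)" if "x \<in> X i" for x i
    using single_in_graded_part[OF that, of 0 1 "g i"] by (simp add: total_degree_def)
  have "\<exists>\<phi>. (\<forall>i. \<phi> i \<in> linear_maps poly_ring (free_module (X i)) (free_module (Y i)) \<and>
      (\<forall>e. \<phi> i ` graded_part (X i) (g i) e \<subseteq> graded_part (Y i) (g' i) e)) \<and>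
    (\<forall>v\<in>carrier (free_module (X 0)). \<epsilon>' (\<phi> 0 v) = \<epsilon> v) \<and>
    (\<forall>i. \<forall>v\<in>carrier (free_module (X (Suc i))). d' i (\<phi> (Suc i) v) = \<phi> i (d i v))"
  proof (rule comparison_map[OF F Q L])
    have "\<exists>y\<in>carrier (free_module (Y 0)). \<epsilon>' y = \<epsilon> (single x 1) \<and> y \<in> graded_part (Y 0) (g' 0) (g 0 x)"
      if "x \<in> X 0" for x
    proof -
      have "\<epsilon> (single x 1) \<in> \<epsilon>' ` carrier (free_module (Y 0))"
        unfolding resolutionD(4)[OF Q] using that by (intro linear_mapsD(1)[OF resolutionD(2)[OF F]]) simp
      then obtain y where y: "keys y \<subseteq> Y 0" "\<epsilon>' y = \<epsilon> (single x 1)" by auto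
      have "\<epsilon> (single x 1) \<in> H (g 0 x)" by (intro subsetD[OF F_gr(1)] imageI e_gr[OF that])
      then have "\<epsilon>' (graded_proj (g' 0) (g 0 x) y) = \<epsilon> (single x 1)"
        using augmentation_graded_proj[OF L sep resolutionD(2)[OF Q] Q_gr(1) y(1), of "g 0 x"] y(2) by simp
      then show ?thesis
        using graded_proj_in[OF y(1), of "g' 0" "g 0 x"] keys_graded_proj[of "g' 0" "g 0 x" y] y(1)
        by (intro bexI[of _ "graded_proj (g' 0) (g 0 x) y"]) auto
    qed
    then have "\<exists>\<phi>\<in>linear_maps poly_ring (free_module (X 0)) (free_module (Y 0)).
        (\<forall>v. keys v \<subseteq> X 0 \<longrightarrow> \<epsilon>' (\<phi> v) = \<epsilon> v) \<and>
        (\<forall>x\<in>X 0. \<phi> (single x 1) \<in> graded_part (Y 0) (g' 0) (g 0 x))"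
      by (rule free_lift[OF free_module_is_module L resolutionD(2)[OF Q] resolutionD(2)[OF F]])
    then obtain \<phi> where \<phi>: "\<phi> \<in> linear_maps poly_ring (free_module (X 0)) (free_module (Y 0))"
      "\<forall>v. keys v \<subseteq> X 0 \<longrightarrow> \<epsilon>' (\<phi> v) = \<epsilon> v"
      "\<forall>x\<in>X 0. \<phi> (single x 1) \<in> graded_part (Y 0) (g' 0) (g 0 x)" by (elim bexE conjE)
    have gr: "\<phi> ` graded_part (X 0) (g 0) e \<subseteq> graded_part (Y 0) (g' 0) e" for e
      by (rule graded_map_from_basis[OF \<phi>(1) \<phi>(3)[rule_format]])
    show "\<exists>\<phi>\<in>linear_maps poly_ring (free_module (X 0)) (free_module (Y 0)).
      (\<forall>e. \<phi> ` graded_part (X 0) (g 0) e \<subseteq> graded_part (Y 0) (g' 0) e) \<and>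
      (\<forall>v\<in>carrier (free_module (X 0)). \<epsilon>' (\<phi> v) = \<epsilon> v)"
      using \<phi>(2) gr by (intro bexI[OF _ \<phi>(1)]) simp
  next
    fix i \<psi> assume \<psi>: "\<psi> \<in> linear_maps poly_ring (free_module (X i)) (free_module (Y i))"
      and \<psi>_gr: "\<forall>e. \<psi> ` graded_part (X i) (g i) e \<subseteq> graded_part (Y i) (g' i) e"
      and im: "\<And>v. v \<in> carrier (free_module (X (Suc i))) \<Longrightarrow>
        \<psi> (d i v) \<in> d' i ` carrier (free_module (Y (Suc i)))"
    have "\<exists>y\<in>carrier (free_module (Y (Suc i))). d' i y = \<psi> (d i (single x 1)) \<and>
        y \<in> graded_part (Y (Suc i)) (g' (Suc i)) (g (Suc i) x)" if "x \<in> X (Suc i)" for x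
    proof -
      have "\<psi> (d i (single x 1)) \<in> d' i ` carrier (free_module (Y (Suc i)))"
        using that by (intro im) simp
      then obtain y where y: "keys y \<subseteq> Y (Suc i)" "d' i y = \<psi> (d i (single x 1))" by auto
      have "\<psi> (d i (single x 1)) \<in> graded_part (Y i) (g' i) (g (Suc i) x)"
        by (intro subsetD[OF \<psi>_gr[rule_format]] subsetD[OF F_gr(2)] imageI e_gr[OF that])
      then have "d' i (graded_proj (g' (Suc i)) (g (Suc i) x) y) = \<psi> (d i (single x 1))"
        using graded_proj_commute[OF resolutionD(3)[OF Q] Q_gr(2) y(1), of "g (Suc i) x"]
          graded_proj_of_graded[of "d' i y" "Y i" "g' i" "g (Suc i) x"] y(2) by simp
      then show ?thesis
        using graded_proj_in[OF y(1), of "g' (Suc i)" "g (Suc i) x"]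
          keys_graded_proj[of "g' (Suc i)" "g (Suc i) x" y] y(1)
        by (intro bexI[of _ "graded_proj (g' (Suc i)) (g (Suc i) x) y"]) auto
    qed
    then have "\<exists>\<phi>\<in>linear_maps poly_ring (free_module (X (Suc i))) (free_module (Y (Suc i))).
        (\<forall>v. keys v \<subseteq> X (Suc i) \<longrightarrow> d' i (\<phi> v) = \<psi> (d i v)) \<and>
        (\<forall>x\<in>X (Suc i). \<phi> (single x 1) \<in> graded_part (Y (Suc i)) (g' (Suc i)) (g (Suc i) x))"
      by (rule free_lift[OF free_module_is_module free_module_is_module resolutionD(3)[OF Q]
        linear_maps_comp[OF resolutionD(3)[OF F] \<psi>]])
    then obtain \<phi> where \<phi>: "\<phi> \<in> linear_maps poly_ring (free_module (X (Suc i))) (free_module (Y (Suc i)))"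
      "\<forall>v. keys v \<subseteq> X (Suc i) \<longrightarrow> d' i (\<phi> v) = \<psi> (d i v)"
      "\<forall>x\<in>X (Suc i). \<phi> (single x 1) \<in> graded_part (Y (Suc i)) (g' (Suc i)) (g (Suc i) x)"
      by (elim bexE conjE)
    have gr: "\<phi> ` graded_part (X (Suc i)) (g (Suc i)) e \<subseteq> graded_part (Y (Suc i)) (g' (Suc i)) e" for e
      by (rule graded_map_from_basis[OF \<phi>(1) \<phi>(3)[rule_format]])
    show "\<exists>\<phi>\<in>linear_maps poly_ring (free_module (X (Suc i))) (free_module (Y (Suc i))).
      (\<forall>e. \<phi> ` graded_part (X (Suc i)) (g (Suc i)) e \<subseteq> graded_part (Y (Suc i)) (g' (Suc i)) e) \<and>
      (\<forall>v\<in>carrier (free_module (X (Suc i))). d' i (\<phi> v) = \<psi> (d i v))"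
      using \<phi>(2) gr by (intro bexI[OF _ \<phi>(1)]) simp
  qed
  then obtain \<phi> where \<phi>': "\<forall>i. \<phi> i \<in> linear_maps poly_ring (free_module (X i)) (free_module (Y i)) \<and>
      (\<forall>e. \<phi> i ` graded_part (X i) (g i) e \<subseteq> graded_part (Y i) (g' i) e)"
    "\<forall>v\<in>carrier (free_module (X 0)). \<epsilon>' (\<phi> 0 v) = \<epsilon> v"
    "\<forall>i. \<forall>v\<in>carrier (free_module (X (Suc i))). d' i (\<phi> (Suc i) v) = \<phi> i (d i v)"
    by (elim exE conjE)
  note \<phi> = \<phi>'(1)[rule_format, THEN conjunct1] \<phi>'(1)[rule_format, THEN conjunct2, rule_format]
    \<phi>'(2,3)[simplified, rule_format]
  obtain \<psi> where \<psi>': "\<forall>i. \<psi> i \<in> linear_maps poly_ring (free_module (Y i)) (free_module (X i))"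
    "\<forall>v. keys v \<subseteq> Y 0 \<longrightarrow> \<epsilon> (\<psi> 0 v) = \<epsilon>' v"
    "\<forall>i v. keys v \<subseteq> Y (Suc i) \<longrightarrow> d i (\<psi> (Suc i) v) = \<psi> i (d' i v)"
    using comparison_map_free[OF Q F L] by (elim exE conjE)
  note \<psi> = \<psi>'[rule_format]
  have \<phi>c: "keys (\<phi> i v) \<subseteq> Y i" if "keys v \<subseteq> X i" for i v
    using linear_mapsD(1)[OF \<phi>(1), of v] that by simp
  let ?q = "\<phi> i (single x 1)"
  have one: "lookup (lookup (\<psi> i ?q) x) 0 = 1"
    by (rule minimal_self_map_const[OF F L minimal, where \<theta> = "\<lambda>i v. \<psi> i (\<phi> i v)"])
      (use \<phi>(3,4) \<psi>(2,3) \<phi>c x linear_maps_comp[OF \<phi>(1) \<psi>(1)] in auto)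
  have "\<exists>y. lookup (lookup ?q y) 0 \<noteq> 0"
  proof (rule ccontr)
    assume "\<nexists>y. lookup (lookup ?q y) 0 \<noteq> 0"
    then have "lookup (lookup (\<psi> i ?q) x) 0 = 0"
      using x \<phi>c[of "single x 1" i] by (intro linear_maps_const_zero[OF \<psi>(1)]) auto
    with one show False by simp
  qed
  then obtain y where y: "0 \<in> keys (lookup ?q y)" by (auto simp: in_keys_iff)
  then have "y \<in> keys ?q" by (auto simp: in_keys_iff)
  then have "y \<in> Y i" using \<phi>c[of "single x 1" i] x by auto
  moreover have "?q \<in> graded_part (Y i) (g' i) (g i x)" by (intro subsetD[OF \<phi>(2)] imageI e_gr[OF x])
  ultimately have "total_degree (0 :: 'n \<Rightarrow>\<^sub>0 nat) + g' i y = g i x" "y \<in> Y i"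
    using y unfolding graded_part_def by blast+
  then show ?thesis by (intro bexI[of _ y]) (simp_all add: total_degree_def)
qed

section \<open>Exponents\<close>

type_synonym 'n expo = "'n \<Rightarrow>\<^sub>0 nat"

text \<open>\<open>mle a b\<close> says that \<open>x\<^sup>a\<close> divides \<open>x\<^sup>b\<close>, and \<open>mlcm a b\<close> is the exponent of the least common
  multiple.\<close>

definition mle :: "'n expo \<Rightarrow> 'n expo \<Rightarrow> bool" where
  "mle a b \<longleftrightarrow> (\<forall>i. lookup a i \<le> lookup b i)"

lift_definition mlcm :: "'n expo \<Rightarrow> 'n expo \<Rightarrow> 'n expo" is "\<lambda>a b i. max (a i) (b i)"
proof -
  fix a b :: "'n \<Rightarrow> nat"
  assume "finite {x. a x \<noteq> 0}" "finite {x. b x \<noteq> 0}"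
  then have "finite ({x. a x \<noteq> 0} \<union> {x. b x \<noteq> 0})" by (rule finite_UnI)
  then show "finite {x. max (a x) (b x) \<noteq> 0}" by (rule rev_finite_subset) auto
qed

lemma mle_refl [simp]: "mle a a" by (simp add: mle_def)

lemma mle_trans [trans]: "mle a b \<Longrightarrow> mle b c \<Longrightarrow> mle a c"
  unfolding mle_def by (meson order_trans)

lemma mle_add [simp]: "mle a (b + a)" "mle a (a + b)"
  by (simp_all add: mle_def lookup_add)

lemma mle_zero [simp]: "mle 0 a" by (simp add: mle_def)

lemma lookup_minus_nat: "lookup (a - b) i = lookup a i - lookup (b :: 'n expo) i"
  by transfer simp

lemma mle_minus_add [simp]: "mle a b \<Longrightarrow> b - a + a = b"
  unfolding mle_def by (intro poly_mapping_eqI) (simp add: lookup_add lookup_minus_nat)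

lemma add_eq_iff_mle: "a + x = b \<longleftrightarrow> mle x b \<and> a = b - (x :: 'n expo)"
  by (metis add_diff_cancel_right' mle_add(1) mle_minus_add)

lemma lookup_mlcm [simp]: "lookup (mlcm a b) i = max (lookup a i) (lookup b i)"
  by transfer simp

lemma mlcm_mle [simp]: "mle (mlcm a b) c \<longleftrightarrow> mle a c \<and> mle b c"
  by (auto simp: mle_def)

lemma mlcm_ge: "mle a (mlcm a b)" "mle b (mlcm a b)"
  by (auto simp: mle_def)

lemma total_degree_add: "total_degree (a + b) = total_degree a + total_degree b"
  by (simp add: total_degree_def lookup_add sum.distrib)

lemma total_degree_mlcm: "total_degree (mlcm a b) \<le> total_degree a + total_degree b"
  unfolding total_degree_def by (subst sum.distrib[symmetric], intro sum_mono) simp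

lemma minus_eq_0_mle: "mle a b \<Longrightarrow> b - a = 0 \<longleftrightarrow> a = (b :: 'n expo)"
  by (metis add.left_neutral diff_self_eq_0 mle_minus_add cancel_comm_monoid_add_class.diff_cancel)

section \<open>Frames\<close>

text \<open>Let the basis element \<open>e\<^sub>x\<close> of a free module have degree \<open>deg x\<close>. A homogeneous element of
  degree \<open>b\<close> is a sum of terms \<open>u\<^sub>x x^(b - deg x) e\<^sub>x\<close> with scalars \<open>u\<^sub>x\<close>, over the \<open>x\<close> whose
  degree divides \<open>b\<close>. \<open>homogenize\<close> produces the element from its scalar coordinates \<open>u\<close>, and
  \<open>component\<close> gives the coordinates of the component of degree \<open>b\<close> of an arbitrary element. In
  these coordinates multiplication by a monomial is an inclusion.\<close>

lift_definition homogenize ::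
    "('x \<Rightarrow> 'n expo) \<Rightarrow> 'n expo \<Rightarrow> ('x \<Rightarrow>\<^sub>0 'k::field) \<Rightarrow> 'x \<Rightarrow>\<^sub>0 ('n, 'k) mpoly" is
  "\<lambda>(deg :: 'x \<Rightarrow> 'n expo) b (u :: 'x \<Rightarrow> 'k) x. single (b - deg x) (u x) :: ('n, 'k) mpoly"
  by (erule rev_finite_subset) auto

lift_definition component ::
    "('x \<Rightarrow> 'n expo) \<Rightarrow> 'n expo \<Rightarrow> ('x \<Rightarrow>\<^sub>0 ('n, 'k::field) mpoly) \<Rightarrow> 'x \<Rightarrow>\<^sub>0 'k" is
  "\<lambda>(deg :: 'x \<Rightarrow> 'n expo) b (v :: 'x \<Rightarrow> ('n, 'k) mpoly) x. if mle (deg x) b then lookup (v x) (b - deg x) else 0"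
  by (erule rev_finite_subset) auto

lemma lookup_homogenize [simp]: "lookup (homogenize deg b u) x = single (b - deg x) (lookup u x)"
  by (simp add: homogenize.rep_eq)

lemma lookup_component [simp]:
  "lookup (component deg b v) x = (if mle (deg x) b then lookup (lookup v x) (b - deg x) else 0)"
  by (simp add: component.rep_eq)

lemma keys_homogenize [simp]: "keys (homogenize deg b u) = keys u"
  by (simp add: set_eq_iff in_keys_iff single_eq_0_iff)

lemma keys_component: "keys (component deg b v) \<subseteq> {x \<in> keys v. mle (deg x) b}"
  by (auto simp: in_keys_iff split: if_splits)

lemma component_zero [simp]: "component deg b 0 = 0"
  by (rule poly_mapping_eqI) simp

lemma component_add: "component deg b (u + v) = component deg b u + component deg b v"
  by (rule poly_mapping_eqI) (simp add: lookup_add)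

lemma component_sum: "component deg b (sum f A) = (\<Sum>a\<in>A. component deg b (f a))"
  by (induction A rule: infinite_finite_induct) (auto simp: component_add)

lemma component_single:
  "component deg b (single x (single a k)) = (if a + deg x = b then single x k else 0)"
  by (rule poly_mapping_eqI) (auto simp: add_eq_iff_mle lookup_single when_def)

lemma component_homogenize:
  assumes "\<And>x. x \<in> keys u \<Longrightarrow> mle (deg x) b"
  shows "component deg b' (homogenize deg b u) = (if b = b' then u else 0)"
proof (rule poly_mapping_eqI)
  fix x
  show "lookup (component deg b' (homogenize deg b u)) x = lookup (if b = b' then u else 0) x"
  proof (cases "x \<in> keys u")
    case True
    then have m: "mle (deg x) b" by (rule assms)
    have "b - deg x = b' - deg x \<longleftrightarrow> b = b'" if "mle (deg x) b'"
      using m that by (metis mle_minus_add)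
    then show ?thesis using m by (auto simp: lookup_single when_def)
  qed (auto simp: in_keys_iff)
qed

lemma component_eqI:
  assumes "\<And>b. component deg b u = component deg b v" shows "u = v"
proof (intro poly_mapping_eqI)
  fix x a
  show "lookup (lookup u x) a = lookup (lookup v x) a"
    using arg_cong[OF assms[of "a + deg x"], of "\<lambda>w. lookup w x"] by simp
qed

lemma finite_components: "finite {b. component deg b v \<noteq> 0}"
proof (rule finite_subset)
  show "{b. component deg b v \<noteq> 0} \<subseteq> (\<Union>x\<in>keys v. (\<lambda>a. a + deg x) ` keys (lookup v x))"
  proof
    fix b assume "b \<in> {b. component deg b v \<noteq> 0}"
    then obtain x where "lookup (component deg b v) x \<noteq> 0"
      by (auto simp: poly_mapping_eq_iff fun_eq_iff)
    then have "mle (deg x) b" "lookup (lookup v x) (b - deg x) \<noteq> 0" by (auto split: if_splits)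
    then have "b = (b - deg x) + deg x" "x \<in> keys v" "b - deg x \<in> keys (lookup v x)"
      by (auto simp: in_keys_iff)
    then show "b \<in> (\<Union>x\<in>keys v. (\<lambda>a. a + deg x) ` keys (lookup v x))" by blast
  qed
qed auto

text \<open>A complex of multigraded free modules in scalar terms: \<open>hdg x\<close> and \<open>deg x\<close> are the
  homological degree and the multidegree of the basis element \<open>x\<close>, and \<open>c x\<close> lists the scalar
  coefficients of its boundary. The monomials in the boundary are determined by the degrees (see
  \<open>diff\<close>). The labels \<open>below i b\<close> are a basis of the component of degree \<open>b\<close> in homological degree
  \<open>i\<close>.\<close>

locale frame =
  fixes X :: "'x set" and hdg :: "'x \<Rightarrow> nat" and deg :: "'x \<Rightarrow> 'n::finite expo"
    and c :: "'x \<Rightarrow> 'x \<Rightarrow>\<^sub>0 'k::field"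
  assumes keys_c: "x \<in> X \<Longrightarrow> y \<in> keys (c x) \<Longrightarrow> y \<in> X \<and> Suc (hdg y) = hdg x \<and> mle (deg y) (deg x)"
begin

definition level :: "nat \<Rightarrow> 'x set" where
  "level i = {x \<in> X. hdg x = i}"

definition below :: "nat \<Rightarrow> 'n expo \<Rightarrow> 'x set" where
  "below i b = {x \<in> X. hdg x = i \<and> mle (deg x) b}"

definition boundaries :: "nat \<Rightarrow> 'n expo \<Rightarrow> ('x \<Rightarrow>\<^sub>0 'k) set" where
  "boundaries i b = lin_ext c ` {w. keys w \<subseteq> below (Suc i) b}"

text \<open>The equivalence contains that the square of the boundary is zero, as well as exactness of
  all strands in positive homological degrees. Homological degree \<open>0\<close> is described by \<open>boundaries
  0\<close>.\<close>

definition exact :: bool where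
  "exact \<longleftrightarrow> (\<forall>i b u. keys u \<subseteq> below (Suc i) b \<longrightarrow> (lin_ext c u = 0 \<longleftrightarrow> u \<in> boundaries (Suc i) b))"

definition minimal :: bool where
  "minimal \<longleftrightarrow> (\<forall>x\<in>X. \<forall>y\<in>keys (c x). deg y \<noteq> deg x)"

definition diff :: "('x \<Rightarrow>\<^sub>0 ('n, 'k) mpoly) \<Rightarrow> 'x \<Rightarrow>\<^sub>0 ('n, 'k) mpoly" where
  "diff = lin_ext (\<lambda>x. homogenize deg (deg x) (c x))"

text \<open>On each component the differential acts by the scalar matrix. This reduces the homology of
  the complex over the polynomial ring to linear algebra over the field.\<close>

lemma component_diff:
  assumes "keys v \<subseteq> X" shows "component deg b (diff v) = lin_ext c (component deg b v)"
  using assms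
proof (induction rule: mpoly_vector_induct)
  case zero
  then show ?case by (simp add: diff_def)
next
  case (single x a k)
  have "component deg b (scal (single a k) (homogenize deg (deg x) (c x))) = 
    (if a + deg x = b then scal k (c x) else 0)"
  proof (rule poly_mapping_eqI)
    fix y
    show "lookup (component deg b (scal (single a k) (homogenize deg (deg x) (c x)))) y =
      lookup (if a + deg x = b then scal k (c x) else 0) y"
    proof (cases "y \<in> keys (c x)")
      case True
      then have m: "mle (deg y) (deg x)" using keys_c[OF single] by blast
      have "a + (deg x - deg y) = b - deg y \<longleftrightarrow> a + deg x = b" if "mle (deg y) b"
        using m that by (metis add.assoc mle_minus_add add_diff_cancel_right')
      moreover have "mle (deg y) b" if "a + deg x = b"
        using m that mle_trans mle_add(1) by blast
      ultimately show ?thesis using m by (auto simp: mult_single lookup_single when_def)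
    qed (auto simp: in_keys_iff)
  qed
  then show ?case by (simp add: diff_def component_single)
next
  case (add u v)
  then show ?case by (simp add: diff_def lin_ext_add component_add)
qed

lemma keys_c_level: "x \<in> level (Suc i) \<Longrightarrow> keys (c x) \<subseteq> level i"
  using keys_c by (force simp: level_def)

lemma diff_linear: "diff \<in> linear_maps poly_ring (free_module (level (Suc i))) (free_module (level i))"
  unfolding diff_def by (rule lin_ext_linear) (simp add: keys_c_level)

text \<open>Preimages of the finitely many nonzero components are homogenised and added up.\<close>

lemma diff_image_iff:
  assumes "keys v \<subseteq> level i"
  shows "v \<in> diff ` {w. keys w \<subseteq> level (Suc i)} \<longleftrightarrow> (\<forall>b. component deg b v \<in> boundaries i b)"
proof
  assume "v \<in> diff ` {w. keys w \<subseteq> level (Suc i)}"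
  then obtain w where w: "keys w \<subseteq> level (Suc i)" "v = diff w" by blast
  show "\<forall>b. component deg b v \<in> boundaries i b"
  proof
    fix b
    have "keys w \<subseteq> X" using w(1) by (auto simp: level_def)
    then have "component deg b v = lin_ext c (component deg b w)" using w(2) component_diff by simp
    moreover have "keys (component deg b w) \<subseteq> below (Suc i) b"
      using keys_component[of deg b w] w(1) by (auto simp: level_def below_def)
    ultimately show "component deg b v \<in> boundaries i b" unfolding boundaries_def by blast
  qed
next
  assume "\<forall>b. component deg b v \<in> boundaries i b"
  then have "\<forall>b. \<exists>w. component deg b v = lin_ext c w \<and> keys w \<subseteq> below (Suc i) b"
    unfolding boundaries_def by blast
  then obtain w where w: "\<And>b. component deg b v = lin_ext c (w b)" "\<And>b. keys (w b) \<subseteq> below (Suc i) b"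
    by metis
  let ?B = "{b. component deg b v \<noteq> 0}"
  let ?w = "\<Sum>b\<in>?B. homogenize deg b (w b)"
  have "(\<Union>b\<in>?B. keys (homogenize deg b (w b))) \<subseteq> level (Suc i)"
    using w(2) by (auto simp: below_def level_def)
  then have k: "keys ?w \<subseteq> level (Suc i)" by (rule order_trans[OF keys_sum])
  have "v = diff ?w"
  proof (rule component_eqI[of deg])
    fix b
    have "component deg b (homogenize deg b' (w b')) = (if b' = b then w b' else 0)" for b'
      using w(2)[of b'] by (intro component_homogenize) (auto simp: below_def)
    then have "component deg b ?w = (if b \<in> ?B then w b else 0)"
      by (simp add: component_sum finite_components)
    then have "lin_ext c (component deg b ?w) = component deg b v"
      using w(1)[of b] by auto
    moreover have "keys ?w \<subseteq> X" using k by (auto simp: level_def)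
    ultimately show "component deg b v = component deg b (diff ?w)" by (simp add: component_diff)
  qed
  with k show "v \<in> diff ` {w. keys w \<subseteq> level (Suc i)}" by blast
qed

text \<open>An element of a multigraded free module vanishes if all its components do, so exactness may
  be tested on the strands.\<close>

theorem frame_resolution:
  fixes L :: "(('n, 'k) mpoly, 'a) module"
  assumes exact: exact
    and lin: "\<epsilon> \<in> linear_maps poly_ring (free_module (level 0)) L"
    and surj: "carrier L \<subseteq> \<epsilon> ` {v. keys v \<subseteq> level 0}"
    and ker: "\<And>v. keys v \<subseteq> level 0 \<Longrightarrow> \<epsilon> v = \<zero>\<^bsub>L\<^esub> \<longleftrightarrow> (\<forall>b. component deg b v \<in> boundaries 0 b)"
  shows "resolution poly_ring (\<lambda>i. free_module (level i)) (\<lambda>_. diff) \<epsilon> L"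
proof (rule resolutionI)
  fix v :: "'x \<Rightarrow>\<^sub>0 ('n, 'k) mpoly" and i assume "v \<in> carrier (free_module (level (Suc i)))"
  then have k: "keys v \<subseteq> level (Suc i)" by simp
  then have kX: "keys v \<subseteq> X" by (auto simp: level_def)
  have "diff v = 0 \<longleftrightarrow> (\<forall>b. component deg b (diff v) = 0)"
    using component_eqI[of deg "diff v" 0] by auto
  also have "\<dots> \<longleftrightarrow> (\<forall>b. component deg b v \<in> boundaries (Suc i) b)"
  proof -
    have "keys (component deg b v) \<subseteq> below (Suc i) b" for b
      using keys_component[of deg b v] k by (auto simp: level_def below_def)
    then have "lin_ext c (component deg b v) = 0 \<longleftrightarrow> component deg b v \<in> boundaries (Suc i) b" for b
      using exact unfolding exact_def by blast
    then show ?thesis using kX by (simp add: component_diff)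
  qed
  finally show "diff v = \<zero>\<^bsub>free_module (level i)\<^esub> \<longleftrightarrow> v \<in> diff ` carrier (free_module (level (Suc (Suc i))))"
    using diff_image_iff[OF k] by simp
qed (use assms diff_linear free_module_is_module diff_image_iff in auto)

text \<open>If \<open>deg y\<close> divides \<open>deg x\<close> properly, the entry of the differential is a scalar multiple of a
  monomial other than \<open>1\<close>.\<close>

lemma minimal_diff: "minimal \<Longrightarrow> minimal_differentials level (\<lambda>_. diff)"
  unfolding minimal_differentials_def
proof (intro allI impI)
  fix i y and v :: "'x \<Rightarrow>\<^sub>0 ('n, 'k) mpoly" assume m: minimal and v: "keys v \<subseteq> level (Suc i)"
  have "lookup (lookup (homogenize deg (deg x) (c x)) y) 0 = 0" if "x \<in> X" for x
  proof (cases "y \<in> keys (c x)")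
    case True
    then have "deg x - deg y \<noteq> 0" using m keys_c[OF that True] that minus_eq_0_mle[of "deg y" "deg x"]
      by (auto simp: minimal_def)
    then show ?thesis by (simp add: lookup_single)
  qed (auto simp: in_keys_iff)
  then show "lookup (lookup (diff v) y) 0 = 0"
    using v by (auto simp: diff_def lin_ext_def lookup_sum lookup_mult_zero level_def intro!: sum.neutral)
qed

lemma diff_graded:
  "diff ` graded_part (level (Suc i)) (\<lambda>x. total_degree (deg x)) e
    \<subseteq> graded_part (level i) (\<lambda>x. total_degree (deg x)) e"
proof (rule graded_map_from_basis[OF diff_linear])
  fix x assume x: "x \<in> level (Suc i)"
  have "total_degree (deg x - deg y) + total_degree (deg y) = total_degree (deg x)" if "y \<in> keys (c x)" for y
  proof -
    have "mle (deg y) (deg x)" using x that keys_c by (auto simp: level_def)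
    then show ?thesis by (simp add: total_degree_add[symmetric])
  qed
  then show "diff (single x 1) \<in> graded_part (level i) (\<lambda>x. total_degree (deg x)) (total_degree (deg x))"
    using keys_c_level[OF x] by (auto simp: diff_def graded_part_def in_keys_iff)
qed

end

section \<open>Relabelling the bases of a resolution\<close>

lemma resolution_transport:
  assumes F: "resolution R F d \<epsilon> L" and F': "\<And>i. Module.module R (F' i)"
    and \<theta>: "\<And>i. \<theta> i \<in> linear_maps R (F i) (F' i)" "\<And>i. \<theta>' i \<in> linear_maps R (F' i) (F i)"
    and inv: "\<And>i v. v \<in> carrier (F i) \<Longrightarrow> \<theta>' i (\<theta> i v) = v" "\<And>i v. v \<in> carrier (F' i) \<Longrightarrow> \<theta> i (\<theta>' i v) = v"
  shows "resolution R F' (\<lambda>i v. \<theta> i (d i (\<theta>' (Suc i) v))) (\<lambda>v. \<epsilon> (\<theta>' 0 v)) L"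
proof (rule resolutionI)
  note \<theta>c = linear_mapsD(1)[OF \<theta>(1)] linear_mapsD(1)[OF \<theta>(2)]
  note dc = linear_mapsD(1)[OF resolutionD(3)[OF F]]
  have im: "\<theta>' i v \<in> d i ` carrier (F (Suc i)) \<longleftrightarrow>
      v \<in> (\<lambda>v. \<theta> i (d i (\<theta>' (Suc i) v))) ` carrier (F' (Suc i))" if v: "v \<in> carrier (F' i)" for i v
  proof
    assume "\<theta>' i v \<in> d i ` carrier (F (Suc i))"
    then obtain w where w: "w \<in> carrier (F (Suc i))" "\<theta>' i v = d i w" by (elim imageE)
    then have "v = \<theta> i (d i (\<theta>' (Suc i) (\<theta> (Suc i) w)))" using inv(1)[OF w(1)] inv(2)[OF v] by simp
    then show "v \<in> (\<lambda>v. \<theta> i (d i (\<theta>' (Suc i) v))) ` carrier (F' (Suc i))"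
      using \<theta>c(1)[OF w(1)] by (rule image_eqI)
  next
    assume "v \<in> (\<lambda>v. \<theta> i (d i (\<theta>' (Suc i) v))) ` carrier (F' (Suc i))"
    then obtain w where w: "w \<in> carrier (F' (Suc i))" "v = \<theta> i (d i (\<theta>' (Suc i) w))" by (elim imageE)
    have "\<theta>' i v = d i (\<theta>' (Suc i) w)" using w(2) inv(1)[OF dc[OF \<theta>c(2)[OF w(1)]]] by simp
    then show "\<theta>' i v \<in> d i ` carrier (F (Suc i))" using \<theta>c(2)[OF w(1)] by (rule image_eqI)
  qed
  show "carrier L \<subseteq> (\<lambda>v. \<epsilon> (\<theta>' 0 v)) ` carrier (F' 0)"
  proof
    fix x assume "x \<in> carrier L"
    then obtain v where v: "v \<in> carrier (F 0)" "x = \<epsilon> v" using resolutionD(4)[OF F] by blast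
    then have "x = \<epsilon> (\<theta>' 0 (\<theta> 0 v))" using inv(1) by simp
    then show "x \<in> (\<lambda>v. \<epsilon> (\<theta>' 0 v)) ` carrier (F' 0)" using \<theta>c(1)[OF v(1)] by (rule image_eqI)
  qed
  fix v i
  show "v \<in> carrier (F' 0) \<Longrightarrow> \<epsilon> (\<theta>' 0 v) = \<zero>\<^bsub>L\<^esub> \<longleftrightarrow>
      v \<in> (\<lambda>v. \<theta> 0 (d 0 (\<theta>' (Suc 0) v))) ` carrier (F' (Suc 0))"
    using resolutionD(5)[OF F \<theta>c(2)] im[of v 0] by blast
  assume v: "v \<in> carrier (F' (Suc i))"
  have "\<theta> i (d i (\<theta>' (Suc i) v)) = \<zero>\<^bsub>F' i\<^esub> \<longleftrightarrow> d i (\<theta>' (Suc i) v) = \<zero>\<^bsub>F i\<^esub>"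
  proof
    assume "\<theta> i (d i (\<theta>' (Suc i) v)) = \<zero>\<^bsub>F' i\<^esub>"
    then have "\<theta>' i (\<theta> i (d i (\<theta>' (Suc i) v))) = \<zero>\<^bsub>F i\<^esub>"
      using linear_maps_zero[OF \<theta>(2) F' resolutionD(1)[OF F]] by simp
    then show "d i (\<theta>' (Suc i) v) = \<zero>\<^bsub>F i\<^esub>" using inv(1)[OF dc[OF \<theta>c(2)[OF v]]] by simp
  qed (use linear_maps_zero[OF \<theta>(1) resolutionD(1)[OF F] F'] in simp)
  then show "\<theta> i (d i (\<theta>' (Suc i) v)) = \<zero>\<^bsub>F' i\<^esub> \<longleftrightarrow>
      v \<in> (\<lambda>v. \<theta> (Suc i) (d (Suc i) (\<theta>' (Suc (Suc i)) v))) ` carrier (F' (Suc (Suc i)))"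
    using resolutionD(6)[OF F \<theta>c(2)[OF v]] im[OF v] by simp
qed (use F' linear_maps_comp[OF \<theta>(2) resolutionD(2)[OF F]]
      linear_maps_comp[OF \<theta>(2) linear_maps_comp[OF resolutionD(3)[OF F] \<theta>(1)]] in auto)

definition pull_labels :: "('y \<Rightarrow> 'x) \<Rightarrow> ('x \<Rightarrow>\<^sub>0 'r::comm_ring_1) \<Rightarrow> 'y \<Rightarrow>\<^sub>0 'r" where
  "pull_labels g = Poly_Mapping.map_key g"

definition push_labels :: "('y \<Rightarrow> 'x) \<Rightarrow> ('y \<Rightarrow>\<^sub>0 'r::comm_ring_1) \<Rightarrow> 'x \<Rightarrow>\<^sub>0 'r" where
  "push_labels g = lin_ext (\<lambda>y. single (g y) 1)"

lemma lookup_pull_labels: "inj g \<Longrightarrow> lookup (pull_labels g v) y = lookup v (g y)"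
  by (simp add: pull_labels_def map_key.rep_eq)

lemma lookup_push_labels:
  assumes "inj g" shows "lookup (push_labels g v) (g y) = lookup v y"
proof -
  have "lookup (push_labels g v) (g y) = (\<Sum>x\<in>keys v. if x = y then lookup v x else 0)"
    unfolding push_labels_def lin_ext_def
    by (auto simp: lookup_sum lookup_single when_def inj_eq[OF assms] intro!: sum.cong)
  also have "\<dots> = lookup v y" by (simp add: in_keys_iff)
  finally show ?thesis .
qed

lemma keys_push_labels: "keys (push_labels g v) \<subseteq> g ` keys v"
  unfolding push_labels_def by (rule order_trans[OF keys_lin_ext]) auto

text \<open>Projective dimension and regularity are defined by modules with basis labels of type \<open>nat\<close>,
  whereas the labels of frames and of their products are tuples.\<close>

lemma resolution_relabel:
  fixes X :: "nat \<Rightarrow> 'x set" and g :: "nat \<Rightarrow> 'y \<Rightarrow> 'x" and L :: "(('n,'k::field) mpoly, 'a) module"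
  assumes F: "resolution poly_ring (\<lambda>i. free_module (X i)) d \<epsilon> L"
    and inj: "\<And>i. inj (g i)" and range: "\<And>i. X i \<subseteq> range (g i)"
  shows "resolution poly_ring (\<lambda>i. free_module (g i -` X i))
    (\<lambda>i v. pull_labels (g i) (d i (push_labels (g (Suc i)) v))) (\<lambda>v. \<epsilon> (push_labels (g 0) v)) L"
proof (rule resolution_transport[OF F free_module_is_module])
  fix i
  show "(pull_labels (g i) :: _ \<Rightarrow> _ \<Rightarrow>\<^sub>0 ('n,'k) mpoly) \<in> linear_maps poly_ring (free_module (X i)) (free_module (g i -` X i))"
  proof (rule linear_mapsI)
    fix v :: "'x \<Rightarrow>\<^sub>0 ('n,'k) mpoly" assume "v \<in> carrier (free_module (X i))"
    then show "pull_labels (g i) v \<in> carrier (free_module (g i -` X i))"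
      by (auto simp: in_keys_iff lookup_pull_labels[OF inj] subset_iff)
  qed (auto intro!: poly_mapping_eqI simp: lookup_pull_labels[OF inj] lookup_add)
  show "(push_labels (g i) :: _ \<Rightarrow> _ \<Rightarrow>\<^sub>0 ('n,'k) mpoly) \<in> linear_maps poly_ring (free_module (g i -` X i)) (free_module (X i))"
    unfolding push_labels_def by (rule lin_ext_linear) auto
next
  fix i and v :: "'x \<Rightarrow>\<^sub>0 ('n,'k) mpoly" assume "v \<in> carrier (free_module (X i))"
  then have v: "keys v \<subseteq> range (g i)" using range[of i] by auto
  show "push_labels (g i) (pull_labels (g i) v) = v"
  proof (rule poly_mapping_eqI)
    fix x
    show "lookup (push_labels (g i) (pull_labels (g i) v)) x = lookup v x"
    proof (cases "x \<in> range (g i)")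
      case True
      then obtain y where "x = g i y" by blast
      then show ?thesis by (simp add: lookup_push_labels[OF inj] lookup_pull_labels[OF inj])
    next
      case False
      then have "x \<notin> keys v" "x \<notin> keys (push_labels (g i) (pull_labels (g i) v))"
        using v keys_push_labels[of "g i" "pull_labels (g i) v"] by blast+
      then show ?thesis by (simp add: in_keys_iff)
    qed
  qed
next
  fix i and v :: "'y \<Rightarrow>\<^sub>0 ('n,'k) mpoly"
  show "pull_labels (g i) (push_labels (g i) v) = v"
    by (rule poly_mapping_eqI) (simp add: lookup_push_labels[OF inj] lookup_pull_labels[OF inj])
qed

section \<open>Contracting homotopies\<close>

lemma vector_space_scal: "vector_space (scal :: 'k::field \<Rightarrow> ('x \<Rightarrow>\<^sub>0 'k) \<Rightarrow> _)"
  by unfold_locales (simp_all add: scal_add add_scal)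

lemma linear_lin_ext: "Vector_Spaces.linear scal scal (lin_ext (f :: 'x \<Rightarrow> 'y \<Rightarrow>\<^sub>0 'k::field))"
  by (simp add: Vector_Spaces.linear_iff vector_space_scal lin_ext_add lin_ext_scal)

lemma linear_is_lin_ext:
  fixes g :: "('x \<Rightarrow>\<^sub>0 'k::field) \<Rightarrow> 'y \<Rightarrow>\<^sub>0 'k"
  assumes "Vector_Spaces.linear scal scal g"
  shows "g = lin_ext (\<lambda>x. g (single x 1))"
proof
  fix v :: "'x \<Rightarrow>\<^sub>0 'k"
  have add: "g (u + v) = g u + g v" and sc: "g (scal a u) = scal a (g u)" for u v a
    using assms by (simp_all add: Vector_Spaces.linear_iff)
  have "keys v \<subseteq> UNIV" by simp
  then show "g v = lin_ext (\<lambda>x. g (single x 1)) v"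
  proof (induction rule: poly_mapping_add_induct)
    case zero
    show ?case using sc[of 0 0] by simp
  next
    case (single x a)
    show ?case using sc[of a "single x 1"] by simp
  next
    case (add u v)
    then show ?case using \<open>\<And>u v. g (u + v) = g u + g v\<close> by (simp add: lin_ext_add)
  qed
qed

lemma keys_lin_ext_subset:
  assumes "keys v \<subseteq> A" "\<And>x. x \<in> A \<Longrightarrow> keys (f x) \<subseteq> B"
  shows "keys (lin_ext f v) \<subseteq> B"
  using keys_lin_ext[of f v] assms by blast

lemma lin_ext_eqI:
  assumes "keys v \<subseteq> A" "\<And>x. x \<in> A \<Longrightarrow> f x = g x" shows "lin_ext f v = lin_ext g v"
  unfolding lin_ext_def using assms by (intro sum.cong) auto

lemma lin_ext_lin_ext: "lin_ext f (lin_ext g v) = lin_ext (\<lambda>x. lin_ext f (g x)) v"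
  unfolding lin_ext_def[of g] lin_ext_def[of "\<lambda>x. lin_ext f (g x)"]
  by (simp add: lin_ext_sum lin_ext_scal)

lemma lin_ext_id: "lin_ext (\<lambda>x. single x 1) v = v"
  using poly_mapping_sum_singles[of "keys v" v] by (simp add: lin_ext_def)

lemma lin_ext_fun_add: "lin_ext (\<lambda>x. f x + g x) v = lin_ext f v + lin_ext g v"
  by (simp add: lin_ext_def scal_add sum.distrib)

lemma lin_ext_fun_minus: "lin_ext (\<lambda>x. f x - g x) v = lin_ext f v - lin_ext g v"
  by (simp add: lin_ext_def scal_minus sum_subtractf)

text \<open>\<open>lin_ext g\<close> is a linear section of \<open>lin_ext f\<close> on the image of the vectors supported in
  \<open>A\<close>.\<close>

lemma lin_ext_right_inverse:
  fixes f :: "'x \<Rightarrow> 'y \<Rightarrow>\<^sub>0 'k::field"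
  shows "\<exists>g. (\<forall>y. keys (g y) \<subseteq> A) \<and> (\<forall>w. keys w \<subseteq> A \<longrightarrow> lin_ext f (lin_ext g (lin_ext f w)) = lin_ext f w)"
proof -
  interpret pair: vector_space_pair "scal :: 'k \<Rightarrow> ('x \<Rightarrow>\<^sub>0 'k) \<Rightarrow> _" "scal :: 'k \<Rightarrow> ('y \<Rightarrow>\<^sub>0 'k) \<Rightarrow> _"
    by (intro vector_space_pair.intro vector_space_scal)
  let ?V = "{w :: 'x \<Rightarrow>\<^sub>0 'k. keys w \<subseteq> A}"
  have add: "keys (u + v) \<subseteq> A" if "keys u \<subseteq> A" "keys v \<subseteq> A" for u v :: "'x \<Rightarrow>\<^sub>0 'k"
    by (rule order_trans[OF keys_add Un_least[OF that]])
  have "pair.vs1.subspace ?V"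
    unfolding pair.vs1.subspace_def using add by (auto dest: subsetD[OF keys_scal])
  from pair.linear_exists_right_inverse_on[OF linear_lin_ext this]
  obtain g where g: "range g \<subseteq> ?V" "Vector_Spaces.linear scal scal g"
    "\<forall>v\<in>lin_ext f ` ?V. lin_ext f (g v) = v" by blast
  have "g = lin_ext (\<lambda>x. g (single x 1))" by (rule linear_is_lin_ext[OF g(2)])
  moreover have "keys (g (single y 1)) \<subseteq> A" for y using g(1) by blast
  ultimately show ?thesis using g(3) by (intro exI[of _ "\<lambda>y. g (single y 1)"]) auto
qed

context frame
begin

lemma keys_c_below: "x \<in> below (Suc i) b \<Longrightarrow> keys (c x) \<subseteq> below i b"
  using keys_c mle_trans by (fastforce simp: below_def)

lemma c_level_zero: "x \<in> below 0 b \<Longrightarrow> c x = 0"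
  using keys_c[of x] by (auto simp: below_def poly_mapping_eq_iff fun_eq_iff in_keys_iff)

lemma bd_level_zero: "keys u \<subseteq> below 0 b \<Longrightarrow> lin_ext c u = 0"
  using c_level_zero by (auto simp: lin_ext_def intro!: sum.neutral)

lemma keys_bd: "keys u \<subseteq> below (Suc i) b \<Longrightarrow> keys (lin_ext c u) \<subseteq> below i b"
  by (erule keys_lin_ext_subset) (rule keys_c_below)

lemma bd_bd:
  assumes exact "keys u \<subseteq> below (Suc i) b" shows "lin_ext c (lin_ext c u) = 0"
proof (cases i)
  case 0
  then show ?thesis using keys_bd[OF assms(2)] bd_level_zero by blast
next
  case (Suc j)
  then have "lin_ext c u \<in> boundaries (Suc j) b" using assms(2) unfolding boundaries_def by blast
  moreover have "keys (lin_ext c u) \<subseteq> below (Suc j) b" using keys_bd[OF assms(2)] Suc by simp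
  ultimately show ?thesis using assms(1) unfolding exact_def by blast
qed

text \<open>On the strand in degree \<open>b\<close>, writing \<open>d\<close> for the boundary: \<open>d h + h d\<close> is the identity in
  positive homological degrees, and \<open>d h d = d\<close> at the bottom, so that \<open>id - d h\<close> is a projection
  in homological degree \<open>0\<close> whose kernel consists of the boundaries.\<close>

definition contraction :: "'n expo \<Rightarrow> ('x \<Rightarrow> 'x \<Rightarrow>\<^sub>0 'k) \<Rightarrow> bool" where
  "contraction b h \<longleftrightarrow> (\<forall>i. \<forall>x\<in>below i b. keys (h x) \<subseteq> below (Suc i) b) \<and>
    (\<forall>i u. keys u \<subseteq> below (Suc i) b \<longrightarrow> lin_ext c (lin_ext h u) + lin_ext h (lin_ext c u) = u) \<and>
    (\<forall>u. keys u \<subseteq> below (Suc 0) b \<longrightarrow> lin_ext c (lin_ext h (lin_ext c u)) = lin_ext c u)"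

text \<open>With a linear section \<open>s\<close> of \<open>d\<close> on its image, \<open>id - s d\<close> maps to cycles, which are
  boundaries in positive homological degrees by exactness; so \<open>h = s (id - s d)\<close> is a
  contraction.\<close>

lemma contraction_exists:
  assumes exact shows "\<exists>h. contraction b h"
proof -
  have "\<forall>i. \<exists>g. (\<forall>x. keys (g x) \<subseteq> below (Suc i) b) \<and>
    (\<forall>w. keys w \<subseteq> below (Suc i) b \<longrightarrow> lin_ext c (lin_ext g (lin_ext c w)) = lin_ext c w)"
    using lin_ext_right_inverse by blast
  then obtain g where g: "\<And>i x. keys (g i x) \<subseteq> below (Suc i) b"
    "\<And>i w. keys w \<subseteq> below (Suc i) b \<Longrightarrow> lin_ext c (lin_ext (g i) (lin_ext c w)) = lin_ext c w"
    by metis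
  \<comment> \<open>A section is chosen in each homological degree; together they form one map on the labels.\<close>
  define s where "s x = g (hdg x) x" for x
  have s: "lin_ext s u = lin_ext (g i) u" if "keys u \<subseteq> below i b" for i u
    using that by (rule lin_ext_eqI) (simp add: s_def below_def)
  have ks: "keys (lin_ext s u) \<subseteq> below (Suc i) b" if "keys u \<subseteq> below i b" for i u
    unfolding s[OF that] using that g(1) by (rule keys_lin_ext_subset)
  define h where "h x = lin_ext s (single x 1 - lin_ext s (c x))" for x
  have h: "lin_ext h u = lin_ext s (u - lin_ext s (lin_ext c u))" for u
  proof -
    have "lin_ext h u = lin_ext s (lin_ext (\<lambda>x. single x 1 - lin_ext s (c x)) u)"
      unfolding h_def by (rule lin_ext_lin_ext[symmetric])
    then show ?thesis by (simp add: lin_ext_fun_minus lin_ext_id lin_ext_lin_ext[symmetric])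
  qed
  have sb: "lin_ext c (lin_ext s (lin_ext c u)) = lin_ext c u" if "keys u \<subseteq> below (Suc i) b" for i u
    using s[OF keys_bd[OF that]] g(2)[OF that] by simp
  have r: "keys (u - lin_ext s (lin_ext c u)) \<subseteq> below i b" if "keys u \<subseteq> below i b" for i u
  proof (cases i)
    case 0
    then show ?thesis using bd_level_zero that by simp
  next
    case (Suc j)
    then have "keys (lin_ext s (lin_ext c u)) \<subseteq> below i b" using ks[OF keys_bd] that by simp
    then show ?thesis using that by (intro order_trans[OF keys_minus Un_least])
  qed
  have "keys (h x) \<subseteq> below (Suc i) b" if "x \<in> below i b" for i x
    using ks[OF r[of "single x 1" i]] that by (simp add: h_def)
  moreover have "lin_ext c (lin_ext h u) + lin_ext h (lin_ext c u) = u" if u: "keys u \<subseteq> below (Suc i) b" for i u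
  proof -
    let ?r = "u - lin_ext s (lin_ext c u)"
    have "lin_ext c ?r = 0" using sb[OF u] by (simp add: lin_ext_minus)
    then have "?r \<in> boundaries (Suc i) b" using r[OF u] assms unfolding exact_def by blast
    then obtain w where w: "keys w \<subseteq> below (Suc (Suc i)) b" "?r = lin_ext c w"
      unfolding boundaries_def by blast
    have "lin_ext c (lin_ext h u) = ?r" unfolding h w(2) by (rule sb[OF w(1)])
    moreover have "lin_ext h (lin_ext c u) = lin_ext s (lin_ext c u)"
      unfolding h using bd_bd[OF assms u] by simp
    ultimately show ?thesis by simp
  qed
  moreover have "lin_ext c (lin_ext h (lin_ext c u)) = lin_ext c u" if u: "keys u \<subseteq> below (Suc 0) b" for u
    unfolding h using bd_bd[OF assms u] sb[OF u] by simp
  ultimately show ?thesis unfolding contraction_def by (intro exI[of _ h]) blast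
qed

text \<open>The defect \<open>id - d h - h d\<close> of a contraction, which lives in homological degree \<open>0\<close>.\<close>

definition residue :: "('x \<Rightarrow> 'x \<Rightarrow>\<^sub>0 'k) \<Rightarrow> 'x \<Rightarrow> 'x \<Rightarrow>\<^sub>0 'k" where
  "residue h x = (if hdg x = 0 then single x 1 - lin_ext c (h x) else 0)"

lemma keys_residue:
  assumes "contraction b h" "x \<in> below i b" shows "keys (residue h x) \<subseteq> below i b"
proof (cases "hdg x = 0")
  case True
  then have x: "x \<in> below 0 b" "i = 0" using assms(2) by (auto simp: below_def)
  then have "keys (h x) \<subseteq> below (Suc 0) b" using assms(1) unfolding contraction_def by blast
  then have "keys (single x (1::'k) - lin_ext c (h x)) \<subseteq> below 0 b"
    using x(1) by (intro order_trans[OF keys_minus Un_least] keys_bd) auto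
  then show ?thesis using True x by (simp add: residue_def)
qed (simp add: residue_def)

lemma residue_level_zero:
  assumes "keys u \<subseteq> below 0 b"
  shows "lin_ext (residue h) u = u - lin_ext c (lin_ext h u)"
proof -
  have "lin_ext (residue h) u = lin_ext (\<lambda>x. single x 1 - lin_ext c (h x)) u"
    using assms by (rule lin_ext_eqI) (simp add: residue_def below_def)
  then show ?thesis by (simp add: lin_ext_fun_minus lin_ext_id lin_ext_lin_ext)
qed

lemma residue_eq_0_iff:
  assumes "contraction b h" "keys u \<subseteq> below 0 b"
  shows "lin_ext (residue h) u = 0 \<longleftrightarrow> u \<in> boundaries 0 b"
proof
  assume "lin_ext (residue h) u = 0"
  then have "u = lin_ext c (lin_ext h u)" using residue_level_zero[OF assms(2)] by simp
  moreover have "keys (lin_ext h u) \<subseteq> below (Suc 0) b"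
    using assms(2) by (rule keys_lin_ext_subset) (use assms(1) in \<open>simp add: contraction_def\<close>)
  ultimately show "u \<in> boundaries 0 b" unfolding boundaries_def by blast
next
  assume "u \<in> boundaries 0 b"
  then obtain w where w: "keys w \<subseteq> below (Suc 0) b" "u = lin_ext c w" unfolding boundaries_def by blast
  then show "lin_ext (residue h) u = 0"
    using residue_level_zero[OF assms(2)] assms(1) by (simp add: contraction_def)
qed

lemma residue_c:
  assumes "contraction b h" "x \<in> below i b" shows "lin_ext (residue h) (c x) = 0"
proof -
  consider "i = 0" | "i = Suc 0" | j where "i = Suc (Suc j)" by (metis nat.exhaust)
  then show ?thesis
  proof cases
    case 1
    then show ?thesis using c_level_zero assms by simp
  next
    case 2
    have "c x \<in> boundaries 0 b"
      unfolding boundaries_def using assms(2) 2 by (intro image_eqI[of _ _ "single x 1"]) auto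
    then show ?thesis using residue_eq_0_iff[OF assms(1)] keys_c_below assms(2) 2 by blast
  next
    case 3
    then have "keys (c x) \<subseteq> below (Suc j) b" using keys_c_below assms(2) by blast
    then have "lin_ext (residue h) (c x) = lin_ext (\<lambda>_. 0) (c x)"
      by (rule lin_ext_eqI) (simp add: residue_def below_def)
    then show ?thesis by (simp add: lin_ext_def)
  qed
qed

lemma bd_residue:
  assumes "contraction b h" "x \<in> below i b" shows "lin_ext c (residue h x) = 0"
proof (cases "hdg x = 0")
  case True
  then have "i = 0" using assms(2) by (simp add: below_def)
  then show ?thesis using keys_residue[OF assms] bd_level_zero by blast
qed (simp add: residue_def)

lemma contraction_residue:
  assumes "contraction b h" "x \<in> below i b"
  shows "lin_ext c (h x) + lin_ext h (c x) = single x 1 - residue h x"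
proof (cases i)
  case 0
  then show ?thesis using assms c_level_zero[of x b] by (auto simp: residue_def below_def)
next
  case (Suc j)
  then have "keys (single x (1::'k)) \<subseteq> below (Suc j) b" using assms(2) by simp
  then have "lin_ext c (lin_ext h (single x 1)) + lin_ext h (lin_ext c (single x 1)) = single x 1"
    using assms(1) unfolding contraction_def by blast
  then show ?thesis using Suc assms(2) by (auto simp: residue_def below_def)
qed

end

section \<open>Products of frames\<close>

lemma mlcm_mono: "mle a a' \<Longrightarrow> mle b b' \<Longrightarrow> mle (mlcm a b) (mlcm a' b')"
  unfolding mle_def by (auto intro: max.coboundedI1 max.coboundedI2)

lift_definition tens :: "('x \<Rightarrow>\<^sub>0 'k::field) \<Rightarrow> ('y \<Rightarrow>\<^sub>0 'k) \<Rightarrow> ('x \<times> 'y) \<Rightarrow>\<^sub>0 'k" is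
  "\<lambda>u v (x, y). u x * v y"
proof -
  fix u :: "'x \<Rightarrow> 'k" and v :: "'y \<Rightarrow> 'k"
  assume "finite {x. u x \<noteq> 0}" "finite {x. v x \<noteq> 0}"
  then have "finite ({x. u x \<noteq> 0} \<times> {x. v x \<noteq> 0})" by (rule finite_cartesian_product)
  then show "finite {x. (case x of (x, y) \<Rightarrow> u x * v y) \<noteq> 0}" by (rule rev_finite_subset) auto
qed

lemma lookup_tens [simp]: "lookup (tens u v) p = lookup u (fst p) * lookup v (snd p)"
  by (simp add: tens.rep_eq split: prod.split)

lemma keys_tens: "keys (tens u v) = keys u \<times> keys v"
  by (auto simp: in_keys_iff)

lemma tens_single: "tens (single x a) (single y b) = single (x, y) (a * b)"
  by (rule poly_mapping_eqI) (auto simp: lookup_single when_def)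

lemma tens_add: "tens (u + u') v = tens u v + tens u' v" "tens u (v + v') = tens u v + tens u v'"
  by (rule poly_mapping_eqI; simp add: lookup_add algebra_simps)+

lemma tens_minus: "tens (u - u') v = tens u v - tens u' v" "tens u (v - v') = tens u v - tens u v'"
  by (rule poly_mapping_eqI; simp add: lookup_minus algebra_simps)+

lemma tens_scal: "tens (scal a u) v = scal a (tens u v)" "tens u (scal a v) = scal a (tens u v)"
  by (rule poly_mapping_eqI; simp)+

lemma tens_zero [simp]: "tens 0 v = 0" "tens u 0 = 0"
  by (rule poly_mapping_eqI; simp)+

lemma tens_eq_0_iff: "tens u v = 0 \<longleftrightarrow> u = 0 \<or> v = 0"
proof
  assume 0: "tens u v = 0"
  show "u = 0 \<or> v = 0"
  proof (rule ccontr)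
    assume "\<not> (u = 0 \<or> v = 0)"
    then obtain x y where "lookup u x \<noteq> 0" "lookup v y \<noteq> 0"
      by (auto simp: poly_mapping_eq_iff fun_eq_iff)
    then show False using arg_cong[OF 0, of "\<lambda>w. lookup w (x, y)"] by simp
  qed
qed auto

lemma tens_sum: "tens (sum f A) v = (\<Sum>a\<in>A. tens (f a) v)" "tens u (sum g A) = (\<Sum>a\<in>A. tens u (g a))"
  by (induction A rule: infinite_finite_induct) (auto simp: tens_add)

lemma lin_ext_tens:
  assumes "\<And>x y. x \<in> keys u \<Longrightarrow> y \<in> keys v \<Longrightarrow> f (x, y) = tens (g x) (h y)"
  shows "lin_ext f (tens u v) = tens (lin_ext g u) (lin_ext h v)"
proof -
  have "lin_ext f (tens u v) = (\<Sum>x\<in>keys u. \<Sum>y\<in>keys v. scal (lookup u x * lookup v y) (tens (g x) (h y)))"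
    unfolding lin_ext_def keys_tens sum.cartesian_product using assms by (intro sum.cong) auto
  also have "\<dots> = tens (lin_ext g u) (lin_ext h v)"
    unfolding lin_ext_def tens_sum(1) tens_scal(1)
    by (simp add: tens_sum(2) tens_scal(2) scal_sum)
  finally show ?thesis .
qed

text \<open>The boundary is that of a tensor product of complexes. In a tensor product over the
  polynomial ring the degrees would add up; with least common multiples instead, the labels of
  degree dividing \<open>b\<close> are the pairs of such labels, and the strand in degree \<open>b\<close> is the tensor
  product of the strands over the field.\<close>

fun prod_hdg :: "('x \<Rightarrow> nat) \<Rightarrow> ('y \<Rightarrow> nat) \<Rightarrow> 'x \<times> 'y \<Rightarrow> nat" where
  "prod_hdg p q (x, y) = p x + q y"

fun prod_deg :: "('x \<Rightarrow> 'n expo) \<Rightarrow> ('y \<Rightarrow> 'n expo) \<Rightarrow> 'x \<times> 'y \<Rightarrow> 'n expo" where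
  "prod_deg d e (x, y) = mlcm (d x) (e y)"

fun prod_bd :: "('x \<Rightarrow> nat) \<Rightarrow> ('x \<Rightarrow> 'x \<Rightarrow>\<^sub>0 'k::field) \<Rightarrow> ('y \<Rightarrow> 'y \<Rightarrow>\<^sub>0 'k) \<Rightarrow> 'x \<times> 'y \<Rightarrow> ('x \<times> 'y) \<Rightarrow>\<^sub>0 'k" where
  "prod_bd p c c' (x, y) = tens (c x) (single y 1) + tens (single x ((-1) ^ p x)) (c' y)"

text \<open>\<open>pairing l\<close> is the linear functional with the values \<open>l\<close> on the basis, and \<open>contract l\<close> is
  the map \<open>l \<otimes> id\<close>.\<close>

definition pairing :: "('x \<Rightarrow> 'k::field) \<Rightarrow> ('x \<Rightarrow>\<^sub>0 'k) \<Rightarrow> 'k" where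
  "pairing l u = lookup (lin_ext (\<lambda>x. single () (l x)) u) ()"

definition contract :: "('x \<Rightarrow> 'k::field) \<Rightarrow> ('x \<times> 'y \<Rightarrow>\<^sub>0 'k) \<Rightarrow> 'y \<Rightarrow>\<^sub>0 'k" where
  "contract l = lin_ext (\<lambda>(x, y). single y (l x))"

locale frame_pair = F: frame X hX degX c + G: frame Y hY degY c'
  for X :: "'x set" and hX and degX :: "'x \<Rightarrow> 'n::finite expo" and c :: "'x \<Rightarrow> 'x \<Rightarrow>\<^sub>0 'k::field"
    and Y :: "'y set" and hY and degY :: "'y \<Rightarrow> 'n expo" and c' :: "'y \<Rightarrow> 'y \<Rightarrow>\<^sub>0 'k"
begin

sublocale P: frame "X \<times> Y" "prod_hdg hX hY" "prod_deg degX degY" "prod_bd hX c c'"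
proof
  fix p q assume p: "p \<in> X \<times> Y" and q: "q \<in> keys (prod_bd hX c c' p)"
  obtain x y x' y' where [simp]: "p = (x, y)" "q = (x', y')" by (metis surj_pair)
  have "q \<in> keys (c x) \<times> {y} \<union> {x} \<times> keys (c' y)"
    using q keys_add[of "tens (c x) (single y 1)" "tens (single x ((-1) ^ hX x)) (c' y)"]
    by (auto simp: keys_tens split: if_splits)
  then show "q \<in> X \<times> Y \<and> Suc (prod_hdg hX hY q) = prod_hdg hX hY p \<and>
      mle (prod_deg degX degY q) (prod_deg degX degY p)"
    using F.keys_c[of x x'] G.keys_c[of y y'] p mlcm_mono[of "degX x'" "degX x" "degY y'" "degY y"]
    by (auto simp del: mlcm_mle)
qed

lemma level_prod: "p \<in> P.level m \<longleftrightarrow>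
    (\<exists>i j. m = i + j \<and> fst p \<in> F.level i \<and> snd p \<in> G.level j)"
  by (cases p) (auto simp: P.level_def F.level_def G.level_def)

lemma below_prod: "p \<in> P.below m b \<longleftrightarrow>
    (\<exists>i j. m = i + j \<and> fst p \<in> F.below i b \<and> snd p \<in> G.below j b)"
  by (cases p) (auto simp: P.below_def F.below_def G.below_def)

lemma keys_tens_below:
  assumes "keys u \<subseteq> F.below i b" "keys v \<subseteq> G.below j b"
  shows "keys (tens u v) \<subseteq> P.below (i + j) b"
proof
  fix p assume "p \<in> keys (tens u v)"
  then have "fst p \<in> F.below i b" "snd p \<in> G.below j b" using assms by (auto simp: keys_tens)
  then show "p \<in> P.below (i + j) b" using below_prod by blast
qed

abbreviation D where "D \<equiv> lin_ext (prod_bd hX c c')"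

lemma D_tens:
  assumes "\<And>x. x \<in> keys u \<Longrightarrow> hX x = i"
  shows "D (tens u v) = tens (lin_ext c u) v + scal ((-1) ^ i) (tens u (lin_ext c' v))"
proof -
  have "D (tens u v) = lin_ext (\<lambda>(x, y). tens (c x) (single y 1) + scal ((-1) ^ i) (tens (single x 1) (c' y))) (tens u v)"
  proof (rule lin_ext_eqI[of _ "keys u \<times> keys v"])
    fix p assume "p \<in> keys u \<times> keys v"
    moreover have "tens (single x ((-1) ^ i)) (c' y) = scal ((-1) ^ i) (tens (single x 1) (c' y))" for x y
      by (simp flip: tens_scal)
    ultimately show "prod_bd hX c c' p =
      (case p of (x, y) \<Rightarrow> tens (c x) (single y 1) + scal ((-1) ^ i) (tens (single x 1) (c' y)))"
      using assms by auto
  qed (simp add: keys_tens)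
  also have "\<dots> = lin_ext (\<lambda>(x, y). tens (c x) (single y 1)) (tens u v)
      + lin_ext (\<lambda>(x, y). tens (scal ((-1) ^ i) (single x 1)) (c' y)) (tens u v)"
    by (simp only: lin_ext_fun_add[symmetric] case_prod_unfold tens_scal)
  also have "lin_ext (\<lambda>(x, y). tens (c x) (single y 1)) (tens u v) = tens (lin_ext c u) (lin_ext (\<lambda>y. single y 1) v)"
    by (rule lin_ext_tens) simp
  also have "lin_ext (\<lambda>(x, y). tens (scal ((-1) ^ i) (single x 1)) (c' y)) (tens u v)
      = tens (lin_ext (\<lambda>x. scal ((-1) ^ i) (single x 1)) u) (lin_ext c' v)"
    by (rule lin_ext_tens) simp
  also have "lin_ext (\<lambda>x. scal ((-1) ^ i) (single x (1::'k))) u = scal ((-1) ^ i) u"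
    using lin_ext_lin_ext[of "\<lambda>x. single x ((-1) ^ i)" "\<lambda>x. single x 1" u]
    by (simp add: lin_ext_def[of "\<lambda>x. single x (_ x)"] poly_mapping_eq_iff fun_eq_iff lookup_sum lookup_single when_def in_keys_iff)
  finally show ?thesis by (simp only: lin_ext_id tens_scal)
qed

lemma D_D_zero:
  assumes F.exact G.exact "keys w \<subseteq> X \<times> Y" shows "D (D w) = 0"
proof -
  have "D (prod_bd hX c c' p) = 0" if pXY: "p \<in> X \<times> Y" for p
  proof -
    obtain x y where p: "p = (x, y)" "x \<in> X" "y \<in> Y" using pXY by blast
    have x: "x \<in> F.below (hX x) (degX x)" and y: "y \<in> G.below (hY y) (degY y)"
      using p by (auto simp: F.below_def G.below_def)
    have cc: "lin_ext c (c x) = 0"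
    proof (cases "hX x")
      case 0
      then show ?thesis using F.c_level_zero[of x "degX x"] x by simp
    next
      case (Suc i)
      then show ?thesis using F.bd_bd[OF assms(1), of "single x 1" i "degX x"] x by simp
    qed
    have cc': "lin_ext c' (c' y) = 0"
    proof (cases "hY y")
      case 0
      then show ?thesis using G.c_level_zero[of y "degY y"] y by simp
    next
      case (Suc i)
      then show ?thesis using G.bd_bd[OF assms(2), of "single y 1" i "degY y"] y by simp
    qed
    have e: "tens (single x ((-1) ^ hX x)) (c' y) = scal ((-1) ^ hX x) (tens (single x 1) (c' y))"
      by (simp flip: tens_scal)
    have 2: "D (tens (single x 1) (c' y)) = tens (c x) (c' y)"
      using D_tens[of "single x 1" "hX x" "c' y"] cc' by simp
    show ?thesis
    proof (cases "hX x")
      case 0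
      then have "c x = 0" using F.c_level_zero[of x "degX x"] x by simp
      then show ?thesis using 2 0 by (simp add: p e lin_ext_add lin_ext_scal)
    next
      case (Suc i)
      have "\<And>z. z \<in> keys (c x) \<Longrightarrow> hX z = i" using F.keys_c[OF p(2)] Suc by auto
      then have "D (tens (c x) (single y 1)) = scal ((-1) ^ i) (tens (c x) (c' y))"
        using D_tens[of "c x" i "single y 1"] cc by simp
      moreover have "D (prod_bd hX c c' p) =
          D (tens (c x) (single y 1)) + scal ((-1) ^ hX x) (D (tens (single x 1) (c' y)))"
        by (simp only: p prod_bd.simps e lin_ext_add lin_ext_scal)
      ultimately show ?thesis using 2 Suc by (simp add: scal_uminus)
    qed
  qed
  then show ?thesis using assms(3) unfolding lin_ext_lin_ext
    by (auto simp: lin_ext_def intro!: sum.neutral)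
qed

text \<open>Let \<open>\<pi>\<close> and \<open>\<pi>'\<close> be the residues of \<open>h\<close> and \<open>h'\<close>. Since \<open>\<pi>\<close> commutes with the boundary (both
  products vanish), the map \<open>H = h \<otimes> id + \<pi> \<otimes> h'\<close> satisfies \<open>D H + H D = (id - \<pi>) \<otimes> id + \<pi> \<otimes> (id -
  \<pi>') = id - \<pi> \<otimes> \<pi>'\<close>; the mixed terms \<open>h \<otimes> d'\<close> cancel by the signs.\<close>

lemma product_homotopy:
  assumes h: "F.contraction b h" and h': "G.contraction b h'"
  defines "H \<equiv> \<lambda>(x, y). tens (h x) (single y 1) + tens (F.residue h x) (h' y)"
  shows "p \<in> P.below m b \<Longrightarrow> keys (H p) \<subseteq> P.below (Suc m) b"
    and "p \<in> P.below m b \<Longrightarrow> D (H p) + lin_ext H (prod_bd hX c c' p) =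
      single p 1 - tens (F.residue h (fst p)) (G.residue h' (snd p))"
proof -
  let ?R = "F.residue h" let ?R' = "G.residue h'"
  assume "p \<in> P.below m b"
  then obtain i j where m: "m = i + j" "fst p \<in> F.below i b" "snd p \<in> G.below j b"
    using below_prod by blast
  obtain x y where p: "p = (x, y)" by fastforce
  have x: "x \<in> F.below i b" and y: "y \<in> G.below j b" using m p by auto
  have hx: "keys (h x) \<subseteq> F.below (Suc i) b" using h x unfolding F.contraction_def by blast
  have hy: "keys (h' y) \<subseteq> G.below (Suc j) b" using h' y unfolding G.contraction_def by blast
  have rx: "keys (?R x) \<subseteq> F.below i b" by (rule F.keys_residue[OF h x])
  have "keys (tens (h x) (single y (1::'k))) \<subseteq> P.below (Suc m) b"
    using keys_tens_below[OF hx, of "single y 1" j] y m(1) by simp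
  moreover have "keys (tens (?R x) (h' y)) \<subseteq> P.below (Suc m) b"
    using keys_tens_below[OF rx hy] m(1) by simp
  ultimately show "keys (H p) \<subseteq> P.below (Suc m) b"
    unfolding H_def p prod.case by (intro order_trans[OF keys_add Un_least])
  have LH: "lin_ext H (tens u v) = tens (lin_ext h u) v + tens (lin_ext ?R u) (lin_ext h' v)" for u v
  proof -
    have "lin_ext H (tens u v) = lin_ext (\<lambda>(x, y). tens (h x) (single y 1)) (tens u v)
        + lin_ext (\<lambda>(x, y). tens (?R x) (h' y)) (tens u v)"
      by (simp only: lin_ext_fun_add[symmetric] case_prod_unfold H_def)
    also have "\<dots> = tens (lin_ext h u) (lin_ext (\<lambda>y. single y 1) v) + tens (lin_ext ?R u) (lin_ext h' v)"
      by (intro arg_cong2[where f = "(+)"] lin_ext_tens) auto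
    finally show ?thesis by (simp only: lin_ext_id)
  qed
  have hX: "hX z = Suc i" if "z \<in> keys (h x)" for z using hx that by (auto simp: F.below_def)
  have hR: "hX z = 0" if "z \<in> keys (?R x)" for z
    using rx that x by (cases "hX x = 0") (auto simp: F.below_def F.residue_def)
  have sR: "scal ((-1) ^ i) (?R x) = ?R x"
    using x by (cases "i = 0") (auto simp: F.residue_def F.below_def)
  have e: "tens (single x ((-1) ^ hX x)) (c' y) = scal ((-1) ^ i) (tens (single x 1) (c' y))"
    using x by (simp add: F.below_def flip: tens_scal)
  have 1: "D (tens (h x) (single y 1)) = tens (lin_ext c (h x)) (single y 1) - scal ((-1) ^ i) (tens (h x) (c' y))"
    using D_tens[OF hX, where v = "single y 1"] by (simp add: scal_uminus)
  have 2: "D (tens (?R x) (h' y)) = tens (?R x) (lin_ext c' (h' y))"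
    using D_tens[OF hR, where v = "h' y"] F.bd_residue[OF h x] by simp
  have 3: "lin_ext H (tens (c x) (single y 1)) = tens (lin_ext h (c x)) (single y 1)"
    using LH[of "c x" "single y 1"] F.residue_c[OF h x] by simp
  have 4: "lin_ext H (scal ((-1) ^ i) (tens (single x 1) (c' y)))
      = scal ((-1) ^ i) (tens (h x) (c' y)) + tens (?R x) (lin_ext h' (c' y))"
  proof -
    have "lin_ext H (tens (single x 1) (c' y)) = tens (h x) (c' y) + tens (?R x) (lin_ext h' (c' y))"
      using LH[of "single x 1" "c' y"] by simp
    moreover have "scal ((-1) ^ i) (tens (?R x) (lin_ext h' (c' y))) = tens (?R x) (lin_ext h' (c' y))"
      by (simp only: tens_scal(1)[symmetric] sR)
    ultimately show ?thesis by (simp only: lin_ext_scal scal_add)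
  qed
  have "D (H p) + lin_ext H (prod_bd hX c c' p) =
      tens (lin_ext c (h x) + lin_ext h (c x)) (single y 1)
      + tens (?R x) (lin_ext c' (h' y) + lin_ext h' (c' y))"
    unfolding p prod_bd.simps e lin_ext_add 3 4 by (simp add: H_def lin_ext_add 1 2 tens_add)
  also have "\<dots> = tens (single x 1 - ?R x) (single y 1) + tens (?R x) (single y 1 - ?R' y)"
    using F.contraction_residue[OF h x] G.contraction_residue[OF h' y] by simp
  also have "\<dots> = single p 1 - tens (?R x) (?R' y)"
    by (simp add: tens_minus tens_single p)
  finally show "D (H p) + lin_ext H (prod_bd hX c c' p) =
      single p 1 - tens (?R (fst p)) (?R' (snd p))" by (simp add: p)
qed

text \<open>In positive homological degrees the term \<open>\<pi> \<otimes> \<pi>'\<close> of \<open>product_homotopy\<close> is zero.\<close>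

theorem product_exact:
  assumes F.exact G.exact
  shows P.exact
  unfolding P.exact_def
proof (intro allI impI iffI)
  fix m b and z :: "'x \<times> 'y \<Rightarrow>\<^sub>0 'k"
  assume z: "keys z \<subseteq> P.below (Suc m) b"
  obtain h h' where h: "F.contraction b h" and h': "G.contraction b h'"
    using F.contraction_exists[OF assms(1)] G.contraction_exists[OF assms(2)] by blast
  let ?H = "\<lambda>(x, y). tens (h x) (single y 1) + tens (F.residue h x) (h' y)"
  note H = product_homotopy[OF h h']
  {
    assume Dz: "D z = 0"
    have "D (lin_ext ?H z) + lin_ext ?H (D z) = lin_ext (\<lambda>p. D (?H p) + lin_ext ?H (prod_bd hX c c' p)) z"
      by (simp only: lin_ext_lin_ext lin_ext_fun_add)
    also have "\<dots> = lin_ext (\<lambda>p. single p 1) z"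
    proof (rule lin_ext_eqI[OF z])
      fix p assume p: "p \<in> P.below (Suc m) b"
      then have "hX (fst p) \<noteq> 0 \<or> hY (snd p) \<noteq> 0" by (cases p) (auto simp: P.below_def)
      then have "tens (F.residue h (fst p)) (G.residue h' (snd p)) = 0"
        by (auto simp: F.residue_def G.residue_def)
      then show "D (?H p) + lin_ext ?H (prod_bd hX c c' p) = single p 1" using H(2)[OF p] by simp
    qed
    also have "\<dots> = z" by (rule lin_ext_id)
    finally have "z = D (lin_ext ?H z)" using Dz by simp
    moreover have "keys (lin_ext ?H z) \<subseteq> P.below (Suc (Suc m)) b"
      using z by (rule keys_lin_ext_subset) (rule H(1))
    ultimately show "z \<in> P.boundaries (Suc m) b" unfolding P.boundaries_def by blast
  next
    assume "z \<in> P.boundaries (Suc m) b"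
    then obtain w where w: "keys w \<subseteq> P.below (Suc (Suc m)) b" "z = D w" unfolding P.boundaries_def by blast
    then have "keys w \<subseteq> X \<times> Y" by (auto simp: P.below_def)
    then show "D z = 0" using D_D_zero[OF assms] w(2) by simp
  }
qed

text \<open>In homological degree \<open>0\<close> the boundaries form the kernel of \<open>\<pi> \<otimes> \<pi>'\<close>, by \<open>product_homotopy\<close>.
  If the boundaries of the first factor are the kernel of a functional \<open>l\<close>, then \<open>\<pi>\<close> has the same
  kernel, so that \<open>\<pi> u = l(u) w\<close> for a fixed vector \<open>w\<close>, and \<open>\<pi> \<otimes> \<pi>'\<close> kills \<open>z\<close> exactly when \<open>\<pi>'\<close>
  kills \<open>(l \<otimes> id) z\<close>.\<close>

theorem product_boundaries:
  assumes F.exact G.exact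
    and l: "\<And>u. keys u \<subseteq> F.below 0 b \<Longrightarrow> pairing l u = 0 \<longleftrightarrow> u \<in> F.boundaries 0 b"
    and z: "keys z \<subseteq> P.below 0 b"
  shows "z \<in> P.boundaries 0 b \<longleftrightarrow> contract l z \<in> G.boundaries 0 b"
proof -
  obtain h h' where h: "F.contraction b h" and h': "G.contraction b h'"
    using F.contraction_exists[OF assms(1)] G.contraction_exists[OF assms(2)] by blast
  let ?H = "\<lambda>(x, y). tens (h x) (single y 1) + tens (F.residue h x) (h' y)"
  note H = product_homotopy[OF h h']
  let ?R = "F.residue h" let ?R' = "G.residue h'"
  let ?Q = "\<lambda>p. tens (?R (fst p)) (?R' (snd p))"
  have below0: "fst p \<in> F.below 0 b" "snd p \<in> G.below 0 b" if "p \<in> P.below 0 b" for p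
    using that below_prod[of p 0 b] by auto
  have Dz0: "D z = 0" by (rule P.bd_level_zero[OF z])
  have DH: "D (lin_ext ?H z) = z - lin_ext ?Q z"
  proof -
    have "D (lin_ext ?H z) + lin_ext ?H (D z) = lin_ext (\<lambda>p. D (?H p) + lin_ext ?H (prod_bd hX c c' p)) z"
      by (simp only: lin_ext_lin_ext lin_ext_fun_add)
    also have "\<dots> = lin_ext (\<lambda>p. single p 1 - ?Q p) z" by (rule lin_ext_eqI[OF z]) (rule H(2))
    finally show ?thesis using Dz0 by (simp add: lin_ext_fun_minus lin_ext_id)
  qed
  have Q: "z \<in> P.boundaries 0 b \<longleftrightarrow> lin_ext ?Q z = 0"
  proof
    assume "lin_ext ?Q z = 0"
    then have "z = D (lin_ext ?H z)" using DH by simp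
    moreover have "keys (lin_ext ?H z) \<subseteq> P.below (Suc 0) b"
      using z by (rule keys_lin_ext_subset) (rule H(1))
    ultimately show "z \<in> P.boundaries 0 b" unfolding P.boundaries_def by blast
  next
    assume "z \<in> P.boundaries 0 b"
    then obtain w where w: "keys w \<subseteq> P.below (Suc 0) b" "z = D w" unfolding P.boundaries_def by blast
    have "lin_ext ?Q (D w) = lin_ext (\<lambda>p. lin_ext ?Q (prod_bd hX c c' p)) w" by (rule lin_ext_lin_ext)
    also have "\<dots> = lin_ext (\<lambda>_. 0) w"
    proof (rule lin_ext_eqI[OF w(1)])
      fix p assume "p \<in> P.below (Suc 0) b"
      then obtain i j where ij: "fst p \<in> F.below i b" "snd p \<in> G.below j b"
        using below_prod[of p "Suc 0" b] by blast
      obtain x y where p: "p = (x, y)" by fastforce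
      have LQ: "lin_ext ?Q (tens u v) = tens (lin_ext ?R u) (lin_ext ?R' v)" for u v
        by (rule lin_ext_tens) simp
      have "lin_ext ?R (c x) = 0" "lin_ext ?R' (c' y) = 0"
        using F.residue_c[OF h ij(1)] G.residue_c[OF h' ij(2)] by (simp_all add: p)
      then show "lin_ext ?Q (prod_bd hX c c' p) = 0" by (simp add: p lin_ext_add LQ)
    qed
    finally show "lin_ext ?Q z = 0" using w(2) by (simp add: lin_ext_def)
  qed
  have kc: "keys (contract l z) \<subseteq> G.below 0 b"
    unfolding contract_def using z by (rule keys_lin_ext_subset) (auto dest: below0(2) split: if_splits)
  have G0: "contract l z \<in> G.boundaries 0 b \<longleftrightarrow> lin_ext ?R' (contract l z) = 0"
    using G.residue_eq_0_iff[OF h' kc] by simp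
  show ?thesis
  proof (cases "\<exists>x\<in>F.below 0 b. l x \<noteq> 0")
    case False
    have "?R x = 0" if "x \<in> F.below 0 b" for x
    proof -
      have "single x 1 \<in> F.boundaries 0 b" using l[of "single x 1"] that False by (simp add: pairing_def)
      then show ?thesis using F.residue_eq_0_iff[OF h, of "single x 1"] that by simp
    qed
    then have "lin_ext ?Q z = lin_ext (\<lambda>_. 0) z" by (intro lin_ext_eqI[OF z]) (simp add: below0)
    then have "lin_ext ?Q z = 0" by (simp add: lin_ext_def)
    moreover have "contract l z = lin_ext (\<lambda>_. 0) z"
      unfolding contract_def using False by (intro lin_ext_eqI[OF z]) (auto dest: below0(1))
    then have "contract l z = 0" by (simp add: lin_ext_def)
    ultimately show ?thesis using Q G0 by simp
  next
    case True
    then obtain x0 where x0: "x0 \<in> F.below 0 b" "l x0 \<noteq> 0" by blast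
    have Rx: "?R x = scal (l x / l x0) (?R x0)" if x: "x \<in> F.below 0 b" for x
    proof -
      let ?u = "single x 1 - scal (l x / l x0) (single x0 1)"
      have k: "keys ?u \<subseteq> F.below 0 b" using x x0(1) by (intro order_trans[OF keys_minus Un_least]) auto
      have "pairing l ?u = 0" using x0(2) by (simp add: pairing_def lin_ext_minus lookup_minus)
      then have "lin_ext ?R ?u = 0" using l[OF k] F.residue_eq_0_iff[OF h k] by simp
      then show ?thesis by (simp add: lin_ext_minus)
    qed
    have R0: "?R x0 \<noteq> 0"
    proof
      assume "?R x0 = 0"
      then have "single x0 1 \<in> F.boundaries 0 b" using F.residue_eq_0_iff[OF h, of "single x0 1"] x0(1) by simp
      then show False using l[of "single x0 1"] x0 by (simp add: pairing_def)
    qed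
    have "lin_ext ?Q z = lin_ext (\<lambda>(x, y). tens (scal (l x / l x0) (?R x0)) (?R' y)) z"
      by (rule lin_ext_eqI[OF z]) (use Rx below0(1) in \<open>force split: prod.split\<close>)
    also have "\<dots> = tens (?R x0) (scal (1 / l x0) (lin_ext ?R' (contract l z)))"
      unfolding contract_def lin_ext_lin_ext
      unfolding lin_ext_def[of _ z] tens_sum scal_sum
      by (auto intro!: sum.cong simp: tens_scal field_simps split: prod.splits)
    finally show ?thesis
      unfolding Q G0 using R0 x0(2) by (auto simp: tens_eq_0_iff poly_mapping_eq_iff fun_eq_iff)
  qed
qed

end

section \<open>Existence of minimal frames\<close>

lemma nat_mono_subsequence:
  fixes s :: "nat \<Rightarrow> nat"
  shows "\<exists>r :: nat \<Rightarrow> nat. strict_mono r \<and> (\<forall>m n. m \<le> n \<longrightarrow> s (r m) \<le> s (r n))"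
proof -
  obtain r :: "nat \<Rightarrow> nat" where r: "strict_mono r" "monoseq (\<lambda>n. s (r n))"
    using seq_monosub[of s] by blast
  show ?thesis
  proof (cases "\<forall>m n. m \<le> n \<longrightarrow> s (r m) \<le> s (r n)")
    case False
    then have dec: "\<And>m n. m \<le> n \<Longrightarrow> s (r n) \<le> s (r m)" using r(2) unfolding monoseq_def by blast
    define k where "k = (LEAST k. k \<in> range (\<lambda>n. s (r n)))"
    have "k \<in> range (\<lambda>n. s (r n))" unfolding k_def by (rule LeastI_ex) blast
    then obtain N where N: "k = s (r N)" by blast
    have "s (r (n + N)) = k" for n
    proof (rule antisym)
      show "s (r (n + N)) \<le> k" using dec[of N "n + N"] N by simp
      show "k \<le> s (r (n + N))" unfolding k_def by (rule Least_le) blast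
    qed
    moreover have "strict_mono (\<lambda>n. r (n + N))"
      using r(1) by (simp add: strict_mono_def)
    ultimately show ?thesis by (intro exI[of _ "\<lambda>n. r (n + N)"]) simp
  qed (use r in blast)
qed

text \<open>Dickson's lemma, obtained by passing to a subsequence for one variable after the other.\<close>

lemma dickson_sequence:
  fixes g :: "nat \<Rightarrow> 'n::finite expo"
  shows "\<exists>r :: nat \<Rightarrow> nat. strict_mono r \<and> (\<forall>m n. m \<le> n \<longrightarrow> mle (g (r m)) (g (r n)))"
proof -
  have "\<exists>r :: nat \<Rightarrow> nat. strict_mono r \<and> (\<forall>i\<in>S. \<forall>m n. m \<le> n \<longrightarrow> lookup (g (r m)) i \<le> lookup (g (r n)) i)"
    if "finite S" for S :: "'n set"
    using that
  proof (induction S rule: finite_induct)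
    case empty
    show ?case by (intro exI[of _ id]) (simp add: strict_mono_def)
  next
    case (insert j S)
    then obtain r :: "nat \<Rightarrow> nat" where r: "strict_mono r"
      "\<forall>i\<in>S. \<forall>m n. m \<le> n \<longrightarrow> lookup (g (r m)) i \<le> lookup (g (r n)) i" by blast
    obtain q :: "nat \<Rightarrow> nat" where q: "strict_mono q"
      "\<forall>m n. m \<le> n \<longrightarrow> lookup (g (r (q m))) j \<le> lookup (g (r (q n))) j"
      using nat_mono_subsequence[of "\<lambda>n. lookup (g (r n)) j"] by blast
    have "strict_mono (\<lambda>n. r (q n))" using r(1) q(1) by (simp add: strict_mono_def)
    moreover have "lookup (g (r (q m))) i \<le> lookup (g (r (q n))) i" if "i \<in> insert j S" "m \<le> n" for i m n
      using r(2) q(2) that monoD[OF strict_mono_mono[OF q(1)], of m n] by auto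
    ultimately show ?case by (intro exI[of _ "\<lambda>n. r (q n)"]) blast
  qed
  from this[of UNIV] show ?thesis by (simp add: mle_def) blast
qed

lemma total_degree_strict: "mle a b \<Longrightarrow> a \<noteq> b \<Longrightarrow> total_degree a < total_degree b"
proof -
  assume ab: "mle a b" "a \<noteq> b"
  then obtain i where "lookup a i \<noteq> lookup b i" by (auto simp: poly_mapping_eq_iff fun_eq_iff)
  then have "lookup a i < lookup b i" using ab(1) by (auto simp: mle_def le_less)
  then show ?thesis unfolding total_degree_def using ab(1) by (intro sum_strict_mono_ex1) (auto simp: mle_def)
qed

interpretation pm: vector_space "scal :: 'k::field \<Rightarrow> ('x \<Rightarrow>\<^sub>0 'k) \<Rightarrow> 'x \<Rightarrow>\<^sub>0 'k"
  by (rule vector_space_scal)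

text \<open>A multigraded submodule of a free module in the coordinates of \<open>component\<close>: multiplication
  by monomials becomes inclusion, so the submodule is an increasing family of subspaces.\<close>

definition monotone_family ::
    "('n::finite expo \<Rightarrow> 'x set) \<Rightarrow> ('n expo \<Rightarrow> ('x \<Rightarrow>\<^sub>0 'k::field) set) \<Rightarrow> bool" where
  "monotone_family A K \<longleftrightarrow> (\<forall>b. pm.subspace (K b)) \<and> (\<forall>b. \<forall>u\<in>K b. keys u \<subseteq> A b) \<and>
    (\<forall>b b'. mle b b' \<longrightarrow> K b \<subseteq> K b')"

lemma keys_in_span_singles:
  assumes "finite A" "keys (u :: 'x \<Rightarrow>\<^sub>0 'k::field) \<subseteq> A" shows "u \<in> pm.span ((\<lambda>x. single x 1) ` A)"
proof -
  have "(\<Sum>x\<in>A. scal (lookup u x) (single x 1)) \<in> pm.span ((\<lambda>x. single x 1) ` A)"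
    by (intro pm.span_sum pm.span_scale pm.span_base) auto
  then show ?thesis using poly_mapping_sum_singles[OF assms] by simp
qed

lemma independent_finite:
  assumes "finite A" "pm.independent S" "\<And>u. u \<in> S \<Longrightarrow> keys (u :: 'x \<Rightarrow>\<^sub>0 'k::field) \<subseteq> A"
  shows "finite S \<and> card S \<le> card A"
proof -
  have "finite S \<and> card S \<le> card ((\<lambda>x. single x (1::'k)) ` A)"
    using assms by (intro pm.independent_span_bound) (auto intro: keys_in_span_singles)
  then show ?thesis using card_image_le[OF assms(1), of "\<lambda>x. single x (1::'k)"] by linarith
qed

lemma lin_ext_in_subspace:
  fixes w :: "'x \<Rightarrow> 'y \<Rightarrow>\<^sub>0 'k::field"
  assumes "pm.subspace V" "\<And>x. x \<in> keys u \<Longrightarrow> w x \<in> V" shows "lin_ext w u \<in> V"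
  unfolding lin_ext_def using assms by (intro pm.subspace_sum pm.subspace_scale) auto

text \<open>A minimal set of homogeneous generators, with labels \<open>(m, 0), \<dots>, (m, n - 1)\<close>: the first
  entry will be the homological degree. Let \<open>L b\<close> be the part of \<open>K b\<close> that comes from smaller
  degrees, and let \<open>W b\<close> be a smallest set that spans \<open>K b\<close> together with \<open>L b\<close>. If infinitely
  many \<open>W b\<close> were nonempty, then by Dickson's lemma their degrees would include a chain, and new
  elements along the chain would be linearly independent in a vector space of finite dimension. In
  a relation of degree \<open>b\<close>, a generator of degree \<open>b\<close> cannot have a nonzero coefficient, since it
  would be redundant in \<open>W b\<close>.\<close>

lemma monotone_family_generators:
  fixes K :: "'n::finite expo \<Rightarrow> ('x \<Rightarrow>\<^sub>0 'k::field) set" and m :: nat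
  assumes K: "monotone_family A K" and A: "finite (\<Union>b. A b)"
  shows "\<exists>n (B :: nat \<times> nat \<Rightarrow> 'n expo) w.
    (\<forall>x\<in>{m} \<times> {..<n}. w x \<in> K (B x)) \<and>
    (\<forall>b. K b = lin_ext w ` {u. keys u \<subseteq> {x\<in>{m} \<times> {..<n}. mle (B x) b}}) \<and>
    (\<forall>b u. keys u \<subseteq> {x\<in>{m} \<times> {..<n}. mle (B x) b} \<longrightarrow> lin_ext w u = 0 \<longrightarrow> (\<forall>x\<in>keys u. B x \<noteq> b))"
proof -
  have sub: "\<And>b. pm.subspace (K b)" and kA: "\<And>b u. u \<in> K b \<Longrightarrow> keys u \<subseteq> (\<Union>b. A b)"
    and mono: "\<And>b b'. mle b b' \<Longrightarrow> K b \<subseteq> K b'"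
    using K unfolding monotone_family_def by blast+
  define L where "L b = pm.span (\<Union>b'\<in>{b'. mle b' b \<and> b' \<noteq> b}. K b')" for b
  define spans where "spans b W \<longleftrightarrow> finite W \<and> W \<subseteq> K b \<and> K b \<subseteq> pm.span (L b \<union> W)" for b W
  have ex: "\<exists>W. spans b W" for b
  proof -
    obtain S where S: "S \<subseteq> K b" "pm.independent S" "K b \<subseteq> pm.span S"
      using pm.maximal_independent_subset[of "K b"] by blast
    have "finite S" using independent_finite[OF A S(2)] S(1) kA by blast
    moreover have "pm.span S \<subseteq> pm.span (L b \<union> S)" by (rule pm.span_mono) simp
    ultimately show ?thesis using S unfolding spans_def by blast
  qed
  define W where "W b = (ARG_MIN card W. spans b W)" for b
  have W: "spans b (W b)" for b
  proof -
    obtain V where "spans b V" using ex by blast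
    then show ?thesis unfolding W_def by (rule arg_min_natI)
  qed
  have W_min: "card (W b) \<le> card V" if "spans b V" for b V
    unfolding W_def using that by (rule arg_min_nat_le)
  have W_indep: "v \<notin> pm.span (L b \<union> (W b - {v}))" if v: "v \<in> W b" for b v
  proof
    assume s: "v \<in> pm.span (L b \<union> (W b - {v}))"
    have "L b \<union> W b \<subseteq> pm.span (L b \<union> (W b - {v}))" using s by (auto intro: pm.span_base)
    then have "pm.span (L b \<union> W b) \<subseteq> pm.span (L b \<union> (W b - {v}))"
      by (rule pm.span_minimal) (rule pm.subspace_span)
    then have "spans b (W b - {v})" using W[of b] unfolding spans_def by blast
    then have "card (W b) \<le> card (W b - {v})" by (rule W_min)
    moreover have "card (W b - {v}) < card (W b)"
      using W[of b] v unfolding spans_def by (intro card_Diff1_less) auto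
    ultimately show False by simp
  qed
  have "finite {b. W b \<noteq> {}}"
  proof (rule ccontr)
    assume "infinite {b. W b \<noteq> {}}"
    then obtain g :: "nat \<Rightarrow> 'n expo" where g: "inj g" "range g \<subseteq> {b. W b \<noteq> {}}"
      using infinite_countable_subset by blast
    obtain r :: "nat \<Rightarrow> nat" where r: "strict_mono r" "\<And>m n. m \<le> n \<Longrightarrow> mle (g (r m)) (g (r n))"
      using dickson_sequence[of g] by blast
    have "\<exists>u. u \<in> K (g (r i)) \<and> u \<notin> L (g (r i))" for i
    proof (rule ccontr)
      assume "\<nexists>u. u \<in> K (g (r i)) \<and> u \<notin> L (g (r i))"
      then have "spans (g (r i)) {}" unfolding spans_def by (auto intro: pm.span_base)
      then have "card (W (g (r i))) = 0" using W_min[of "g (r i)" "{}"] by simp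
      then have "W (g (r i)) = {}" using W[of "g (r i)"] unfolding spans_def by simp
      then show False using g(2) by blast
    qed
    then obtain u where u: "\<And>i. u i \<in> K (g (r i))" "\<And>i. u i \<notin> L (g (r i))" by metis
    have new: "u i \<notin> pm.span (u ` {..<i})" for i
    proof
      assume i: "u i \<in> pm.span (u ` {..<i})"
      have "u ` {..<i} \<subseteq> (\<Union>b'\<in>{b'. mle b' (g (r i)) \<and> b' \<noteq> g (r i)}. K b')"
      proof
        fix z assume "z \<in> u ` {..<i}"
        then obtain j where j: "j < i" "z = u j" by blast
        then have "g (r j) \<noteq> g (r i)" using g(1) strict_monoD[OF r(1) j(1)] by (auto simp: inj_eq)
        then show "z \<in> (\<Union>b'\<in>{b'. mle b' (g (r i)) \<and> b' \<noteq> g (r i)}. K b')"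
          using r(2)[of j i] j u(1)[of j] by auto
      qed
      then have "u i \<in> L (g (r i))" unfolding L_def by (rule subsetD[OF pm.span_mono i])
      then show False using u(2) by blast
    qed
    have ind: "pm.independent (u ` {..<i}) \<and> card (u ` {..<i}) = i" for i
    proof (induction i)
      case 0
      show ?case by (simp add: pm.independent_empty)
    next
      case (Suc i)
      have "u i \<notin> u ` {..<i}" using new[of i] pm.span_base[of "u i"] by metis
      then show ?case using Suc pm.independent_insertI[OF new[of i]] by (simp add: lessThan_Suc)
    qed
    have "i \<le> card (\<Union>b. A b)" for i
    proof -
      have "keys z \<subseteq> (\<Union>b. A b)" if z: "z \<in> u ` {..<i}" for z
      proof -
        obtain j where "z = u j" using z by blast
        then show ?thesis using kA[OF u(1)[of j]] by simp
      qed
      then have "card (u ` {..<i}) \<le> card (\<Union>b. A b)"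
        using independent_finite[OF A ind[THEN conjunct1], of i] by simp
      then show ?thesis using ind[of i] by simp
    qed
    from this[of "Suc (card (\<Union>b. A b))"] show False by simp
  qed
  moreover have "finite (W b)" for b using W[of b] by (simp add: spans_def)
  ultimately have "finite (SIGMA b:{b. W b \<noteq> {}}. W b)" by (rule finite_SigmaI)
  then obtain n and e :: "nat \<Rightarrow> 'n expo \<times> ('x \<Rightarrow>\<^sub>0 'k)" where e: "bij_betw e {0..<n} (SIGMA b:{b. W b \<noteq> {}}. W b)"
    using ex_bij_betw_nat_finite by blast
  define B where "B x = fst (e (snd x))" for x :: "nat \<times> nat"
  define w where "w x = snd (e (snd x))" for x :: "nat \<times> nat"
  have wW: "w x \<in> W (B x)" if "x \<in> {m} \<times> {..<n}" for x
  proof -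
    have "e (snd x) \<in> (SIGMA b:{b. W b \<noteq> {}}. W b)" using that by (intro bij_betwE[OF e, rule_format]) auto
    then show ?thesis by (auto simp: B_def w_def)
  qed
  have wK: "w x \<in> K (B x)" if "x \<in> {m} \<times> {..<n}" for x
    using wW[OF that] W[of "B x"] by (auto simp: spans_def)
  have inj: "x = y" if "x \<in> {m} \<times> {..<n}" "y \<in> {m} \<times> {..<n}" "B x = B y" "w x = w y" for x y
  proof -
    have "e (snd x) = e (snd y)" using that by (simp add: B_def w_def prod_eq_iff)
    then have "snd x = snd y" using e that by (auto simp: bij_betw_def inj_on_def)
    then show ?thesis using that by auto
  qed
  define S where "S b = lin_ext w ` {u. keys u \<subseteq> {x\<in>{m} \<times> {..<n}. mle (B x) b}}" for b
  have S_sub: "pm.subspace (S b)" for b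
    unfolding pm.subspace_def
  proof (intro conjI ballI allI)
    show "0 \<in> S b" unfolding S_def by (rule image_eqI[of _ _ 0]) auto
  next
    fix p q assume "p \<in> S b" "q \<in> S b"
    then obtain u v where uv: "keys u \<subseteq> {x\<in>{m} \<times> {..<n}. mle (B x) b}" "p = lin_ext w u"
      "keys v \<subseteq> {x\<in>{m} \<times> {..<n}. mle (B x) b}" "q = lin_ext w v" unfolding S_def by blast
    have "keys (u + v) \<subseteq> {x\<in>{m} \<times> {..<n}. mle (B x) b}"
      by (rule order_trans[OF keys_add Un_least[OF uv(1,3)]])
    then show "p + q \<in> S b" unfolding S_def uv using lin_ext_add[of w u v] by (intro image_eqI[of _ _ "u + v"]) auto
  next
    fix a p assume "p \<in> S b"
    then obtain u where u: "keys u \<subseteq> {x\<in>{m} \<times> {..<n}. mle (B x) b}" "p = lin_ext w u" unfolding S_def by blast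
    then have "keys (scal a u) \<subseteq> {x\<in>{m} \<times> {..<n}. mle (B x) b}" using keys_scal by fast
    then show "scal a p \<in> S b" unfolding S_def u using lin_ext_scal[of w a u] by (intro image_eqI[of _ _ "scal a u"]) auto
  qed
  have SK: "S b \<subseteq> K b" for b
  proof
    fix p assume "p \<in> S b"
    then obtain u where u: "keys u \<subseteq> {x\<in>{m} \<times> {..<n}. mle (B x) b}" "p = lin_ext w u" unfolding S_def by blast
    show "p \<in> K b" unfolding u(2) using u(1) wK mono by (intro lin_ext_in_subspace[OF sub]) blast
  qed
  have KS: "K b \<subseteq> S b" for b
  proof (induction "total_degree b" arbitrary: b rule: less_induct)
    case less
    have S_mono: "S b' \<subseteq> S b" if "mle b' b" for b'
      unfolding S_def using that mle_trans by (intro image_mono) blast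
    have "L b \<subseteq> S b" unfolding L_def
    proof (rule pm.span_minimal[OF _ S_sub], rule UN_least)
      fix b' assume "b' \<in> {b'. mle b' b \<and> b' \<noteq> b}"
      then have b': "mle b' b" "b' \<noteq> b" by auto
      then have "K b' \<subseteq> S b'" by (intro less total_degree_strict)
      then show "K b' \<subseteq> S b" using S_mono[OF b'(1)] by (rule order_trans)
    qed
    moreover have "W b \<subseteq> S b"
    proof
      fix v assume "v \<in> W b"
      then have "(b, v) \<in> (SIGMA b:{b. W b \<noteq> {}}. W b)" by auto
      then have "(b, v) \<in> e ` {0..<n}" using e by (simp add: bij_betw_def)
      then obtain j where j: "j < n" "e j = (b, v)" by auto
      then have "lin_ext w (single (m, j) 1) = v" "keys (single (m, j) (1::'k)) \<subseteq> {x\<in>{m} \<times> {..<n}. mle (B x) b}"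
        by (auto simp: B_def w_def)
      then show "v \<in> S b" unfolding S_def by (intro image_eqI[of _ _ "single (m, j) 1"]) auto
    qed
    ultimately have "pm.span (L b \<union> W b) \<subseteq> S b" by (intro pm.span_minimal[OF _ S_sub]) auto
    then show ?case using W[of b] unfolding spans_def by blast
  qed
  have strict: "B x \<noteq> b"
    if u: "keys u \<subseteq> {x\<in>{m} \<times> {..<n}. mle (B x) b}" "lin_ext w u = 0" and x: "x \<in> keys u" for b u x
  proof
    assume b: "B x = b"
    let ?T = "pm.span (L b \<union> (W b - {w x}))"
    have "w y \<in> ?T" if "y \<in> keys u - {x}" for y
    proof (rule pm.span_base)
      have y: "y \<in> {m} \<times> {..<n}" "mle (B y) b" "y \<noteq> x" using u(1) that by auto
      show "w y \<in> L b \<union> (W b - {w x})"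
      proof (cases "B y = b")
        case True
        then have "w y \<noteq> w x" using inj[OF y(1), of x] u(1) x b y(3) by auto
        then show ?thesis using wW[OF y(1)] True by simp
      next
        case False
        then have "w y \<in> L b" unfolding L_def using wK[OF y(1)] y(2) by (intro pm.span_base) blast
        then show ?thesis by simp
      qed
    qed
    then have "(\<Sum>y\<in>keys u - {x}. scal (lookup u y) (w y)) \<in> ?T"
      by (intro pm.span_sum pm.span_scale) auto
    moreover have "scal (lookup u x) (w x) + (\<Sum>y\<in>keys u - {x}. scal (lookup u y) (w y)) = 0"
      using u(2) x unfolding lin_ext_def by (simp add: sum.remove)
    then have "scal (lookup u x) (w x) = - (\<Sum>y\<in>keys u - {x}. scal (lookup u y) (w y))"
      by (simp add: eq_neg_iff_add_eq_0)
    ultimately have "scal (lookup u x) (w x) \<in> ?T" by (simp add: pm.span_neg)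
    then have "scal (1 / lookup u x) (scal (lookup u x) (w x)) \<in> ?T" by (rule pm.span_scale)
    then have "w x \<in> ?T" using x by (simp add: in_keys_iff)
    then show False using W_indep[of "w x" b] wW[of x] u(1) x b by auto
  qed
  have "K b = lin_ext w ` {u. keys u \<subseteq> {x\<in>{m} \<times> {..<n}. mle (B x) b}}" for b
    using SK[of b] KS[of b] unfolding S_def by (rule equalityI[rotated])
  then show ?thesis using wK strict
    by (intro exI[of _ n] exI[of _ B] exI[of _ w] conjI ballI allI impI) blast+
qed

text \<open>A free resolution is built by covering the kernel family of each step with minimal
  generators. The last conclusion is minimality from homological degree \<open>2\<close> on; in degree \<open>1\<close> the
  boundaries lie in the given family \<open>K0\<close>, so there it depends on \<open>K0\<close>.\<close>

theorem minimal_frame_exists: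
  fixes K0 :: "'n::finite expo \<Rightarrow> ((nat \<times> nat) \<Rightarrow>\<^sub>0 'k::field) set" and deg0 :: "nat \<times> nat \<Rightarrow> 'n expo"
  assumes K0: "monotone_family (\<lambda>b. {x\<in>{0} \<times> {..<n0}. mle (deg0 x) b}) K0"
  shows "\<exists>N (deg :: nat \<times> nat \<Rightarrow> 'n expo) (c :: nat \<times> nat \<Rightarrow> (nat \<times> nat) \<Rightarrow>\<^sub>0 'k).
    frame (SIGMA i:UNIV. {..<N i}) fst deg c \<and> N 0 = n0 \<and> (\<forall>x\<in>{0} \<times> {..<n0}. deg x = deg0 x) \<and>
    frame.exact (SIGMA i:UNIV. {..<N i}) fst deg c \<and>
    (\<forall>b. frame.boundaries (SIGMA i:UNIV. {..<N i}) fst deg c 0 b = K0 b) \<and>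
    (\<forall>i j. j < N (Suc (Suc i)) \<longrightarrow> (\<forall>y\<in>keys (c (Suc (Suc i), j)). deg y \<noteq> deg (Suc (Suc i), j)))"
proof -
  let ?A = "\<lambda>i n (B :: nat \<times> nat \<Rightarrow> 'n expo) b. {x\<in>{i} \<times> {..<n}. mle (B x) b}"
  \<comment> \<open>A state consists of the number of labels, their degrees, their boundaries, and the kernel to be covered next.\<close>
  define good where "good i s \<longleftrightarrow> (case s of (n, B, w, K) \<Rightarrow> monotone_family (?A i n B) K \<and>
    (i = 0 \<longrightarrow> n = n0 \<and> B = deg0 \<and> K = K0))"
    for i and s :: "nat \<times> (nat \<times> nat \<Rightarrow> 'n expo) \<times> (nat \<times> nat \<Rightarrow> (nat \<times> nat) \<Rightarrow>\<^sub>0 'k) \<times>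
      ('n expo \<Rightarrow> ((nat \<times> nat) \<Rightarrow>\<^sub>0 'k) set)"
  define next_stage where "next_stage i s s' \<longleftrightarrow> (case s of (n, B, w, K) \<Rightarrow> case s' of (n', B', w', K') \<Rightarrow>
    (\<forall>x\<in>{Suc i} \<times> {..<n'}. w' x \<in> K (B' x)) \<and>
    (\<forall>b. K b = lin_ext w' ` {u. keys u \<subseteq> ?A (Suc i) n' B' b}) \<and>
    (\<forall>b. K' b = {u. keys u \<subseteq> ?A (Suc i) n' B' b \<and> lin_ext w' u = 0}) \<and>
    (\<forall>b. \<forall>u\<in>K' b. \<forall>x\<in>keys u. B' x \<noteq> b))"
    for i and s s' :: "nat \<times> (nat \<times> nat \<Rightarrow> 'n expo) \<times> (nat \<times> nat \<Rightarrow> (nat \<times> nat) \<Rightarrow>\<^sub>0 'k) \<times>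
      ('n expo \<Rightarrow> ((nat \<times> nat) \<Rightarrow>\<^sub>0 'k) set)"
  have "\<exists>s. \<forall>i. good i (s i) \<and> next_stage i (s i) (s (Suc i))"
  proof (rule dependent_nat_choice)
    show "\<exists>s. good 0 s" by (rule exI[of _ "(n0, deg0, \<lambda>_. 0, K0)"]) (simp add: good_def K0)
  next
    fix s i assume s: "good i s"
    obtain n B w K where s_eq: "s = (n, B, w, K)" by (metis prod_cases4)
    have K: "monotone_family (?A i n B) K" using s by (simp add: good_def s_eq)
    have "finite (\<Union>b. ?A i n B b)" by (rule finite_subset[of _ "{i} \<times> {..<n}"]) auto
    from monotone_family_generators[OF K this, of "Suc i"]
    obtain n' and B' :: "nat \<times> nat \<Rightarrow> 'n expo" and w' where g: "\<forall>x\<in>{Suc i} \<times> {..<n'}. w' x \<in> K (B' x)"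
      "\<forall>b. K b = lin_ext w' ` {u. keys u \<subseteq> ?A (Suc i) n' B' b}"
      "\<forall>b u. keys u \<subseteq> ?A (Suc i) n' B' b \<longrightarrow> lin_ext w' u = 0 \<longrightarrow> (\<forall>x\<in>keys u. B' x \<noteq> b)"
      by (elim exE conjE)
    define K' where "K' b = {u. keys u \<subseteq> ?A (Suc i) n' B' b \<and> lin_ext w' u = 0}" for b
    have add: "keys (u + v) \<subseteq> Z" if "keys u \<subseteq> Z" "keys v \<subseteq> Z" for u v :: "(nat \<times> nat) \<Rightarrow>\<^sub>0 'k" and Z
      by (rule order_trans[OF keys_add Un_least[OF that]])
    have sc: "keys (scal a u) \<subseteq> Z" if "keys u \<subseteq> Z" for a and u :: "(nat \<times> nat) \<Rightarrow>\<^sub>0 'k" and Z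
      by (rule order_trans[OF keys_scal that])
    have "pm.subspace (K' b)" for b
      unfolding pm.subspace_def K'_def
      using add sc by (simp add: lin_ext_add lin_ext_scal)
    moreover have "K' b \<subseteq> K' b'" if "mle b b'" for b b'
      unfolding K'_def using mle_trans[OF _ that] by blast
    ultimately have "monotone_family (?A (Suc i) n' B') K'"
      unfolding monotone_family_def K'_def by blast
    then have "good (Suc i) (n', B', w', K')" by (simp add: good_def)
    moreover have "next_stage i s (n', B', w', K')"
      unfolding next_stage_def s_eq prod.case K'_def by (intro conjI g(1,2)) (use g(3) in blast)+
    ultimately show "\<exists>s'. good (Suc i) s' \<and> next_stage i s s'" by blast
  qed
  then obtain s where s: "\<And>i. good i (s i)" "\<And>i. next_stage i (s i) (s (Suc i))" by blast
  define N where "N i = fst (s i)" for i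
  define deg where "deg x = fst (snd (s (fst x))) x" for x
  define c where "c x = (if fst x = 0 then 0 else fst (snd (snd (s (fst x)))) x)" for x
  define K where "K i = snd (snd (snd (s i)))" for i
  let ?X = "SIGMA i:UNIV. {..<N i}"
  have A: "?A i (N i) (fst (snd (s i))) b = {x \<in> ?X. fst x = i \<and> mle (deg x) b}" for i b
    by (auto simp: deg_def)
  have fam: "monotone_family (\<lambda>b. {x \<in> ?X. fst x = i \<and> mle (deg x) b}) (K i)" for i
  proof -
    have "monotone_family (\<lambda>b. ?A i (N i) (fst (snd (s i))) b) (K i)"
      using s(1)[of i] by (simp add: good_def N_def K_def case_prod_unfold)
    then show ?thesis unfolding A .
  qed
  have nxt: "\<forall>x\<in>{Suc i} \<times> {..<N (Suc i)}. c x \<in> K i (deg x)"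
    "\<And>b. K i b = lin_ext c ` {u. keys u \<subseteq> {x \<in> ?X. fst x = Suc i \<and> mle (deg x) b}}"
    "\<And>b. K (Suc i) b = {u. keys u \<subseteq> {x \<in> ?X. fst x = Suc i \<and> mle (deg x) b} \<and> lin_ext c u = 0}"
    "\<And>b u x. u \<in> K (Suc i) b \<Longrightarrow> x \<in> keys u \<Longrightarrow> deg x \<noteq> b" for i
  proof -
    let ?w = "fst (snd (snd (s (Suc i))))"
    have w: "lin_ext ?w u = lin_ext c u" if "keys u \<subseteq> {x \<in> ?X. fst x = Suc i \<and> mle (deg x) b}" for u b
      using that by (rule lin_ext_eqI) (simp add: c_def)
    note st0 = s(2)[of i, unfolded next_stage_def case_prod_unfold, folded N_def K_def, unfolded A]
    note st = st0[THEN conjunct1] st0[THEN conjunct2, THEN conjunct1]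
      st0[THEN conjunct2, THEN conjunct2, THEN conjunct1] st0[THEN conjunct2, THEN conjunct2, THEN conjunct2]
    show "\<forall>x\<in>{Suc i} \<times> {..<N (Suc i)}. c x \<in> K i (deg x)" using st(1) by (auto simp: c_def deg_def)
    show K1: "K i b = lin_ext c ` {u. keys u \<subseteq> {x \<in> ?X. fst x = Suc i \<and> mle (deg x) b}}" for b
      unfolding st(2)[rule_format] using w by (intro image_cong) auto
    show K2: "K (Suc i) b = {u. keys u \<subseteq> {x \<in> ?X. fst x = Suc i \<and> mle (deg x) b} \<and> lin_ext c u = 0}" for b
      unfolding st(3)[rule_format] using w by (intro Collect_cong) auto
    show "deg x \<noteq> b" if "u \<in> K (Suc i) b" "x \<in> keys u" for b u x
    proof -
      have "fst x = Suc i" using K2[of b] that by blast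
      moreover have "fst (snd (s (Suc i))) x \<noteq> b" using st(4) that by blast
      ultimately show ?thesis by (simp add: deg_def)
    qed
  qed
  interpret frame ?X fst deg c
  proof
    fix x y assume x: "x \<in> ?X" and y: "y \<in> keys (c x)"
    then obtain i where i: "fst x = Suc i" by (cases "fst x") (auto simp: c_def)
    then have "c x \<in> K i (deg x)" using nxt(1)[of i] x by auto
    then have "y \<in> {y \<in> ?X. fst y = i \<and> mle (deg y) (deg x)}"
      using fam[of i] y unfolding monotone_family_def by blast
    then show "y \<in> ?X \<and> Suc (fst y) = fst x \<and> mle (deg y) (deg x)" using i by auto
  qed
  have b: "boundaries i b = K i b" for i b
    unfolding boundaries_def below_def nxt(2) by (rule refl)
  have ex: exact
    unfolding exact_def b nxt(3) below_def by blast
  have strict: "deg y \<noteq> deg (Suc (Suc i), j)" if "j < N (Suc (Suc i))" "y \<in> keys (c (Suc (Suc i), j))" for i j y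
    using nxt(1)[of "Suc i"] nxt(4)[of _ i] that by blast
  have 0: "N 0 = n0" "\<forall>x\<in>{0} \<times> {..<n0}. deg x = deg0 x" "K 0 = K0"
    using s(1)[of 0] by (auto simp: good_def N_def deg_def K_def case_prod_unfold)
  show ?thesis
    using ex b strict 0 frame_axioms by (intro exI[of _ N] exI[of _ deg] exI[of _ c]) simp
qed

section \<open>Multigraded modules\<close>

lemma homogenize_zero [simp]: "homogenize deg b 0 = 0"
  by (rule poly_mapping_eqI) simp

lemma homogenize_add: "homogenize deg b (u + v) = homogenize deg b u + homogenize deg b v"
  by (rule poly_mapping_eqI) (simp add: lookup_add single_add)

lemma homogenize_scal: "homogenize deg b (scal a u) = scal (single 0 a) (homogenize deg b u)"
  by (rule poly_mapping_eqI) (simp add: mult_single)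

lemma homogenize_single: "homogenize deg b (single x k) = single x (single (b - deg x) k)"
  by (rule poly_mapping_eqI) (auto simp: lookup_single when_def)

lemma mle_add_minus: "mle a b \<Longrightarrow> a + (b - a) = b"
  by (simp add: add.commute[of a])

lemma homogenize_shift:
  assumes "mle b b'" "\<And>x. x \<in> keys u \<Longrightarrow> mle (deg x) b"
  shows "homogenize deg b' u = scal (single (b' - b) 1) (homogenize deg b u)"
proof (rule poly_mapping_eqI)
  fix x
  show "lookup (homogenize deg b' u) x = lookup (scal (single (b' - b) 1) (homogenize deg b u)) x"
  proof (cases "x \<in> keys u")
    case True
    then have "mle (deg x) b" by (rule assms(2))
    then have "b' - deg x = (b' - b) + (b - deg x)"
      using assms(1) by (intro poly_mapping_eqI) (simp add: lookup_minus_nat lookup_add mle_def)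
    then show ?thesis by (simp add: mult_single)
  qed (simp add: in_keys_iff)
qed

lemma submodule_finsum:
  assumes M: "Module.module R M" and N: "submodule N R M" and f: "\<And>a. a \<in> A \<Longrightarrow> f a \<in> N"
  shows "finsum M f A \<in> N"
proof -
  interpret M: Module.module R M by fact
  note NE = M.submoduleE[OF N]
  show ?thesis using f
  proof (induction A rule: infinite_finite_induct)
    case (infinite A)
    have "\<zero>\<^bsub>M\<^esub> \<in> N" using subgroup.one_closed[OF submodule.axioms(1)[OF N]] by simp
    then show ?case using infinite by (simp add: M.finsum_infinite)
  next
    case empty
    show ?case using subgroup.one_closed[OF submodule.axioms(1)[OF N]] by simp
  next
    case (insert a A)
    then show ?case using NE(1,5) by (subst M.finsum_insert) (auto simp: Pi_def subset_iff)
  qed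
qed

locale mgmod =
  fixes M :: "(('n::finite, 'k::field) mpoly, 'm) module" and G :: "'n expo \<Rightarrow> 'm set"
  assumes mg: "multigraded M G"
begin

lemma mod: "Module.module poly_ring M"
  using mg by (simp add: multigraded_def)

sublocale M: Module.module poly_ring M by (rule mod)

lemma G_subgroup: "subgroup (G a) (add_monoid M)"
  using mg by (simp add: multigraded_def)

lemma G_carrier: "x \<in> G a \<Longrightarrow> x \<in> carrier M"
  using subgroup.subset[OF G_subgroup] by auto

lemma G_zero: "\<zero>\<^bsub>M\<^esub> \<in> G a"
  using subgroup.one_closed[OF G_subgroup] by simp

lemma G_add: "x \<in> G a \<Longrightarrow> y \<in> G a \<Longrightarrow> x \<oplus>\<^bsub>M\<^esub> y \<in> G a"
  using subgroup.m_closed[OF G_subgroup] by simp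

lemma G_smult: "x \<in> G b \<Longrightarrow> single a k \<odot>\<^bsub>M\<^esub> x \<in> G (a + b)"
  using mg by (simp add: multigraded_def)

definition decomposes :: "'m \<Rightarrow> ('n expo \<Rightarrow> 'm) \<Rightarrow> bool" where
  "decomposes x f \<longleftrightarrow> (\<forall>a. f a \<in> G a) \<and> finite {a. f a \<noteq> \<zero>\<^bsub>M\<^esub>} \<and>
    x = (\<Oplus>\<^bsub>M\<^esub>a\<in>{a. f a \<noteq> \<zero>\<^bsub>M\<^esub>}. f a)"

definition mcomp :: "'m \<Rightarrow> 'n expo \<Rightarrow> 'm" where
  "mcomp x = (THE f. decomposes x f)"

lemma ex1_decomposes: "x \<in> carrier M \<Longrightarrow> \<exists>!f. decomposes x f"
  using mg unfolding multigraded_def decomposes_def by blast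

lemma decomposes_mcomp: "x \<in> carrier M \<Longrightarrow> decomposes x (mcomp x)"
  unfolding mcomp_def by (rule theI'[OF ex1_decomposes])

lemma mcomp_G: "x \<in> carrier M \<Longrightarrow> mcomp x a \<in> G a"
  using decomposes_mcomp by (simp add: decomposes_def)

lemma mcomp_carrier: "x \<in> carrier M \<Longrightarrow> mcomp x a \<in> carrier M"
  using mcomp_G G_carrier by blast

lemma mcomp_finite: "x \<in> carrier M \<Longrightarrow> finite {a. mcomp x a \<noteq> \<zero>\<^bsub>M\<^esub>}"
  using decomposes_mcomp by (simp add: decomposes_def)

lemma mcomp_sum:
  assumes "x \<in> carrier M" "finite A" "{a. mcomp x a \<noteq> \<zero>\<^bsub>M\<^esub>} \<subseteq> A"
  shows "x = finsum M (mcomp x) A"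
proof -
  have "x = finsum M (mcomp x) {a. mcomp x a \<noteq> \<zero>\<^bsub>M\<^esub>}"
    using decomposes_mcomp[OF assms(1)] by (simp add: decomposes_def)
  also have "\<dots> = finsum M (mcomp x) A"
    using assms mcomp_carrier[OF assms(1)] by (intro M.add.finprod_mono_neutral_cong_left) auto
  finally show ?thesis .
qed

lemma mcompI:
  assumes "\<And>a. f a \<in> G a" "finite A" "\<And>a. a \<notin> A \<Longrightarrow> f a = \<zero>\<^bsub>M\<^esub>" "x = finsum M f A"
  shows "mcomp x = f"
proof -
  have fc: "\<And>a. f a \<in> carrier M" using assms(1) G_carrier by blast
  have s: "{a. f a \<noteq> \<zero>\<^bsub>M\<^esub>} \<subseteq> A" using assms(3) by blast
  have "finsum M f {a. f a \<noteq> \<zero>\<^bsub>M\<^esub>} = finsum M f A"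
    using assms(2) s fc by (intro M.add.finprod_mono_neutral_cong_left) auto
  then have d: "decomposes x f"
    using assms s finite_subset[OF s] by (simp add: decomposes_def)
  have "x \<in> carrier M" unfolding assms(4) using fc by (intro M.finsum_closed) auto
  then have "\<exists>!f. decomposes x f" "decomposes x (mcomp x)"
    by (rule ex1_decomposes, rule decomposes_mcomp)
  then show ?thesis using d by metis
qed

lemma mcomp_add:
  assumes "x \<in> carrier M" "y \<in> carrier M"
  shows "mcomp (x \<oplus>\<^bsub>M\<^esub> y) = (\<lambda>a. mcomp x a \<oplus>\<^bsub>M\<^esub> mcomp y a)"
proof (rule mcompI)
  let ?A = "{a. mcomp x a \<noteq> \<zero>\<^bsub>M\<^esub>} \<union> {a. mcomp y a \<noteq> \<zero>\<^bsub>M\<^esub>}"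
  show fin: "finite ?A" using mcomp_finite assms by simp
  have "finsum M (\<lambda>a. mcomp x a \<oplus>\<^bsub>M\<^esub> mcomp y a) ?A = finsum M (mcomp x) ?A \<oplus>\<^bsub>M\<^esub> finsum M (mcomp y) ?A"
    using mcomp_carrier assms by (intro M.finsum_addf) auto
  then show "x \<oplus>\<^bsub>M\<^esub> y = finsum M (\<lambda>a. mcomp x a \<oplus>\<^bsub>M\<^esub> mcomp y a) ?A"
    using mcomp_sum[OF assms(1) fin] mcomp_sum[OF assms(2) fin] by simp
qed (use mcomp_G G_add assms in auto)

lemma mcomp_homogeneous:
  assumes "x \<in> G b" shows "mcomp x = (\<lambda>a. if a = b then x else \<zero>\<^bsub>M\<^esub>)"
  by (rule mcompI[of _ "{b}"]) (use assms G_zero G_carrier[OF assms] in auto)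

lemma mcomp_zero: "mcomp \<zero>\<^bsub>M\<^esub> a = \<zero>\<^bsub>M\<^esub>"
  using mcomp_homogeneous[OF G_zero[of a]] by simp

lemma mcomp_eq_zero_iff:
  assumes "x \<in> carrier M" shows "x = \<zero>\<^bsub>M\<^esub> \<longleftrightarrow> (\<forall>a. mcomp x a = \<zero>\<^bsub>M\<^esub>)"
  using mcomp_sum[OF assms, of "{}"] mcomp_zero by auto

lemma mcomp_single_smult:
  assumes x: "x \<in> carrier M"
  shows "mcomp (single a k \<odot>\<^bsub>M\<^esub> x) b = (if mle a b then single a k \<odot>\<^bsub>M\<^esub> mcomp x (b - a) else \<zero>\<^bsub>M\<^esub>)"
proof -
  let ?f = "\<lambda>b. if mle a b then single a k \<odot>\<^bsub>M\<^esub> mcomp x (b - a) else \<zero>\<^bsub>M\<^esub>"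
  let ?S = "{a. mcomp x a \<noteq> \<zero>\<^bsub>M\<^esub>}"
  have "mcomp (single a k \<odot>\<^bsub>M\<^esub> x) = ?f"
  proof (rule mcompI)
    fix c
    show "?f c \<in> G c"
      using G_smult[OF mcomp_G[OF x], of a k "c - a"] G_zero by (cases "mle a c") (simp_all add: mle_add_minus)
    show "finite ((\<lambda>b. a + b) ` ?S)" using mcomp_finite[OF x] by simp
    show "?f c = \<zero>\<^bsub>M\<^esub>" if c: "c \<notin> (\<lambda>b. a + b) ` ?S"
    proof (cases "mle a c")
      case True
      then have "c = a + (c - a)" by (simp add: mle_add_minus)
      then have "mcomp x (c - a) = \<zero>\<^bsub>M\<^esub>" using c by blast
      then show ?thesis by simp
    qed simp
    have "single a k \<odot>\<^bsub>M\<^esub> x = single a k \<odot>\<^bsub>M\<^esub> finsum M (mcomp x) ?S"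
      using mcomp_sum[OF x mcomp_finite[OF x] order_refl] by simp
    also have "\<dots> = finsum M (\<lambda>c. single a k \<odot>\<^bsub>M\<^esub> mcomp x c) ?S"
      using mcomp_carrier[OF x] by (intro M.finsum_smult_ldistr mcomp_finite[OF x]) auto
    also have "\<dots> = finsum M (\<lambda>c. ?f (a + c)) ?S"
      using mcomp_carrier[OF x] by (intro M.finsum_cong') auto
    also have "\<dots> = finsum M ?f ((\<lambda>b. a + b) ` ?S)"
      using mcomp_carrier[OF x] by (intro M.finsum_reindex[symmetric]) (auto simp: inj_on_def)
    finally show "single a k \<odot>\<^bsub>M\<^esub> x = finsum M ?f ((\<lambda>b. a + b) ` ?S)" .
  qed
  then show ?thesis by simp
qed

subsection \<open>Independence of the components of the total grading\<close>

definition tproj :: "nat \<Rightarrow> 'm \<Rightarrow> 'm" where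
  "tproj e x = finsum M (mcomp x) {a. mcomp x a \<noteq> \<zero>\<^bsub>M\<^esub> \<and> total_degree a = e}"

lemma tproj_superset:
  assumes "x \<in> carrier M" "finite A" "{a. mcomp x a \<noteq> \<zero>\<^bsub>M\<^esub>} \<subseteq> A"
  shows "tproj e x = finsum M (mcomp x) {a \<in> A. total_degree a = e}"
  unfolding tproj_def using assms mcomp_carrier[OF assms(1)]
  by (intro M.add.finprod_mono_neutral_cong_left) auto

lemma tproj_add:
  assumes "x \<in> carrier M" "y \<in> carrier M"
  shows "tproj e (x \<oplus>\<^bsub>M\<^esub> y) = tproj e x \<oplus>\<^bsub>M\<^esub> tproj e y"
proof -
  let ?A = "{a. mcomp x a \<noteq> \<zero>\<^bsub>M\<^esub>} \<union> {a. mcomp y a \<noteq> \<zero>\<^bsub>M\<^esub>}"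
  have A: "finite ?A" using mcomp_finite assms by simp
  have s: "{a. mcomp (x \<oplus>\<^bsub>M\<^esub> y) a \<noteq> \<zero>\<^bsub>M\<^esub>} \<subseteq> ?A" by (auto simp: mcomp_add assms)
  have "tproj e (x \<oplus>\<^bsub>M\<^esub> y) = finsum M (\<lambda>a. mcomp x a \<oplus>\<^bsub>M\<^esub> mcomp y a) {a \<in> ?A. total_degree a = e}"
    using tproj_superset[OF _ A s, of e] assms by (simp add: mcomp_add)
  also have "\<dots> = finsum M (mcomp x) {a \<in> ?A. total_degree a = e} \<oplus>\<^bsub>M\<^esub> finsum M (mcomp y) {a \<in> ?A. total_degree a = e}"
    using mcomp_carrier assms by (intro M.finsum_addf) auto
  finally show ?thesis
    using tproj_superset[OF assms(1) A, of e] tproj_superset[OF assms(2) A, of e] by simp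
qed

lemma tproj_carrier: "x \<in> carrier M \<Longrightarrow> tproj e x \<in> carrier M"
  unfolding tproj_def using mcomp_carrier by (intro M.finsum_closed) auto

lemma tproj_homogeneous:
  assumes "x \<in> G a" shows "tproj e x = (if total_degree a = e then x else \<zero>\<^bsub>M\<^esub>)"
proof -
  have "tproj e x = finsum M (mcomp x) {b \<in> {a}. total_degree b = e}"
    using assms G_carrier[OF assms] by (intro tproj_superset) (auto simp: mcomp_homogeneous[OF assms])
  also have "{b \<in> {a}. total_degree b = e} = (if total_degree a = e then {a} else {})" by auto
  finally show ?thesis using G_carrier[OF assms] by (simp add: mcomp_homogeneous[OF assms])
qed

lemma total_grading_tproj:
  assumes N: "submodule N poly_ring M"
    and x: "x \<in> total_grading (M\<lparr>carrier := N\<rparr>) (induced_grading G N) e"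
  shows "x \<in> N \<and> (\<forall>e'. tproj e' x = (if e' = e then x else \<zero>\<^bsub>M\<^esub>))"
  using x unfolding total_grading_def
proof (induction rule: generate.induct)
  case one
  have "\<zero>\<^bsub>M\<^esub> \<in> N" using subgroup.one_closed[OF submodule.axioms(1)[OF N]] by simp
  then show ?case using tproj_homogeneous[OF G_zero] by auto
next
  case (incl h)
  then show ?case by (auto simp: induced_grading_def tproj_homogeneous)
next
  case (inv h)
  then obtain a where h: "h \<in> G a" "h \<in> N" "total_degree a = e" by (auto simp: induced_grading_def)
  have "inv\<^bsub>add_monoid (M\<lparr>carrier := N\<rparr>)\<^esub> h = \<ominus>\<^bsub>M\<^esub> h"
    using group.m_inv_consistent[OF M.add.is_group submodule.axioms(1)[OF N] h(2)]
    by (simp add: a_inv_def)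
  moreover have "\<ominus>\<^bsub>M\<^esub> h \<in> G a" using subgroup.m_inv_closed[OF G_subgroup h(1)] by (simp add: a_inv_def)
  moreover have "\<ominus>\<^bsub>M\<^esub> h \<in> N" using M.submoduleE(3)[OF N h(2)] .
  ultimately show ?case using tproj_homogeneous h(3) by auto
next
  case (eng h1 h2)
  have NM: "N \<subseteq> carrier M" by (rule M.submoduleE(1)[OF N])
  then have "h1 \<in> carrier M" "h2 \<in> carrier M" using eng by auto
  then show ?case using eng M.submoduleE(5)[OF N, of h1 h2] by (auto simp: tproj_add)
qed

text \<open>The projection to total degree \<open>e\<close> adds up the components of the multidegrees with that
  total degree.\<close>

lemma separated_total_grading:
  assumes N: "submodule N poly_ring M"
  shows "separated (M\<lparr>carrier := N\<rparr>) (total_grading (M\<lparr>carrier := N\<rparr>) (induced_grading G N))"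
  unfolding separated_def
proof (intro exI[of _ tproj] conjI allI ballI)
  fix e e' x assume "x \<in> total_grading (M\<lparr>carrier := N\<rparr>) (induced_grading G N) e"
  from total_grading_tproj[OF N this]
  show "tproj e' x = (if e' = e then x else \<zero>\<^bsub>M\<lparr>carrier := N\<rparr>\<^esub>)" by simp
next
  fix e x y assume "x \<in> carrier (M\<lparr>carrier := N\<rparr>)" "y \<in> carrier (M\<lparr>carrier := N\<rparr>)"
  then have "x \<in> carrier M" "y \<in> carrier M" using M.submoduleE(1)[OF N] by auto
  then show "tproj e (x \<oplus>\<^bsub>M\<lparr>carrier := N\<rparr>\<^esub> y) = tproj e x \<oplus>\<^bsub>M\<lparr>carrier := N\<rparr>\<^esub> tproj e y"
    by (simp add: tproj_add)
qed

subsection \<open>Maps from free modules with homogeneous values on the basis\<close>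

context
  fixes X0 :: "'x set" and deg :: "'x \<Rightarrow> 'n expo" and m :: "'x \<Rightarrow> 'm"
  assumes m: "\<And>x. x \<in> X0 \<Longrightarrow> m x \<in> G (deg x)"
begin

abbreviation eps where "eps \<equiv> lin_ext_to M m"

lemma m_carrier: "x \<in> X0 \<Longrightarrow> m x \<in> carrier M"
  using m G_carrier by blast

lemma eps_linear: "eps \<in> linear_maps poly_ring (free_module X0) M"
  by (rule lin_ext_to_linear[OF mod m_carrier])

lemma eps_carrier: "keys v \<subseteq> X0 \<Longrightarrow> eps v \<in> carrier M"
  using linear_mapsD(1)[OF eps_linear, of v] by simp

lemma eps_add: "keys u \<subseteq> X0 \<Longrightarrow> keys v \<subseteq> X0 \<Longrightarrow> eps (u + v) = eps u \<oplus>\<^bsub>M\<^esub> eps v"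
  using linear_mapsD(2)[OF eps_linear, of u v] by simp

lemma eps_scal: "keys v \<subseteq> X0 \<Longrightarrow> eps (scal a v) = a \<odot>\<^bsub>M\<^esub> eps v"
  using linear_mapsD(3)[OF eps_linear, of a v] by simp

lemma eps_zero: "eps 0 = \<zero>\<^bsub>M\<^esub>"
  using linear_maps_zero[OF eps_linear free_module_is_module mod] by simp

lemma eps_single: "x \<in> X0 \<Longrightarrow> eps (single x f) = f \<odot>\<^bsub>M\<^esub> m x"
  by (rule lin_ext_to_single[of M m x f, OF mod]) (rule m_carrier)

lemma keys_component_subset: "keys v \<subseteq> Z \<Longrightarrow> keys (component d b v) \<subseteq> Z"
  using keys_component[of d b v] by blast

text \<open>Homogeneous values on the basis make the map respect the multigrading.\<close>

lemma mcomp_eps: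
  assumes "keys v \<subseteq> X0" shows "mcomp (eps v) b = eps (homogenize deg b (component deg b v))"
  using assms
proof (induction rule: mpoly_vector_induct)
  case zero
  then show ?case by (simp add: eps_zero mcomp_zero)
next
  case (single x a k)
  have "eps (single x (single a k)) \<in> G (a + deg x)"
    using G_smult[OF m[OF single], of a k] by (simp add: eps_single[OF single])
  from mcomp_homogeneous[OF this] show ?case
    by (auto simp: component_single homogenize_single eps_zero)
next
  case (add u v)
  then show ?case
    using keys_component_subset[of u X0 deg b] keys_component_subset[of v X0 deg b]
    by (simp add: eps_add mcomp_add eps_carrier component_add homogenize_add)
qed

lemma eps_eq_0_iff:
  assumes "keys v \<subseteq> X0"
  shows "eps v = \<zero>\<^bsub>M\<^esub> \<longleftrightarrow> (\<forall>b. eps (homogenize deg b (component deg b v)) = \<zero>\<^bsub>M\<^esub>)"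
  using mcomp_eq_zero_iff[OF eps_carrier[OF assms]] by (simp add: mcomp_eps[OF assms])

lemma eps_in_submodule:
  assumes N: "submodule N poly_ring M" and mN: "\<And>x. x \<in> keys v \<Longrightarrow> m x \<in> N"
  shows "eps v \<in> N"
  unfolding lin_ext_to_def using mN M.submoduleE(4)[OF N]
  by (intro submodule_finsum[OF mod N]) simp

lemma eps_linear_submodule:
  assumes N: "submodule N poly_ring M" and mN: "\<And>x. x \<in> X0 \<Longrightarrow> m x \<in> N"
  shows "eps \<in> linear_maps poly_ring (free_module X0) (M\<lparr>carrier := N\<rparr>)"
  using eps_linear eps_in_submodule[OF N] mN by (fastforce simp: linear_maps_def)

lemma eps_graded:
  assumes N: "submodule N poly_ring M" and mN: "\<And>x. x \<in> X0 \<Longrightarrow> m x \<in> N"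
  shows "eps ` graded_part X0 (\<lambda>x. total_degree (deg x)) e
    \<subseteq> total_grading (M\<lparr>carrier := N\<rparr>) (induced_grading G N) e"
proof
  fix y assume "y \<in> eps ` graded_part X0 (\<lambda>x. total_degree (deg x)) e"
  then obtain v where v: "v \<in> graded_part X0 (\<lambda>x. total_degree (deg x)) e" "y = eps v" by blast
  then have k: "keys v \<subseteq> X0" by (simp add: graded_part_def)
  let ?S = "{a. mcomp y a \<noteq> \<zero>\<^bsub>M\<^esub>}"
  have yc: "y \<in> carrier M" using eps_carrier[OF k] v(2) by simp
  have "mcomp y a \<in> (\<Union>a\<in>{a. total_degree a = e}. induced_grading G N a)" if a: "a \<in> ?S" for a
  proof -
    have eq: "mcomp y a = eps (homogenize deg a (component deg a v))" unfolding v(2) by (rule mcomp_eps[OF k])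
    have "mcomp y a \<in> N" unfolding eq
      using mN keys_component_subset[OF k, of deg a] by (intro eps_in_submodule[OF N]) auto
    moreover have "component deg a v \<noteq> 0" using a eq eps_zero by auto
    then obtain x where "lookup (component deg a v) x \<noteq> 0"
      by (auto simp: poly_mapping_eq_iff fun_eq_iff)
    then have x: "mle (deg x) a" "a - deg x \<in> keys (lookup v x)" by (auto simp: in_keys_iff split: if_splits)
    then have "lookup v x \<noteq> 0" by auto
    then have "x \<in> X0" using k by (auto simp: in_keys_iff)
    then have "total_degree (a - deg x) + total_degree (deg x) = e" using v(1) x by (auto simp: graded_part_def)
    then have "total_degree a = e" using x(1) by (simp flip: total_degree_add)
    ultimately show ?thesis using mcomp_G[OF yc] by (auto simp: induced_grading_def)
  qed
  then have "finsum M (mcomp y) T \<in> total_grading (M\<lparr>carrier := N\<rparr>) (induced_grading G N) e" if "T \<subseteq> ?S" for T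
    using that unfolding total_grading_def
  proof (induction T rule: infinite_finite_induct)
    case (infinite T)
    then show ?case using generate.one[of "add_monoid (M\<lparr>carrier := N\<rparr>)"] by (simp add: M.finsum_infinite)
  next
    case empty
    then show ?case using generate.one[of "add_monoid (M\<lparr>carrier := N\<rparr>)"] by simp
  next
    case (insert a T)
    have eq: "finsum M (mcomp y) (insert a T) = mcomp y a \<oplus>\<^bsub>M\<^esub> finsum M (mcomp y) T"
      using insert(1,2) mcomp_carrier[OF yc] by (intro M.finsum_insert) auto
    show ?case unfolding eq
      using generate.eng[OF generate.incl[OF insert(4)] insert(3)[OF insert(4)], of a] insert(5) by simp
  qed
  from this[OF order_refl] show "y \<in> total_grading (M\<lparr>carrier := N\<rparr>) (induced_grading G N) e"
    using mcomp_sum[OF yc mcomp_finite[OF yc] order_refl] by simp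
qed

text \<open>The kernel of \<open>eps\<close> in the coordinates of \<open>component\<close>.\<close>

definition relations :: "'n expo \<Rightarrow> ('x \<Rightarrow>\<^sub>0 'k) set" where
  "relations b = {u. keys u \<subseteq> {x \<in> X0. mle (deg x) b} \<and> eps (homogenize deg b u) = \<zero>\<^bsub>M\<^esub>}"

lemma relations_family: "monotone_family (\<lambda>b. {x \<in> X0. mle (deg x) b}) relations"
  unfolding monotone_family_def
proof (intro conjI allI impI ballI)
  fix b
  have X0: "keys u \<subseteq> X0" if "keys u \<subseteq> {x \<in> X0. mle (deg x) b}" for u :: "'x \<Rightarrow>\<^sub>0 'k" using that by blast
  have add: "keys (u + v) \<subseteq> Z" if "keys u \<subseteq> Z" "keys v \<subseteq> Z" for u v :: "'x \<Rightarrow>\<^sub>0 'k" and Z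
    by (rule order_trans[OF keys_add Un_least[OF that]])
  have sc: "keys (scal a u) \<subseteq> Z" if "keys u \<subseteq> Z" for a and u :: "'x \<Rightarrow>\<^sub>0 'k" and Z
    by (rule order_trans[OF keys_scal that])
  show "pm.subspace (relations b)"
    unfolding pm.subspace_def relations_def
    using add sc X0 by (simp add: eps_zero homogenize_add homogenize_scal eps_add eps_scal)
next
  fix b b' :: "'n expo" assume bb: "mle b b'"
  show "relations b \<subseteq> relations b'"
  proof
    fix u assume u: "u \<in> relations b"
    then have k: "keys u \<subseteq> {x \<in> X0. mle (deg x) b}" and z: "eps (homogenize deg b u) = \<zero>\<^bsub>M\<^esub>"
      by (auto simp: relations_def)
    have "homogenize deg b' u = scal (single (b' - b) 1) (homogenize deg b u)"
      using k by (intro homogenize_shift[OF bb]) blast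
    moreover have "keys (homogenize deg b u) \<subseteq> X0" using k by auto
    ultimately have "eps (homogenize deg b' u) = \<zero>\<^bsub>M\<^esub>" using z by (simp add: eps_scal)
    moreover have "keys u \<subseteq> {x \<in> X0. mle (deg x) b'}" using k mle_trans[OF _ bb] by blast
    ultimately show "u \<in> relations b'" by (simp add: relations_def)
  qed
qed (auto simp: relations_def)

end

end

section \<open>Minimality and the irrelevant ideal\<close>

lemma poly_ring_is_ring: "ring (poly_ring :: ('n, 'k::field) mpoly ring)"
  using poly_ring_cring by (rule cring.axioms(1))

lemma poly_idealI:
  fixes J :: "('n, 'k::field) mpoly set"
  assumes "0 \<in> J" "\<And>f g. f \<in> J \<Longrightarrow> g \<in> J \<Longrightarrow> f + g \<in> J" "\<And>f g. f \<in> J \<Longrightarrow> g * f \<in> J"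
  shows "ideal J poly_ring"
proof (rule idealI[OF poly_ring_is_ring])
  have neg: "- f \<in> J" if "f \<in> J" for f using assms(3)[OF that, of "-1"] by simp
  show "subgroup J (add_monoid (poly_ring :: ('n, 'k) mpoly ring))"
  proof (rule group.subgroupI)
    show "group (add_monoid (poly_ring :: ('n, 'k) mpoly ring))"
      using abelian_group.a_group[OF ring.is_abelian_group[OF poly_ring_is_ring]] .
    fix f assume f: "f \<in> J"
    have "inv\<^bsub>add_monoid (poly_ring :: ('n, 'k) mpoly ring)\<^esub> f = - f"
      using abelian_group.minus_equality[OF ring.is_abelian_group[OF poly_ring_is_ring], of "- f" f]
      by (simp add: a_inv_def)
    then show "inv\<^bsub>add_monoid (poly_ring :: ('n, 'k) mpoly ring)\<^esub> f \<in> J" using neg[OF f] by simp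
  qed (use assms in auto)
qed (use assms(3) in \<open>auto simp: mult.commute\<close>)

lemma poly_idealD:
  assumes "ideal (J :: ('n, 'k::field) mpoly set) poly_ring"
  shows "0 \<in> J" "f \<in> J \<Longrightarrow> g \<in> J \<Longrightarrow> f + g \<in> J" "f \<in> J \<Longrightarrow> g * f \<in> J"
  using additive_subgroup.zero_closed[OF ideal.axioms(1)[OF assms]]
    additive_subgroup.a_closed[OF ideal.axioms(1)[OF assms], of f g]
    ideal.I_l_closed[OF assms, of f g] by simp_all

lemma poly_ideal_sum:
  assumes "ideal (J :: ('n, 'k::field) mpoly set) poly_ring" "\<And>a. a \<in> A \<Longrightarrow> f a \<in> J"
  shows "sum f A \<in> J"
  using assms(2) by (induction A rule: infinite_finite_induct) (auto intro: poly_idealD[OF assms(1)])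

lemma genideal_props:
  fixes S :: "('n, 'k::field) mpoly set"
  shows "ideal (genideal poly_ring S) poly_ring" "S \<subseteq> genideal poly_ring S"
    "ideal J poly_ring \<Longrightarrow> S \<subseteq> J \<Longrightarrow> genideal poly_ring S \<subseteq> J"
  using ring.genideal_ideal[OF poly_ring_is_ring, of S] ring.genideal_self[OF poly_ring_is_ring, of S]
    ring.genideal_minimal[OF poly_ring_is_ring, of J S] by auto

lemma irrelevant_ideal_iff:
  "f \<in> (irrelevant_ideal :: ('n, 'k::field) mpoly set) \<longleftrightarrow> lookup f 0 = 0"
proof
  have "ideal {f :: ('n, 'k) mpoly. lookup f 0 = 0} poly_ring"
    by (rule poly_idealI) (auto simp: lookup_add lookup_mult_zero)
  moreover have "range (\<lambda>i. monomial (single i 1)) \<subseteq> {f :: ('n, 'k) mpoly. lookup f 0 = 0}"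
  proof (rule image_subsetI)
    fix i :: 'n
    have "single i (1::nat) \<noteq> 0" by (simp flip: keys_eq_empty)
    then show "monomial (single i 1) \<in> {f :: ('n, 'k) mpoly. lookup f 0 = 0}"
      by (simp add: monomial_def lookup_single)
  qed
  ultimately have "irrelevant_ideal \<subseteq> {f :: ('n, 'k) mpoly. lookup f 0 = 0}"
    unfolding irrelevant_ideal_def by (rule genideal_props(3))
  then show "f \<in> irrelevant_ideal \<Longrightarrow> lookup f 0 = 0" by blast
next
  let ?J = "irrelevant_ideal :: ('n, 'k) mpoly set"
  have J: "ideal ?J poly_ring" unfolding irrelevant_ideal_def by (rule genideal_props(1))
  assume 0: "lookup f 0 = 0"
  have "single a (lookup f a) \<in> ?J" if "a \<in> keys f" for a
  proof -
    have "a \<noteq> 0" using that 0 by (auto simp: in_keys_iff)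
    then obtain i where i: "lookup a i \<noteq> 0" by (auto simp: poly_mapping_eq_iff fun_eq_iff)
    then have "mle (single i 1) a" by (auto simp: mle_def lookup_single when_def)
    then have "single a (lookup f a) = single (a - single i 1) (lookup f a) * monomial (single i 1)"
      by (simp add: monomial_def mult_single)
    moreover have "monomial (single i 1) \<in> ?J"
      unfolding irrelevant_ideal_def by (rule subsetD[OF genideal_props(2) rangeI])
    ultimately show ?thesis using poly_idealD(3)[OF J] by simp
  qed
  then have "(\<Sum>a\<in>keys f. single a (lookup f a)) \<in> ?J" by (rule poly_ideal_sum[OF J])
  then show "f \<in> ?J" using poly_mapping_sum_singles[of "keys f" f] by simp
qed

lemma submodule_free_sum:
  assumes N: "submodule N (poly_ring :: ('n, 'k::field) mpoly ring) (free_module Y)" and f: "\<And>a. a \<in> A \<Longrightarrow> f a \<in> N"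
  shows "sum f A \<in> N"
proof -
  have 0: "0 \<in> N" using subgroup.one_closed[OF submodule.axioms(1)[OF N]] by simp
  have add: "u + v \<in> N" if "u \<in> N" "v \<in> N" for u v
    using Module.module.submoduleE(5)[OF free_module_is_module N that] by simp
  show ?thesis using f by (induction A rule: infinite_finite_induct) (auto intro: 0 add)
qed

lemma irrelevant_smult_iff:
  "v \<in> ideal_smult poly_ring irrelevant_ideal (free_module Y) \<longleftrightarrow>
    keys v \<subseteq> Y \<and> (\<forall>y. lookup (lookup (v :: 'y \<Rightarrow>\<^sub>0 ('n, 'k::field) mpoly) y) 0 = 0)" (is "_ \<longleftrightarrow> ?P v")
proof
  let ?S = "{f \<odot>\<^bsub>free_module Y\<^esub> x | f x. f \<in> irrelevant_ideal \<and> x \<in> carrier (free_module Y)}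
    :: ('y \<Rightarrow>\<^sub>0 ('n, 'k) mpoly) set"
  interpret Fr: Module.module poly_ring "free_module Y :: (('n, 'k) mpoly, 'y \<Rightarrow>\<^sub>0 ('n, 'k) mpoly) module"
    by (rule free_module_is_module)
  {
    have add: "?P (a + b)" if "?P a" "?P b" for a b
      using that order_trans[OF keys_add[of a b] Un_least] by (simp add: lookup_add)
    have sc: "?P (scal f a)" if "?P a" for f a
      using that order_trans[OF keys_scal[of f a]] by (simp add: lookup_mult_zero)
    have "submodule {v. ?P v} poly_ring (free_module Y)"
    proof (rule Fr.submoduleI)
      fix a assume a: "a \<in> {v. ?P v}"
      have "\<ominus>\<^bsub>free_module Y\<^esub> a = - a"
        using Fr.minus_equality[of "- a" a] a by simp
      then show "\<ominus>\<^bsub>free_module Y\<^esub> a \<in> {v. ?P v}" using a by simp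
    qed (use add sc in auto)
    moreover have "?S \<subseteq> {v. ?P v}"
      using order_trans[OF keys_scal] by (auto simp: irrelevant_ideal_iff lookup_mult_zero dest: subsetD[OF keys_scal])
    ultimately have "ideal_smult poly_ring irrelevant_ideal (free_module Y) \<subseteq> {v. ?P v}"
      unfolding ideal_smult_def module_span_def by blast
    then show "v \<in> ideal_smult poly_ring irrelevant_ideal (free_module Y) \<Longrightarrow> ?P v" by blast
  }
  assume v: "?P v"
  show "v \<in> ideal_smult poly_ring irrelevant_ideal (free_module Y)"
    unfolding ideal_smult_def module_span_def
  proof (rule InterI, elim CollectE conjE)
    fix N assume N: "submodule N poly_ring (free_module Y)" and S: "?S \<subseteq> N"
    have "single y (lookup v y) \<in> N" if y: "y \<in> keys v" for y
    proof -
      have "scal (lookup v y) (single y 1) \<in> ?S"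
        using v y irrelevant_ideal_iff[of "lookup v y"] by (auto intro!: exI[of _ "lookup v y"] exI[of _ "single y 1"])
      then have "scal (lookup v y) (single y 1) \<in> N" using S by blast
      then show ?thesis by simp
    qed
    then have "(\<Sum>y\<in>keys v. single y (lookup v y)) \<in> N" by (rule submodule_free_sum[OF N])
    then show "v \<in> N" using poly_mapping_sum_singles[of "keys v" v] by simp
  qed
qed

lemma shifted_component_graded_part:
  "shifted_component bs e = graded_part {..<length bs} ((!) bs) e"
  by (auto simp: shifted_component_def graded_part_def)

lemma minimal_graded_free_resolution_iff:
  fixes L :: "(('n::finite, 'k::field) mpoly, 'a) module"
  shows "minimal_graded_free_resolution L H \<beta> d \<epsilon> \<longleftrightarrow>
    resolution poly_ring (\<lambda>i. free_module {..<length (\<beta> i)}) d \<epsilon> L \<and>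
    (\<forall>e. \<epsilon> ` graded_part {..<length (\<beta> 0)} ((!) (\<beta> 0)) e \<subseteq> H e) \<and>
    (\<forall>i e. d i ` graded_part {..<length (\<beta> (Suc i))} ((!) (\<beta> (Suc i))) e
      \<subseteq> graded_part {..<length (\<beta> i)} ((!) (\<beta> i)) e) \<and>
    minimal_differentials (\<lambda>i. {..<length (\<beta> i)}) d" (is "?l \<longleftrightarrow> ?R \<and> ?E \<and> ?D \<and> ?M")
proof -
  have eq: "(\<forall>i. d i ` carrier (free_module {..<length (\<beta> (Suc i))})
        \<subseteq> ideal_smult poly_ring irrelevant_ideal (free_module {..<length (\<beta> i)})) \<longleftrightarrow> ?M"
    (is "?I \<longleftrightarrow> _") if R: ?R
  proof
    assume a: ?I
    show ?M unfolding minimal_differentials_def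
    proof (intro allI impI)
      fix i y and v :: "nat \<Rightarrow>\<^sub>0 ('n, 'k) mpoly" assume "keys v \<subseteq> {..<length (\<beta> (Suc i))}"
      then have "d i v \<in> ideal_smult poly_ring irrelevant_ideal (free_module {..<length (\<beta> i)})"
        by (intro subsetD[OF a[rule_format]] imageI) simp
      then show "lookup (lookup (d i v) y) 0 = 0" unfolding irrelevant_smult_iff by simp
    qed
  next
    assume m: ?M
    show ?I
    proof (intro allI image_subsetI)
      fix i and v assume "v \<in> carrier (free_module {..<length (\<beta> (Suc i))} :: (('n, 'k) mpoly, nat \<Rightarrow>\<^sub>0 ('n, 'k) mpoly) module)"
      moreover from this have "d i v \<in> carrier (free_module {..<length (\<beta> i)})"
        by (rule linear_mapsD(1)[OF resolutionD(3)[OF R]])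
      ultimately show "d i v \<in> ideal_smult poly_ring irrelevant_ideal (free_module {..<length (\<beta> i)})"
        using m unfolding irrelevant_smult_iff minimal_differentials_def by simp
    qed
  qed
  show ?thesis
    unfolding minimal_graded_free_resolution_def shifted_component_graded_part
    by (intro conj_cong refl eq; assumption)
qed

text \<open>The labels of a minimal frame in homological degree \<open>i\<close> are listed by \<open>lab i\<close>;
  \<open>resolution_relabel\<close> transports the resolution to the positions in the lists.\<close>

theorem frame_list_resolution:
  fixes L :: "(('n::finite, 'k::field) mpoly, 'a) module" and deg :: "'x \<Rightarrow> 'n expo" and lab :: "nat \<Rightarrow> nat \<Rightarrow> 'x"
  assumes fr: "frame X hdg deg c" and min: "frame.minimal X deg c"
    and level: "\<And>i. frame.level X hdg i = lab i ` {..<N i}" and inj: "\<And>i. inj (lab i)"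
    and res: "resolution poly_ring (\<lambda>i. free_module (frame.level X hdg i)) (\<lambda>_. frame.diff deg c) \<epsilon> L"
    and gr: "\<And>e. \<epsilon> ` graded_part (frame.level X hdg 0) (\<lambda>x. total_degree (deg x)) e \<subseteq> H e"
  shows "\<exists>\<beta> d' \<epsilon>'. minimal_graded_free_resolution L H \<beta> d' \<epsilon>'"
proof -
  interpret frame X hdg deg c by (rule fr)
  define \<beta> where "\<beta> i = map (\<lambda>j. total_degree (deg (lab i j))) [0..<N i]" for i
  let ?tdeg = "\<lambda>x. total_degree (deg x)"
  have vi: "lab i -` level i = {..<length (\<beta> i)}" for i
    using inj[of i] by (auto simp: level \<beta>_def inj_def)
  have "resolution poly_ring (\<lambda>i. free_module (lab i -` level i))
    (\<lambda>i v. pull_labels (lab i) (diff (push_labels (lab (Suc i)) v))) (\<lambda>v. \<epsilon> (push_labels (lab 0) v)) L"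
    by (rule resolution_relabel[OF res inj]) (auto simp: level)
  note R = this[unfolded vi]
  have push: "push_labels (lab i) v \<in> graded_part (level i) ?tdeg e"
    if v: "v \<in> graded_part {..<length (\<beta> i)} ((!) (\<beta> i)) e" for i v e
  proof -
    have k: "keys v \<subseteq> {..<N i}" using v by (simp add: graded_part_def \<beta>_def)
    have "total_degree a + ?tdeg y = e"
      if y: "y \<in> level i" and a: "a \<in> keys (lookup (push_labels (lab i) v) y)" for y a
    proof -
      obtain j where j: "y = lab i j" "j < N i" using y by (auto simp: level)
      then have "a \<in> keys (lookup v j)" using a by (simp add: lookup_push_labels[OF inj])
      then show ?thesis using v j by (auto simp: graded_part_def \<beta>_def)
    qed
    moreover have "keys (push_labels (lab i) v) \<subseteq> level i"
      using keys_push_labels[of "lab i" v] k by (auto simp: level)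
    ultimately show ?thesis by (simp add: graded_part_def)
  qed
  have pull: "pull_labels (lab i) v \<in> graded_part {..<length (\<beta> i)} ((!) (\<beta> i)) e"
    if v: "v \<in> graded_part (level i) ?tdeg e" for i v e
  proof -
    have k: "keys v \<subseteq> level i" using v by (simp add: graded_part_def)
    have "keys (pull_labels (lab i) v) \<subseteq> {..<length (\<beta> i)}"
      using k unfolding vi[symmetric] by (auto simp: in_keys_iff lookup_pull_labels[OF inj] subset_iff)
    moreover have "total_degree a + \<beta> i ! j = e"
      if "j < length (\<beta> i)" "a \<in> keys (lookup (pull_labels (lab i) v) j)" for j a
      using v that by (auto simp: graded_part_def lookup_pull_labels[OF inj] \<beta>_def level)
    ultimately show ?thesis by (simp add: graded_part_def)
  qed
  have "minimal_graded_free_resolution L H \<beta>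
    (\<lambda>i v. pull_labels (lab i) (diff (push_labels (lab (Suc i)) v))) (\<lambda>v. \<epsilon> (push_labels (lab 0) v))"
    unfolding minimal_graded_free_resolution_iff
  proof (intro conjI allI R)
    fix e
    show "(\<lambda>v. \<epsilon> (push_labels (lab 0) v)) ` graded_part {..<length (\<beta> 0)} ((!) (\<beta> 0)) e \<subseteq> H e"
      using push by (intro image_subsetI subsetD[OF gr] imageI)
    fix i
    show "(\<lambda>v. pull_labels (lab i) (diff (push_labels (lab (Suc i)) v))) `
        graded_part {..<length (\<beta> (Suc i))} ((!) (\<beta> (Suc i))) e \<subseteq> graded_part {..<length (\<beta> i)} ((!) (\<beta> i)) e"
      by (intro image_subsetI pull) (rule subsetD[OF diff_graded imageI[OF push]])
  next
    show "minimal_differentials (\<lambda>i. {..<length (\<beta> i)})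
        (\<lambda>i v. pull_labels (lab i) (diff (push_labels (lab (Suc i)) v)))"
      unfolding minimal_differentials_def
    proof (intro allI impI)
      fix i y and v :: "nat \<Rightarrow>\<^sub>0 ('n, 'k) mpoly" assume "keys v \<subseteq> {..<length (\<beta> (Suc i))}"
      then have "keys (push_labels (lab (Suc i)) v) \<subseteq> level (Suc i)"
        unfolding level by (intro order_trans[OF keys_push_labels image_mono]) (simp add: \<beta>_def)
      then show "lookup (lookup (pull_labels (lab i) (diff (push_labels (lab (Suc i)) v))) y) 0 = 0"
        using minimal_diff[OF min] by (simp add: minimal_differentials_def lookup_pull_labels[OF inj])
    qed
  qed
  then show ?thesis by blast
qed

section \<open>The shifts of the minimal resolution\<close>

lemma resolution_shifts_minimal:
  assumes "\<exists>\<beta> d \<epsilon>. minimal_graded_free_resolution L H \<beta> d \<epsilon>"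
  shows "\<exists>d \<epsilon>. minimal_graded_free_resolution L H (resolution_shifts L H) d \<epsilon>"
  unfolding resolution_shifts_def using assms by (rule someI_ex)

text \<open>Both parts are instances of \<open>minimal_resolution_shifts\<close>: in the first the resolution \<open>Y\<close> is
  compared with the one that defines the shifts, in the second, where both are minimal, the roles
  are exchanged.\<close>

theorem shifts_of_minimal_resolution:
  fixes L :: "(('n::finite, 'k::field) mpoly, 'a) module"
  assumes ex: "\<exists>\<beta> d \<epsilon>. minimal_graded_free_resolution L H \<beta> d \<epsilon>"
    and L: "Module.module poly_ring L" and sep: "separated L H"
    and Q: "resolution poly_ring (\<lambda>i. free_module (Y i)) d \<epsilon> L"
    and Q_gr: "\<And>e. \<epsilon> ` graded_part (Y 0) (g 0) e \<subseteq> H e"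
      "\<And>i e. d i ` graded_part (Y (Suc i)) (g (Suc i)) e \<subseteq> graded_part (Y i) (g i) e"
  shows "b \<in> set (resolution_shifts L H i) \<Longrightarrow> \<exists>y\<in>Y i. g i y = b"
    and "minimal_differentials Y d \<Longrightarrow> y \<in> Y i \<Longrightarrow> g i y \<in> set (resolution_shifts L H i)"
proof -
  let ?\<beta> = "resolution_shifts L H"
  obtain d' \<epsilon>' where "minimal_graded_free_resolution L H ?\<beta> d' \<epsilon>'"
    using resolution_shifts_minimal[OF ex] by blast
  then have R: "resolution poly_ring (\<lambda>i. free_module {..<length (?\<beta> i)}) d' \<epsilon>' L"
    and E: "\<And>e. \<epsilon>' ` graded_part {..<length (?\<beta> 0)} ((!) (?\<beta> 0)) e \<subseteq> H e"
    and D: "\<And>i e. d' i ` graded_part {..<length (?\<beta> (Suc i))} ((!) (?\<beta> (Suc i))) e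
      \<subseteq> graded_part {..<length (?\<beta> i)} ((!) (?\<beta> i)) e"
    and m: "minimal_differentials (\<lambda>i. {..<length (?\<beta> i)}) d'"
    unfolding minimal_graded_free_resolution_iff by simp_all
  {
    assume "b \<in> set (?\<beta> i)"
    then obtain j where j: "j < length (?\<beta> i)" "?\<beta> i ! j = b" by (auto simp: in_set_conv_nth)
    show "\<exists>y\<in>Y i. g i y = b"
      using minimal_resolution_shifts[OF L sep R m, where g = "\<lambda>i. (!) (?\<beta> i)" and g' = g and Y = Y, OF E D Q Q_gr, of j i] j by simp
  next
    assume "minimal_differentials Y d" "y \<in> Y i"
    then obtain j where "j \<in> {..<length (?\<beta> i)}" "?\<beta> i ! j = g i y"
      using minimal_resolution_shifts[OF L sep Q, where g' = "\<lambda>i. (!) (?\<beta> i)" and g = g and Y = "\<lambda>i. {..<length (?\<beta> i)}", OF _ Q_gr R E D, of y i] by blast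
    then show "g i y \<in> set (?\<beta> i)" by (metis lessThan_iff nth_mem)
  }
qed

section \<open>Homogeneous generators\<close>

context mgmod
begin

lemma carrier_decompose_in_submodule:
  assumes N: "submodule N poly_ring M" and x: "x \<in> carrier M" "\<And>a. mcomp x a \<noteq> \<zero>\<^bsub>M\<^esub> \<Longrightarrow> mcomp x a \<in> N"
  shows "x \<in> N"
proof -
  have "finsum M (mcomp x) {a. mcomp x a \<noteq> \<zero>\<^bsub>M\<^esub>} \<in> N"
    using x(2) by (intro submodule_finsum[OF mod N]) simp
  then show ?thesis using mcomp_sum[OF x(1) mcomp_finite[OF x(1)] order_refl] by simp
qed

text \<open>The homogeneous components of finitely many generators generate, and among the finite
  homogeneous generating sets one of least cardinality is irredundant.\<close>

lemma homogeneous_generators: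
  assumes hom: "\<forall>x\<in>N. \<forall>a. mcomp x a \<in> N" and NM: "N \<subseteq> carrier M"
    and A: "finite A" "A \<subseteq> N" "N \<subseteq> module_span poly_ring M A"
  shows "\<exists>n (m :: nat \<Rightarrow> 'm) \<delta>. inj_on m {..<n} \<and> (\<forall>j<n. m j \<in> G (\<delta> j) \<and> m j \<in> N) \<and>
    N \<subseteq> module_span poly_ring M (m ` {..<n}) \<and>
    (\<forall>B. B \<subset> m ` {..<n} \<longrightarrow> \<not> N \<subseteq> module_span poly_ring M B)"
proof -
  let ?gen = "\<lambda>B. B \<subseteq> (\<Union>a. G a) \<inter> N \<and> finite B \<and> N \<subseteq> module_span poly_ring M B"
  define B0 where "B0 = (\<Union>x\<in>A. mcomp x ` {a. mcomp x a \<noteq> \<zero>\<^bsub>M\<^esub>})"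
  have "?gen B0"
  proof (intro conjI)
    show "B0 \<subseteq> (\<Union>a. G a) \<inter> N"
    proof
      fix y assume "y \<in> B0"
      then obtain x a where xa: "x \<in> A" "y = mcomp x a" unfolding B0_def by blast
      then have "x \<in> N" "x \<in> carrier M" using A(2) NM by auto
      then show "y \<in> (\<Union>a. G a) \<inter> N" using xa(2) mcomp_G[of x a] hom by blast
    qed
    show "finite B0"
      unfolding B0_def using A(1,2) NM by (intro finite_UN_I finite_imageI mcomp_finite) auto
    show "N \<subseteq> module_span poly_ring M B0"
      unfolding module_span_def
    proof (rule Inter_greatest, elim CollectE conjE)
      fix N' assume N': "submodule N' poly_ring M" "B0 \<subseteq> N'"
      have "A \<subseteq> N'"
      proof
        fix x assume x: "x \<in> A"
        show "x \<in> N'"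
        proof (rule carrier_decompose_in_submodule[OF N'(1)])
          show "x \<in> carrier M" using x A(2) NM by blast
          show "mcomp x a \<in> N'" if "mcomp x a \<noteq> \<zero>\<^bsub>M\<^esub>" for a
            using N'(2) x that unfolding B0_def by blast
        qed
      qed
      then show "N \<subseteq> N'" using A(3) N'(1) unfolding module_span_def by blast
    qed
  qed
  then have ex: "\<exists>B. ?gen B" by blast
  define C where "C = (ARG_MIN card B. ?gen B)"
  have C: "?gen C" unfolding C_def using ex by (elim exE) (rule arg_min_natI)
  have C_min: "card C \<le> card B" if "?gen B" for B
    unfolding C_def using that by (rule arg_min_nat_le)
  have C_proper: "\<not> N \<subseteq> module_span poly_ring M B" if "B \<subset> C" for B
  proof
    assume "N \<subseteq> module_span poly_ring M B"
    then have "card C \<le> card B" using that C finite_subset[of B C] by (intro C_min) auto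
    then show False using psubset_card_mono[of C B] that C by simp
  qed
  obtain n and m :: "nat \<Rightarrow> 'm" where m: "bij_betw m {..<n} C"
    using C ex_bij_betw_nat_finite[of C] by (auto simp: atLeast0LessThan)
  have mC: "m ` {..<n} = C" using m by (simp add: bij_betw_def)
  have "\<forall>j. \<exists>a. j < n \<longrightarrow> m j \<in> G a" using C mC by blast
  then obtain \<delta> where \<delta>: "\<And>j. j < n \<Longrightarrow> m j \<in> G (\<delta> j)" by metis
  have "inj_on m {..<n}" using m by (simp add: bij_betw_def)
  moreover have "m j \<in> N" if "j < n" for j using C mC that by blast
  ultimately show ?thesis using \<delta> C C_proper mC by (intro exI[of _ n] exI[of _ m] exI[of _ \<delta>]) simp
qed

lemma eps_image_submodule:
  assumes m: "\<And>x. x \<in> X0 \<Longrightarrow> m x \<in> G (deg x)"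
  shows "submodule (lin_ext_to M m ` {v. keys v \<subseteq> X0}) poly_ring M"
proof (rule M.submoduleI)
  note e = eps_add[of X0 m deg, OF m, simplified] eps_scal[of X0 m deg, OF m, simplified]
    eps_zero[of X0 m deg, OF m, simplified] eps_carrier[of X0 m deg, OF m, simplified]
  let ?I = "lin_ext_to M m ` {v. keys v \<subseteq> X0}"
  show "?I \<subseteq> carrier M" using e(4) by auto
  show "\<zero>\<^bsub>M\<^esub> \<in> ?I" using e(3) by (intro image_eqI[of _ _ 0]) auto
  have sc: "a \<odot>\<^bsub>M\<^esub> y \<in> ?I" if "y \<in> ?I" for a y
  proof -
    obtain v where v: "keys v \<subseteq> X0" "y = lin_ext_to M m v" using \<open>y \<in> ?I\<close> by blast
    then show ?thesis using e(2)[OF v(1), of a] order_trans[OF keys_scal v(1), of a]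
      by (intro image_eqI[of _ _ "scal a v"]) auto
  qed
  then show "\<And>a y. a \<in> carrier poly_ring \<Longrightarrow> y \<in> ?I \<Longrightarrow> a \<odot>\<^bsub>M\<^esub> y \<in> ?I" by blast
  show "\<ominus>\<^bsub>M\<^esub> y \<in> ?I" if y: "y \<in> ?I" for y
  proof -
    have yc: "y \<in> carrier M" using y e(4) by auto
    have "(- 1) \<odot>\<^bsub>M\<^esub> y \<oplus>\<^bsub>M\<^esub> y = ((- 1) + 1) \<odot>\<^bsub>M\<^esub> y"
      using M.smult_l_distr[of "- 1" 1 y] M.smult_one[OF yc] yc by simp
    also have "\<dots> = \<zero>\<^bsub>M\<^esub>" using M.smult_l_null[OF yc] by simp
    finally have "(- 1) \<odot>\<^bsub>M\<^esub> y = \<ominus>\<^bsub>M\<^esub> y" using yc by (intro M.minus_equality[symmetric]) auto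
    then show ?thesis using sc[OF y, of "- 1"] by simp
  qed
  show "y \<oplus>\<^bsub>M\<^esub> z \<in> ?I" if y: "y \<in> ?I" and z: "z \<in> ?I" for y z
  proof -
    obtain u v where uv: "keys u \<subseteq> X0" "y = lin_ext_to M m u" "keys v \<subseteq> X0" "z = lin_ext_to M m v"
      using y z by blast
    then show ?thesis using e(1)[OF uv(1,3)] order_trans[OF keys_add Un_least[OF uv(1,3)]]
      by (intro image_eqI[of _ _ "u + v"]) auto
  qed
qed

text \<open>In a relation of degree \<open>b\<close>, a generator of degree \<open>b\<close> has a scalar coefficient. Were it
  nonzero, the generator would lie in the submodule generated by the others.\<close>

lemma relations_strict:
  assumes m: "\<And>x. x \<in> X0 \<Longrightarrow> m x \<in> G (deg x)"
    and N: "\<And>x. x \<in> X0 \<Longrightarrow> \<exists>N. submodule N poly_ring M \<and> m ` (X0 - {x}) \<subseteq> N \<and> m x \<notin> N"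
    and u: "u \<in> relations X0 deg m b" and x: "x \<in> keys u"
  shows "deg x \<noteq> b"
proof
  assume b: "deg x = b"
  have ku: "keys u \<subseteq> X0" and z: "lin_ext_to M m (homogenize deg b u) = \<zero>\<^bsub>M\<^esub>"
    using u by (auto simp: relations_def[of X0 m deg, OF m])
  then have xX: "x \<in> X0" using x by blast
  obtain N where N: "submodule N poly_ring M" "m ` (X0 - {x}) \<subseteq> N" "m x \<notin> N" using N[OF xX] by blast
  let ?k = "lookup u x" let ?u' = "u - single x ?k"
  let ?e = "lin_ext_to M m"
  have k': "keys ?u' \<subseteq> keys u - {x}"
    by (auto simp: in_keys_iff lookup_minus lookup_single when_def split: if_splits)
  have hN: "?e (homogenize deg b ?u') \<in> N"
    using k' ku N(2) by (intro eps_in_submodule[of X0 m deg, OF m N(1)]) auto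
  have "homogenize deg b u = homogenize deg b (single x ?k + ?u')" by simp
  also have "\<dots> = single x (single 0 ?k) + homogenize deg b ?u'"
    unfolding homogenize_add using b by (simp add: homogenize_single)
  finally have "?e (single x (single 0 ?k)) \<oplus>\<^bsub>M\<^esub> ?e (homogenize deg b ?u') = \<zero>\<^bsub>M\<^esub>"
    using z eps_add[of X0 m deg "single x (single 0 ?k)" "homogenize deg b ?u'", OF m]
      order_trans[OF k' order_trans[OF Diff_subset ku]] xX by simp
  then have "single 0 ?k \<odot>\<^bsub>M\<^esub> m x \<oplus>\<^bsub>M\<^esub> ?e (homogenize deg b ?u') = \<zero>\<^bsub>M\<^esub>"
    using eps_single[of X0 m deg x "single 0 ?k", OF m xX] by simp
  moreover have mx: "m x \<in> carrier M" using m[OF xX] G_carrier by blast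
  moreover have "?e (homogenize deg b ?u') \<in> carrier M" using hN M.submoduleE(1)[OF N(1)] by blast
  ultimately have "single 0 ?k \<odot>\<^bsub>M\<^esub> m x = \<ominus>\<^bsub>M\<^esub> ?e (homogenize deg b ?u')"
    by (intro M.minus_equality[symmetric]) auto
  then have "single 0 ?k \<odot>\<^bsub>M\<^esub> m x \<in> N" using M.submoduleE(3)[OF N(1) hN] by simp
  then have "single 0 (1 / ?k) \<odot>\<^bsub>M\<^esub> (single 0 ?k \<odot>\<^bsub>M\<^esub> m x) \<in> N"
    by (rule M.submoduleE(4)[OF N(1), rotated]) simp
  moreover have "single 0 (1 / ?k) \<odot>\<^bsub>M\<^esub> (single 0 ?k \<odot>\<^bsub>M\<^esub> m x) = m x"
    using M.smult_assoc1[of "single 0 (1 / ?k)" "single 0 ?k" "m x"] mx x M.smult_one[OF mx]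
    by (simp add: mult_single in_keys_iff)
  ultimately show False using N(3) by simp
qed

subsection \<open>Submodules that are sums of graded components\<close>

text \<open>The sum of the components of \<open>M\<close> with degree in \<open>E\<close>.\<close>

definition supported :: "'n expo set \<Rightarrow> 'm set" where
  "supported E = {x \<in> carrier M. \<forall>b. b \<notin> E \<longrightarrow> mcomp x b = \<zero>\<^bsub>M\<^esub>}"

lemma mcomp_uminus: "x \<in> carrier M \<Longrightarrow> mcomp (\<ominus>\<^bsub>M\<^esub> x) b = \<ominus>\<^bsub>M\<^esub> mcomp x b"
proof -
  assume x: "x \<in> carrier M"
  have "mcomp (\<ominus>\<^bsub>M\<^esub> x) b \<oplus>\<^bsub>M\<^esub> mcomp x b = mcomp (\<ominus>\<^bsub>M\<^esub> x \<oplus>\<^bsub>M\<^esub> x) b"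
    using mcomp_add[of "\<ominus>\<^bsub>M\<^esub> x" x] x by simp
  also have "\<dots> = \<zero>\<^bsub>M\<^esub>" using x by (simp add: M.l_neg mcomp_zero)
  finally show ?thesis using mcomp_carrier[of "\<ominus>\<^bsub>M\<^esub> x" b] mcomp_carrier[OF x, of b] x
    by (intro M.minus_equality[symmetric]) auto
qed

lemma poly_smult_in_supported:
  assumes E: "\<And>a b. a \<in> E \<Longrightarrow> mle a b \<Longrightarrow> b \<in> E" and x: "x \<in> carrier M"
    and f: "(\<forall>a\<in>keys f. a \<in> E) \<or> x \<in> supported E"
  shows "f \<odot>\<^bsub>M\<^esub> x \<in> supported E"
proof -
  have add: "p \<oplus>\<^bsub>M\<^esub> q \<in> supported E" if "p \<in> supported E" "q \<in> supported E" for p q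
    using that by (auto simp: supported_def mcomp_add)
  have "(\<Sum>a\<in>A. single a (lookup f a)) \<odot>\<^bsub>M\<^esub> x \<in> supported E" if "finite A" "A \<subseteq> keys f" for A
    using that
  proof (induction A rule: finite_induct)
    case empty
    then show ?case using M.smult_l_null[OF x] by (simp add: supported_def mcomp_zero)
  next
    case (insert a A)
    have "single a (lookup f a) \<odot>\<^bsub>M\<^esub> x \<in> supported E"
    proof -
      have "mcomp (single a (lookup f a) \<odot>\<^bsub>M\<^esub> x) b = \<zero>\<^bsub>M\<^esub>" if b: "b \<notin> E" for b
      proof (cases "mle a b")
        case True
        then have "a \<notin> E" "b - a \<notin> E" using E[of a b] E[of "b - a" b] b mle_add(1)[of "b - a" a]
          by (auto simp: mle_add_minus)
        then have "mcomp x (b - a) = \<zero>\<^bsub>M\<^esub>" using f insert(4) by (auto simp: supported_def)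
        then show ?thesis by (simp add: mcomp_single_smult[OF x])
      qed (simp add: mcomp_single_smult[OF x])
      then show ?thesis using x by (simp add: supported_def)
    qed
    then have "single a (lookup f a) \<odot>\<^bsub>M\<^esub> x \<oplus>\<^bsub>M\<^esub> (\<Sum>a\<in>A. single a (lookup f a)) \<odot>\<^bsub>M\<^esub> x \<in> supported E"
      using insert by (intro add) auto
    then show ?case using insert M.smult_l_distr[of "single a (lookup f a)" "\<Sum>a\<in>A. single a (lookup f a)" x] x by simp
  qed
  from this[of "keys f"] show ?thesis using poly_mapping_sum_singles[of "keys f" f] by simp
qed

lemma supported_submodule:
  assumes E: "\<And>a b. a \<in> E \<Longrightarrow> mle a b \<Longrightarrow> b \<in> E"
  shows "submodule (supported E) poly_ring M"
  by (rule M.submoduleI)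
    (use poly_smult_in_supported[OF E] in \<open>auto simp: supported_def mcomp_add mcomp_zero mcomp_uminus\<close>)

end

section \<open>The polynomial ring as a multigraded module\<close>

lemma poly_module_simps [simp]:
  "carrier poly_module = UNIV" "zero poly_module = 0" "add poly_module = (+)" "smult poly_module = (*)"
  by (simp_all add: poly_module_def)

lemma poly_module_is_module:
  "Module.module (poly_ring :: ('n, 'k::field) mpoly ring) poly_module"
proof (rule Module.moduleI)
  show "cring (poly_ring :: ('n, 'k) mpoly ring)" by (rule poly_ring_cring)
  show "abelian_group (poly_module :: (('n, 'k) mpoly, ('n, 'k) mpoly) module)"
    by (rule abelian_groupI) (auto simp: algebra_simps intro: exI[of _ "- x" for x])
qed (auto simp: algebra_simps)

lemma finsum_poly_module:
  fixes f :: "'a \<Rightarrow> ('n, 'k::field) mpoly"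
  shows "finite A \<Longrightarrow> finsum poly_module f A = sum f A"
proof (induction A rule: finite_induct)
  interpret Module.module poly_ring "poly_module :: (('n, 'k) mpoly, ('n, 'k) mpoly) module"
    by (rule poly_module_is_module)
  {
    case empty
    show ?case by simp
  next
    case (insert a A)
    then show ?case by (subst finsum_insert) auto
  }
qed

lemma poly_module_multigraded: "multigraded (poly_module :: (('n, 'k::field) mpoly, _) module) poly_grading"
  unfolding multigraded_def
proof (intro conjI allI ballI)
  show "Module.module poly_ring (poly_module :: (('n, 'k) mpoly, _) module)" by (rule poly_module_is_module)
  interpret Module.module poly_ring "poly_module :: (('n, 'k) mpoly, ('n, 'k) mpoly) module"
    by (rule poly_module_is_module)
  fix a :: "'n expo"
  show "subgroup (poly_grading a) (add_monoid (poly_module :: (('n, 'k) mpoly, _) module))"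
  proof (rule group.subgroupI[OF add.is_group])
    fix f :: "('n, 'k) mpoly" assume f: "f \<in> poly_grading a"
    have "inv\<^bsub>add_monoid poly_module\<^esub> f = - f"
      using minus_equality[of "- f" f] by (simp add: a_inv_def)
    then show "inv\<^bsub>add_monoid poly_module\<^esub> f \<in> poly_grading a" using f by (simp add: poly_grading_def)
  next
    fix f g :: "('n, 'k) mpoly" assume "f \<in> poly_grading a" "g \<in> poly_grading a"
    then show "f \<otimes>\<^bsub>add_monoid poly_module\<^esub> g \<in> poly_grading a"
      using keys_add[of f g] by (auto simp: poly_grading_def)
  qed (auto simp: poly_grading_def intro: exI[of _ 0])
  fix b k and x :: "('n, 'k) mpoly" assume "x \<in> poly_grading b"
  then show "single a k \<odot>\<^bsub>poly_module\<^esub> x \<in> poly_grading (a + b)"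
    using keys_mult[of "single a k" x] by (auto simp: poly_grading_def split: if_splits)
next
  fix x :: "('n, 'k) mpoly"
  let ?P = "\<lambda>f. (\<forall>a. f a \<in> poly_grading a) \<and> finite {a. f a \<noteq> \<zero>\<^bsub>poly_module\<^esub>} \<and>
    x = (\<Oplus>\<^bsub>poly_module\<^esub>a\<in>{a. f a \<noteq> \<zero>\<^bsub>poly_module\<^esub>}. f a)"
  have eq: "{a. single a (lookup x a) \<noteq> 0} = keys x" by (auto simp: single_eq_0_iff in_keys_iff)
  show "\<exists>!f. ?P f"
  proof (rule ex1I[of _ "\<lambda>a. single a (lookup x a)"])
    show "?P (\<lambda>a. single a (lookup x a))"
      using poly_mapping_sum_singles[of "keys x" x]
      by (simp add: eq finsum_poly_module) (simp add: poly_grading_def)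
    fix f assume f: "?P f"
    show "f = (\<lambda>a. single a (lookup x a))"
    proof
      fix a
      have g: "\<And>b. keys (f b) \<subseteq> {b}" using f by (simp add: poly_grading_def)
      have "lookup x a = (\<Sum>b\<in>{b. f b \<noteq> 0}. lookup (f b) a)"
        using f by (simp add: finsum_poly_module lookup_sum)
      also have "\<dots> = (\<Sum>b\<in>{b. f b \<noteq> 0}. if b = a then lookup (f a) a else 0)"
      proof (intro sum.cong refl)
        fix b
        have "lookup (f b) a = 0" if "b \<noteq> a"
          using g[of b] that not_in_keys_iff_lookup_eq_zero[of a "f b"] by blast
        then show "lookup (f b) a = (if b = a then lookup (f a) a else 0)" by simp
      qed
      also have "\<dots> = lookup (f a) a" using f by auto
      finally have l: "lookup x a = lookup (f a) a" .
      show "f a = single a (lookup x a)"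
        unfolding l using g[of a] by (intro poly_mapping_eqI) (auto simp: lookup_single when_def in_keys_iff)
    qed
  qed
qed

interpretation S: mgmod poly_module poly_grading
  by unfold_locales (rule poly_module_multigraded)

lemma S_mcomp: "S.mcomp f a = single a (lookup f a)"
proof -
  have "S.mcomp f = (\<lambda>a. single a (lookup f a))"
  proof (rule S.mcompI[of _ "keys f"])
    show "f = finsum poly_module (\<lambda>a. single a (lookup f a)) (keys f)"
      using poly_mapping_sum_singles[of "keys f" f] by (simp add: finsum_poly_module)
  qed (auto simp: poly_grading_def in_keys_iff)
  then show ?thesis by simp
qed

section \<open>Monomial ideals\<close>

definition expos :: "('n, 'k::field) mpoly set \<Rightarrow> 'n expo set" where
  "expos I = {b. monomial b \<in> I}"

lemma genideal_monomials:
  fixes A :: "'n::finite expo set"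
  shows "genideal poly_ring (monomial ` A) = {f :: ('n, 'k::field) mpoly. keys f \<subseteq> {b. \<exists>a\<in>A. mle a b}}"
    (is "?l = ?r")
proof (rule equalityI)
  let ?E = "{b. \<exists>a\<in>A. mle a b}"
  show "?l \<subseteq> ?r"
  proof (rule genideal_props(3))
    show "ideal ?r poly_ring"
    proof (rule poly_idealI)
      fix f g :: "('n, 'k) mpoly"
      show "f \<in> ?r \<Longrightarrow> g \<in> ?r \<Longrightarrow> f + g \<in> ?r"
        using order_trans[OF keys_add[of f g] Un_least, of ?E] by simp
      assume f: "f \<in> ?r"
      have "c \<in> ?E" if "c \<in> keys (g * f)" for c
      proof -
        obtain b d where bd: "c = b + d" "d \<in> keys f"
          using subsetD[OF keys_mult \<open>c \<in> keys (g * f)\<close>] by blast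
        then obtain a where "a \<in> A" "mle a d" using f by blast
        then show ?thesis using bd(1) mle_trans[of a d "b + d"] by auto
      qed
      then show "g * f \<in> ?r" by blast
    qed simp
    show "monomial ` A \<subseteq> ?r" using mle_refl by (force simp: monomial_def)
  qed
next
  have J: "ideal ?l (poly_ring :: ('n, 'k) mpoly ring)" by (rule genideal_props(1))
  show "?r \<subseteq> ?l"
  proof
    fix f :: "('n, 'k) mpoly" assume f: "f \<in> ?r"
    have "single b (lookup f b) \<in> ?l" if b: "b \<in> keys f" for b
    proof -
      obtain a where a: "a \<in> A" "mle a b" using f b by blast
      have "monomial a \<in> ?l" by (rule subsetD[OF genideal_props(2) imageI[OF a(1)]])
      then have "single (b - a) (lookup f b) * monomial a \<in> ?l" by (rule poly_idealD(3)[OF J])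
      then show ?thesis using a(2) by (simp add: monomial_def mult_single)
    qed
    then have "(\<Sum>b\<in>keys f. single b (lookup f b)) \<in> ?l" by (rule poly_ideal_sum[OF J])
    then show "f \<in> ?l" using poly_mapping_sum_singles[of "keys f" f] by simp
  qed
qed

lemma generated_by_monomials_iff:
  "generated_by_monomials (I :: ('n::finite, 'k::field) mpoly set) A \<longleftrightarrow> I = {f. keys f \<subseteq> {b. \<exists>a\<in>A. mle a b}}"
  by (simp add: generated_by_monomials_def genideal_monomials)

lemma expos_generated:
  assumes "generated_by_monomials (I :: ('n::finite, 'k::field) mpoly set) A"
  shows "expos I = {b. \<exists>a\<in>A. mle a b}"
proof -
  have I: "I = {f. keys f \<subseteq> {b. \<exists>a\<in>A. mle a b}}" using assms by (simp add: generated_by_monomials_iff)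
  show ?thesis unfolding expos_def by (subst I) (simp add: monomial_def)
qed

lemma monomial_ideal_iff_keys:
  assumes "monomial_ideal (I :: ('n::finite, 'k::field) mpoly set)"
  shows "I = {f. keys f \<subseteq> expos I}"
proof -
  obtain A where A: "generated_by_monomials I A" using assms by (auto simp: monomial_ideal_def)
  show ?thesis unfolding expos_generated[OF A] using A by (simp add: generated_by_monomials_iff)
qed

lemma expos_up:
  assumes "monomial_ideal (I :: ('n::finite, 'k::field) mpoly set)" "a \<in> expos I" "mle a b"
  shows "b \<in> expos I"
proof -
  obtain A where A: "generated_by_monomials I A" using assms by (auto simp: monomial_ideal_def)
  obtain a' where a': "a' \<in> A" "mle a' a" using assms(2) unfolding expos_generated[OF A] by blast
  then show ?thesis unfolding expos_generated[OF A] using mle_trans[OF a'(2) assms(3)] by blast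
qed

text \<open>The exponents of \<open>I\<close> that are minimal for divisibility form an irredundant set of
  generators, so their variables belong to \<open>Gens_ideal I\<close>; divisibility is well-founded by total
  degree.\<close>

lemma expos_minimal:
  assumes I: "monomial_ideal (I :: ('n::finite, 'k::field) mpoly set)" and b: "b \<in> expos I"
  shows "\<exists>a\<in>expos I. mle a b \<and> (\<forall>i. lookup a i > 0 \<longrightarrow> i \<in> Gens_ideal I)"
proof -
  define A where "A = {a \<in> expos I. \<forall>a'\<in>expos I. mle a' a \<longrightarrow> a' = a}"
  have below: "\<exists>a\<in>A. mle a b" if "b \<in> expos I" for b
    using that
  proof (induction "total_degree b" arbitrary: b rule: less_induct)
    case less
    show ?case
    proof (cases "b \<in> A")
      case False
      then obtain a' where a': "a' \<in> expos I" "mle a' b" "a' \<noteq> b" using less(2) by (auto simp: A_def)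
      then obtain a where "a \<in> A" "mle a a'" using less(1)[OF total_degree_strict] by blast
      then show ?thesis using a'(2) mle_trans by blast
    qed (auto intro: bexI[of _ b])
  qed
  have "{b. \<exists>a\<in>A. mle a b} = expos I"
    using below expos_up[OF I] by (auto simp: A_def)
  then have gen: "generated_by_monomials I A"
    unfolding generated_by_monomials_iff using monomial_ideal_iff_keys[OF I] by simp
  moreover have "\<not> generated_by_monomials I B" if "B \<subset> A" for B
  proof
    assume B: "generated_by_monomials I B"
    obtain a where a: "a \<in> A" "a \<notin> B" using \<open>B \<subset> A\<close> by blast
    then have "a \<in> expos I" by (simp add: A_def)
    then obtain a' where a': "a' \<in> B" "mle a' a" using expos_generated[OF B] by blast
    then have "a' \<in> expos I" using \<open>B \<subset> A\<close> by (auto simp: A_def)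
    then have "a' = a" using a a'(2) by (simp add: A_def)
    then show False using a(2) a'(1) by simp
  qed
  ultimately have "i \<in> Gens_ideal I" if "a \<in> A" "lookup a i > 0" for a i
    unfolding Gens_ideal_def using that by blast
  then show ?thesis using below[OF b] by (auto simp: A_def)
qed

lemma monomial_ideal_supported:
  assumes "monomial_ideal (I :: ('n::finite, 'k::field) mpoly set)"
  shows "I = S.supported (expos I)"
proof -
  show ?thesis
    unfolding S.supported_def using monomial_ideal_iff_keys[OF assms] 
    by (auto simp: S_mcomp single_eq_0_iff in_keys_iff subset_iff)
qed

text \<open>The component \<open>M\<^sub>b\<close> is spanned by multiples \<open>x^(b - d) m\<close> of generators \<open>m\<close> of degree \<open>d\<close>. If
  \<open>x\<^sup>b \<in> I\<close> and \<open>x\<^sup>a\<close> is a minimal generator of \<open>I\<close> dividing \<open>x\<^sup>b\<close>, then \<open>x\<^sup>a\<close> has no variable in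
  common with \<open>x\<^sup>d\<close>, so it divides \<open>x^(b - d)\<close>.\<close>

lemma (in mgmod) ideal_smult_supported:
  fixes I :: "('n, 'k) mpoly set" and m :: "'x \<Rightarrow> 'm"
  assumes I: "monomial_ideal I" and m: "\<And>x. x \<in> X0 \<Longrightarrow> m x \<in> G (deg x)"
    and disj: "\<And>x i. x \<in> X0 \<Longrightarrow> lookup (deg x) i > 0 \<Longrightarrow> i \<notin> Gens_ideal I"
    and surj: "carrier M \<subseteq> lin_ext_to M m ` {v. keys v \<subseteq> X0}"
  shows "ideal_smult poly_ring I M = supported (expos I)"
proof (rule equalityI)
  let ?S = "{f \<odot>\<^bsub>M\<^esub> x | f x. f \<in> I \<and> x \<in> carrier M}"
  have up: "\<And>a b. a \<in> expos I \<Longrightarrow> mle a b \<Longrightarrow> b \<in> expos I" by (rule expos_up[OF I])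
  have sub: "submodule (supported (expos I)) poly_ring M" by (rule supported_submodule) (rule up)
  have "?S \<subseteq> supported (expos I)"
  proof
    fix y assume "y \<in> ?S"
    then obtain f x where y: "y = f \<odot>\<^bsub>M\<^esub> x" "f \<in> I" "x \<in> carrier M" by blast
    have "\<forall>a\<in>keys f. a \<in> expos I" using y(2) monomial_ideal_iff_keys[OF I] by blast
    then show "y \<in> supported (expos I)"
      unfolding y(1) using up y(3) by (intro poly_smult_in_supported disjI1)
  qed
  then show "ideal_smult poly_ring I M \<subseteq> supported (expos I)"
    unfolding ideal_smult_def module_span_def using sub by blast
  show "supported (expos I) \<subseteq> ideal_smult poly_ring I M"
    unfolding ideal_smult_def module_span_def
  proof (intro subsetI InterI, elim CollectE conjE)
    fix y N assume y: "y \<in> supported (expos I)" and N: "submodule N poly_ring M" and SN: "?S \<subseteq> N"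
    have yc: "y \<in> carrier M" using y by (simp add: supported_def)
    show "y \<in> N"
    proof (rule carrier_decompose_in_submodule[OF N yc])
      fix b assume "mcomp y b \<noteq> \<zero>\<^bsub>M\<^esub>"
      then have b: "b \<in> expos I" using y by (auto simp: supported_def)
      obtain a where a: "a \<in> expos I" "mle a b" "\<And>i. lookup a i > 0 \<Longrightarrow> i \<in> Gens_ideal I"
        using expos_minimal[OF I b] by blast
      obtain v where v: "keys v \<subseteq> X0" "y = lin_ext_to M m v" using surj yc by blast
      let ?u = "component deg b v"
      have ku: "keys ?u \<subseteq> X0" "\<And>x. x \<in> keys ?u \<Longrightarrow> mle (deg x) b"
        using keys_component[of deg b v] v(1) by auto
      have eq: "mcomp y b = lin_ext_to M m (homogenize deg b ?u)"
        unfolding v(2) by (rule mcomp_eps[of X0 m deg, OF m v(1)])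
      show "mcomp y b \<in> N" unfolding eq lin_ext_to_def
      proof (rule submodule_finsum[OF mod N])
        fix x assume "x \<in> keys (homogenize deg b ?u)"
        then have x: "x \<in> X0" "mle (deg x) b" using ku by auto
        have "mle a (b - deg x)" unfolding mle_def
        proof
          fix i
          show "lookup a i \<le> lookup (b - deg x) i"
          proof (cases "lookup a i > 0")
            case True
            then have "lookup (deg x) i = 0" using disj[OF x(1)] a(3) by blast
            then show ?thesis using a(2) by (simp add: lookup_minus_nat mle_def)
          qed simp
        qed
        then have "b - deg x \<in> expos I" using up a(1) by blast
        then have "keys (lookup (homogenize deg b ?u) x) \<subseteq> expos I" by simp
        then have "lookup (homogenize deg b ?u) x \<in> I" by (subst monomial_ideal_iff_keys[OF I]) simp
        moreover have "m x \<in> carrier M" using m[OF x(1)] G_carrier by blast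
        ultimately show "lookup (homogenize deg b ?u) x \<odot>\<^bsub>M\<^esub> m x \<in> N" using SN by blast
      qed
    qed
  qed
qed

section \<open>Frames of multigraded modules\<close>

lemma homogenize_cong: "(\<And>x. x \<in> keys u \<Longrightarrow> deg x = deg' x) \<Longrightarrow> homogenize deg b u = homogenize deg' b u"
  by (rule poly_mapping_eqI, case_tac "k \<in> keys u") (auto simp: in_keys_iff)

lemma level_labels: "frame (SIGMA i:UNIV. {..<K i}) fst deg c \<Longrightarrow>
    frame.level (SIGMA i:UNIV. {..<K i}) fst i = Pair i ` {..<K i}"
  by (auto simp: frame.level_def)

context mgmod
begin

text \<open>Given generators \<open>m\<close> of \<open>N\<close>, it remains to know in each degree that their relations are the
  boundaries of the frame.\<close>

lemma frame_resolution_submodule: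
  fixes X :: "'x set" and deg :: "'x \<Rightarrow> 'n expo" and c :: "'x \<Rightarrow> 'x \<Rightarrow>\<^sub>0 'k"
  assumes fr: "frame X hdg deg c" and ex: "frame.exact X hdg deg c"
    and N: "submodule N poly_ring M"
    and m: "\<And>x. x \<in> frame.level X hdg 0 \<Longrightarrow> m x \<in> G (deg x)"
    and mN: "\<And>x. x \<in> frame.level X hdg 0 \<Longrightarrow> m x \<in> N"
    and surj: "N \<subseteq> lin_ext_to M m ` {v. keys v \<subseteq> frame.level X hdg 0}"
    and bd: "\<And>b u. keys u \<subseteq> frame.below X hdg deg 0 b \<Longrightarrow>
      lin_ext_to M m (homogenize deg b u) = \<zero>\<^bsub>M\<^esub> \<longleftrightarrow> u \<in> frame.boundaries X hdg deg c 0 b"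
  shows "resolution poly_ring (\<lambda>i. free_module (frame.level X hdg i)) (\<lambda>_. frame.diff deg c)
    (lin_ext_to M m) (M\<lparr>carrier := N\<rparr>)"
proof -
  interpret frame X hdg deg c by (rule fr)
  show ?thesis
  proof (rule frame_resolution[OF ex])
    show "lin_ext_to M m \<in> linear_maps poly_ring (free_module (level 0)) (M\<lparr>carrier := N\<rparr>)"
      by (rule eps_linear_submodule[of _ m deg]) (use m mN N in auto)
    show "carrier (M\<lparr>carrier := N\<rparr>) \<subseteq> lin_ext_to M m ` {v. keys v \<subseteq> level 0}" using surj by simp
    fix v :: "'x \<Rightarrow>\<^sub>0 ('n, 'k) mpoly" assume v: "keys v \<subseteq> level 0"
    have "keys (component deg b v) \<subseteq> below 0 b" for b
      using keys_component[of deg b v] v by (auto simp: level_def below_def)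
    then show "lin_ext_to M m v = \<zero>\<^bsub>M\<lparr>carrier := N\<rparr>\<^esub> \<longleftrightarrow> (\<forall>b. component deg b v \<in> boundaries 0 b)"
      using eps_eq_0_iff[of "level 0" m deg v, OF m v] bd by simp
  qed
qed

text \<open>Minimal homogeneous generators of \<open>N\<close> form homological degree \<open>0\<close>, and
  \<open>minimal_frame_exists\<close> resolves the family of their relations. Minimality in homological degree
  \<open>1\<close> is \<open>relations_strict\<close>. The last two conclusions say that \<open>m\<close> lists a minimal generating set,
  by which the degrees are related to \<open>Gens\<close>.\<close>

lemma submodule_minimal_frame:
  assumes N: "submodule N poly_ring M" and hom: "\<forall>x\<in>N. \<forall>a. mcomp x a \<in> N"
    and A: "finite A" "A \<subseteq> N" "N \<subseteq> module_span poly_ring M A"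
  shows "\<exists>K (deg :: nat \<times> nat \<Rightarrow> 'n expo) c m.
    frame (SIGMA i:UNIV. {..<K i}) fst deg c \<and> frame.exact (SIGMA i:UNIV. {..<K i}) fst deg c \<and>
    frame.minimal (SIGMA i:UNIV. {..<K i}) deg c \<and>
    (\<forall>x\<in>Pair 0 ` {..<K 0}. m x \<in> G (deg x) \<and> m x \<in> N) \<and>
    N \<subseteq> lin_ext_to M m ` {v. keys v \<subseteq> Pair 0 ` {..<K 0}} \<and>
    (\<forall>b u. keys u \<subseteq> frame.below (SIGMA i:UNIV. {..<K i}) fst deg 0 b \<longrightarrow>
      (lin_ext_to M m (homogenize deg b u) = \<zero>\<^bsub>M\<^esub> \<longleftrightarrow>
        u \<in> frame.boundaries (SIGMA i:UNIV. {..<K i}) fst deg c 0 b)) \<and>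
    N \<subseteq> module_span poly_ring M (m ` Pair 0 ` {..<K 0}) \<and>
    (\<forall>B. B \<subset> m ` Pair 0 ` {..<K 0} \<longrightarrow> \<not> N \<subseteq> module_span poly_ring M B)"
proof -
  have NM: "N \<subseteq> carrier M" by (rule M.submoduleE(1)[OF N])
  obtain n and m0 :: "nat \<Rightarrow> 'm" and \<delta> where inj: "inj_on m0 {..<n}"
    and m0: "\<forall>j<n. m0 j \<in> G (\<delta> j) \<and> m0 j \<in> N"
    and span: "N \<subseteq> module_span poly_ring M (m0 ` {..<n})"
    and min: "\<forall>B. B \<subset> m0 ` {..<n} \<longrightarrow> \<not> N \<subseteq> module_span poly_ring M B"
    using homogeneous_generators[OF hom NM A] by (elim exE conjE)
  define deg0 where "deg0 x = \<delta> (snd x)" for x :: "nat \<times> nat"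
  define m where "m x = m0 (snd x)" for x :: "nat \<times> nat"
  let ?X0 = "{0::nat} \<times> {..<n}"
  have X0: "?X0 = Pair 0 ` {..<n}" by auto
  have mX0: "m ` ?X0 = m0 ` {..<n}" unfolding X0 image_image m_def by simp
  have mG: "\<And>x. x \<in> ?X0 \<Longrightarrow> m x \<in> G (deg0 x)" using m0 by (auto simp: m_def deg0_def)
  have mN: "\<And>x. x \<in> ?X0 \<Longrightarrow> m x \<in> N" using m0 by (auto simp: m_def)
  have rf: "monotone_family (\<lambda>b. {x \<in> ?X0. mle (deg0 x) b}) (relations ?X0 deg0 m)"
    by (rule relations_family) (rule mG)
  obtain K and deg :: "nat \<times> nat \<Rightarrow> 'n expo" and c :: "nat \<times> nat \<Rightarrow> (nat \<times> nat) \<Rightarrow>\<^sub>0 'k" where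
    fr: "frame (SIGMA i:UNIV. {..<K i}) fst deg c" and K0: "K 0 = n" and deg: "\<forall>x\<in>?X0. deg x = deg0 x"
    and ex: "frame.exact (SIGMA i:UNIV. {..<K i}) fst deg c"
    and bd: "\<forall>b. frame.boundaries (SIGMA i:UNIV. {..<K i}) fst deg c 0 b = relations ?X0 deg0 m b"
    and strict: "\<forall>i j. j < K (Suc (Suc i)) \<longrightarrow> (\<forall>y\<in>keys (c (Suc (Suc i), j)). deg y \<noteq> deg (Suc (Suc i), j))"
    using minimal_frame_exists[OF rf] by (elim exE conjE)
  interpret frame "SIGMA i:UNIV. {..<K i}" fst deg c by (rule fr)
  have strict0: "deg0 x \<noteq> b" if u: "u \<in> relations ?X0 deg0 m b" and x: "x \<in> keys u" for u x b
  proof (rule relations_strict[of ?X0 m deg0, OF mG _ u x])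
    fix y assume y: "y \<in> ?X0"
    show "\<exists>N'. submodule N' poly_ring M \<and> m ` (?X0 - {y}) \<subseteq> N' \<and> m y \<notin> N'"
    proof (rule ccontr)
      assume no: "\<nexists>N'. submodule N' poly_ring M \<and> m ` (?X0 - {y}) \<subseteq> N' \<and> m y \<notin> N'"
      have "m y \<notin> m ` (?X0 - {y})"
      proof
        assume "m y \<in> m ` (?X0 - {y})"
        then obtain z where z: "z \<in> ?X0" "z \<noteq> y" "m0 (snd y) = m0 (snd z)" by (auto simp: m_def)
        then have "snd y = snd z" using y by (intro inj_onD[OF inj]) auto
        then show False using y z(1,2) by (auto simp: prod_eq_iff)
      qed
      moreover have "m y \<in> m ` ?X0" using y by (rule imageI)
      moreover have "m ` (?X0 - {y}) \<subseteq> m ` ?X0" by (intro image_mono Diff_subset)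
      ultimately have sub: "m ` (?X0 - {y}) \<subset> m0 ` {..<n}" unfolding mX0[symmetric] by auto
      have "N \<subseteq> module_span poly_ring M (m ` (?X0 - {y}))"
        unfolding module_span_def
      proof (rule Inter_greatest, elim CollectE conjE)
        fix N' assume N': "submodule N' poly_ring M" "m ` (?X0 - {y}) \<subseteq> N'"
        have my: "m y \<in> N'"
        proof (rule ccontr)
          assume "m y \<notin> N'"
          then have "submodule N' poly_ring M \<and> m ` (?X0 - {y}) \<subseteq> N' \<and> m y \<notin> N'" using N' by (intro conjI)
          then have "\<exists>N'. submodule N' poly_ring M \<and> m ` (?X0 - {y}) \<subseteq> N' \<and> m y \<notin> N'" by (rule exI[of _ N'])
          then show False by (rule notE[OF no])
        qed
        have "m ` ?X0 \<subseteq> N'"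
        proof (rule image_subsetI)
          fix x assume "x \<in> ?X0"
          then show "m x \<in> N'" using my N'(2) by (cases "x = y") (simp, intro subsetD[OF N'(2)] imageI, simp)
        qed
        then have "module_span poly_ring M (m0 ` {..<n}) \<subseteq> N'"
          unfolding module_span_def mX0[symmetric] using N'(1) by (intro Inter_lower) simp
        then show "N \<subseteq> N'" using span by (rule order_trans[rotated])
      qed
      then show False using min[rule_format, OF sub] by simp
    qed
  qed
  have min_frame: minimal
    unfolding minimal_def
  proof (intro ballI)
    fix x y assume x: "x \<in> (SIGMA i:UNIV. {..<K i})" and y: "y \<in> keys (c x)"
    note kc = keys_c[OF x y]
    obtain i j where ij: "x = (i, j)" by fastforce
    show "deg y \<noteq> deg x"
    proof (cases i)
      case 0
      then show ?thesis using kc ij by simp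
    next
      case (Suc i')
      show ?thesis
      proof (cases i')
        case 0
        have "c x \<in> boundaries 0 (deg x)"
          unfolding boundaries_def using x ij Suc 0 by (intro image_eqI[of _ _ "single x 1"]) (auto simp: below_def)
        then have "deg0 y \<noteq> deg x" using strict0[OF _ y] bd by simp
        moreover have "y \<in> ?X0" using kc ij Suc 0 K0 by (cases y) auto
        ultimately show ?thesis using bspec[OF deg, of y] by metis
      next
        case (Suc i'')
        then show ?thesis using strict x y ij \<open>i = Suc i'\<close> by auto
      qed
    qed
  qed
  have bd': "lin_ext_to M m (homogenize deg b u) = \<zero>\<^bsub>M\<^esub> \<longleftrightarrow> u \<in> boundaries 0 b"
    if u: "keys u \<subseteq> below 0 b" for b u
  proof -
    have ku: "keys u \<subseteq> {x \<in> ?X0. mle (deg0 x) b}"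
    proof
      fix x assume "x \<in> keys u"
      then have "x \<in> below 0 b" using u by blast
      then have "x \<in> ?X0" "mle (deg x) b" using K0 by (auto simp: below_def)
      then show "x \<in> {x \<in> ?X0. mle (deg0 x) b}" using deg by auto
    qed
    have "homogenize deg b u = homogenize deg0 b u" using ku deg by (intro homogenize_cong) auto
    then show ?thesis using ku bd by (simp add: relations_def[of ?X0 m deg0, OF mG])
  qed
  have surj: "N \<subseteq> lin_ext_to M m ` {v. keys v \<subseteq> Pair 0 ` {..<n}}"
  proof -
    have "m ` ?X0 \<subseteq> lin_ext_to M m ` {v. keys v \<subseteq> ?X0}"
    proof (rule image_subsetI)
      fix x assume x: "x \<in> ?X0"
      have "m x \<in> carrier M" using mN[OF x] NM by blast
      then have "lin_ext_to M m (single x 1) = m x" using eps_single[of ?X0 m deg0 x 1, OF mG x] M.smult_one[of "m x"] by simp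
      then show "m x \<in> lin_ext_to M m ` {v. keys v \<subseteq> ?X0}" using x by (intro image_eqI[of _ _ "single x 1"]) auto
    qed
    moreover have "submodule (lin_ext_to M m ` {v. keys v \<subseteq> ?X0}) poly_ring M"
      by (rule eps_image_submodule) (rule mG)
    ultimately have "module_span poly_ring M (m0 ` {..<n}) \<subseteq> lin_ext_to M m ` {v. keys v \<subseteq> ?X0}"
      unfolding module_span_def mX0[symmetric] by (intro Inter_lower) simp
    then show ?thesis unfolding X0[symmetric] using span by (rule order_trans[rotated])
  qed
  have gens: "m x \<in> G (deg x) \<and> m x \<in> N" if "x \<in> Pair 0 ` {..<n}" for x
  proof -
    have x: "x \<in> ?X0" using that by (simp only: X0)
    show ?thesis using mG[OF x] mN[OF x] bspec[OF deg x] by simp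
  qed
  have img: "m ` Pair 0 ` {..<K 0} = m0 ` {..<n}"
    unfolding K0 X0[symmetric] by (rule mX0)
  have bd'': "\<forall>b u. keys u \<subseteq> below 0 b \<longrightarrow>
      (lin_ext_to M m (homogenize deg b u) = \<zero>\<^bsub>M\<^esub> \<longleftrightarrow> u \<in> boundaries 0 b)"
    using bd' by blast
  have gens': "\<forall>x\<in>Pair 0 ` {..<n}. m x \<in> G (deg x) \<and> m x \<in> N" using gens by blast
  note all = conjI[OF fr conjI[OF ex conjI[OF min_frame conjI[OF gens' conjI[OF surj conjI[OF bd'' conjI[OF span min]]]]]]]
  show ?thesis
    by (rule exI[of _ K], rule exI[of _ deg], rule exI[of _ c], rule exI[of _ m], unfold img, unfold K0, rule all)
qed

end

context frame
begin

text \<open>Without its labels of homological degree \<open>0\<close>, a frame of \<open>S/I\<close> is a frame of \<open>I\<close>. The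
  boundaries of the new labels of homological degree \<open>0\<close> are set to \<open>0\<close>.\<close>

lemma shift_frame:
  "frame {x \<in> X. hdg x \<noteq> 0} (\<lambda>x. hdg x - 1) deg (\<lambda>x. if hdg x \<le> 1 then 0 else c x)"
proof
  fix x y assume x: "x \<in> {x \<in> X. hdg x \<noteq> 0}" and y: "y \<in> keys (if hdg x \<le> 1 then 0 else c x)"
  then have "1 < hdg x" "y \<in> keys (c x)" by (auto split: if_splits)
  then show "y \<in> {x \<in> X. hdg x \<noteq> 0} \<and> Suc (hdg y - 1) = hdg x - 1 \<and> mle (deg y) (deg x)"
    using keys_c[of x y] x by auto
qed

lemma shift_level: "frame.level {x \<in> X. hdg x \<noteq> 0} (\<lambda>x. hdg x - 1) i = level (Suc i)"
  unfolding frame.level_def[OF shift_frame] level_def by auto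

lemma shift_below: "frame.below {x \<in> X. hdg x \<noteq> 0} (\<lambda>x. hdg x - 1) deg i b = below (Suc i) b"
  unfolding frame.below_def[OF shift_frame] below_def by auto

lemma shift_bd:
  assumes "keys u \<subseteq> below (Suc (Suc i)) b"
  shows "lin_ext (\<lambda>x. if hdg x \<le> 1 then 0 else c x) u = lin_ext c u"
  using assms by (rule lin_ext_eqI) (simp add: below_def)

lemma shift_boundaries:
  "frame.boundaries {x \<in> X. hdg x \<noteq> 0} (\<lambda>x. hdg x - 1) deg (\<lambda>x. if hdg x \<le> 1 then 0 else c x) i b
    = boundaries (Suc i) b"
  unfolding frame.boundaries_def[OF shift_frame] shift_below boundaries_def
  using shift_bd by (intro image_cong) auto

lemma shift_exact:
  assumes exact
  shows "frame.exact {x \<in> X. hdg x \<noteq> 0} (\<lambda>x. hdg x - 1) deg (\<lambda>x. if hdg x \<le> 1 then 0 else c x)"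
  unfolding frame.exact_def[OF shift_frame] shift_below shift_boundaries
  using assms shift_bd by (simp add: exact_def)

end

section \<open>The frame of a monomial ideal\<close>

lemma lookup_lin_ext: "lookup (lin_ext f v) y = (\<Sum>x\<in>keys v. lookup v x * lookup (f x) y)"
  by (simp add: lin_ext_def lookup_sum)

lemma pairing_sum: "pairing l u = (\<Sum>x\<in>keys u. lookup u x * l x)"
  by (simp add: pairing_def lookup_lin_ext)

text \<open>In degree \<open>b\<close> the module \<open>S/I\<close> is zero or the ground field according to whether \<open>x\<^sup>b \<in> I\<close>,
  so the relations of its single generator are everything or zero. For \<open>I = S\<close> the complex \<open>S \<rightarrow> S\<close>
  is not minimal in homological degree \<open>1\<close>, hence strictness is asserted from degree \<open>2\<close> on, which
  covers all boundaries in the frame of \<open>I\<close>.\<close>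

lemma ideal_frame_exists:
  fixes I :: "('n::finite, 'k::field) mpoly set"
  assumes I: "monomial_ideal I"
  shows "\<exists>K (deg :: nat \<times> nat \<Rightarrow> 'n expo) (c :: nat \<times> nat \<Rightarrow> (nat \<times> nat) \<Rightarrow>\<^sub>0 'k).
    frame (SIGMA i:UNIV. {..<K i}) fst deg c \<and> K 0 = 1 \<and> deg (0, 0) = 0 \<and>
    frame.exact (SIGMA i:UNIV. {..<K i}) fst deg c \<and>
    (\<forall>b. frame.boundaries (SIGMA i:UNIV. {..<K i}) fst deg c 0 b
      = {u. keys u \<subseteq> {(0, 0)} \<and> (u \<noteq> 0 \<longrightarrow> b \<in> expos I)}) \<and>
    (\<forall>i j. j < K (Suc (Suc i)) \<longrightarrow> (\<forall>y\<in>keys (c (Suc (Suc i), j)). deg y \<noteq> deg (Suc (Suc i), j)))"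
proof -
  let ?K0 = "\<lambda>b. {u :: (nat \<times> nat) \<Rightarrow>\<^sub>0 'k. keys u \<subseteq> {(0, 0)} \<and> (u \<noteq> 0 \<longrightarrow> b \<in> expos I)}"
  have add: "keys (u + v) \<subseteq> Z" if "keys u \<subseteq> Z" "keys v \<subseteq> Z" for u v :: "(nat \<times> nat) \<Rightarrow>\<^sub>0 'k" and Z
    by (rule order_trans[OF keys_add Un_least[OF that]])
  have sc: "keys (scal a u) \<subseteq> Z" if "keys u \<subseteq> Z" for a and u :: "(nat \<times> nat) \<Rightarrow>\<^sub>0 'k" and Z
    by (rule order_trans[OF keys_scal that])
  have "monotone_family (\<lambda>b. {x \<in> {0} \<times> {..<1}. mle ((\<lambda>_. 0) x) b}) ?K0"
    unfolding monotone_family_def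
  proof (intro conjI allI impI ballI)
    fix b
    show "pm.subspace (?K0 b)" unfolding pm.subspace_def using add sc by auto
    show "keys u \<subseteq> {x \<in> {0} \<times> {..<1}. mle 0 b}" if "u \<in> ?K0 b" for u using that by auto
  next
    fix b b' :: "'n expo" assume "mle b b'"
    then show "?K0 b \<subseteq> ?K0 b'" using expos_up[OF I] by blast
  qed
  from minimal_frame_exists[OF this]
  obtain K and deg :: "nat \<times> nat \<Rightarrow> 'n expo" and c :: "nat \<times> nat \<Rightarrow> (nat \<times> nat) \<Rightarrow>\<^sub>0 'k" where
    "frame (SIGMA i:UNIV. {..<K i}) fst deg c" "K 0 = 1" "\<forall>x\<in>{0} \<times> {..<1}. deg x = 0"
    "frame.exact (SIGMA i:UNIV. {..<K i}) fst deg c"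
    "\<forall>b. frame.boundaries (SIGMA i:UNIV. {..<K i}) fst deg c 0 b = ?K0 b"
    "\<forall>i j. j < K (Suc (Suc i)) \<longrightarrow> (\<forall>y\<in>keys (c (Suc (Suc i), j)). deg y \<noteq> deg (Suc (Suc i), j))"
    by (elim exE conjE)
  then show ?thesis by (intro exI[of _ K] exI[of _ deg] exI[of _ c] conjI) auto
qed

text \<open>The sublocale \<open>F\<close> is the frame of \<open>S/I\<close>, and \<open>J\<close> is the frame of \<open>I\<close> obtained from it by
  deleting homological degree \<open>0\<close>.\<close>

locale ideal_frame =
  fixes I :: "('n::finite, 'k::field) mpoly set" and K :: "nat \<Rightarrow> nat" and deg :: "nat \<times> nat \<Rightarrow> 'n expo"
    and c :: "nat \<times> nat \<Rightarrow> (nat \<times> nat) \<Rightarrow>\<^sub>0 'k"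
  assumes I: "monomial_ideal I" and fr: "frame (SIGMA i:UNIV. {..<K i}) fst deg c"
    and K0: "K 0 = 1" and deg0: "deg (0, 0) = 0"
    and exact: "frame.exact (SIGMA i:UNIV. {..<K i}) fst deg c"
    and bd0: "\<And>b. frame.boundaries (SIGMA i:UNIV. {..<K i}) fst deg c 0 b
      = {u. keys u \<subseteq> {(0, 0)} \<and> (u \<noteq> 0 \<longrightarrow> b \<in> expos I)}"
    and strict: "\<And>i j y. j < K (Suc (Suc i)) \<Longrightarrow> y \<in> keys (c (Suc (Suc i), j)) \<Longrightarrow> deg y \<noteq> deg (Suc (Suc i), j)"
begin

sublocale F: frame "SIGMA i:UNIV. {..<K i}" fst deg c by (rule fr)

definition XI :: "(nat \<times> nat) set" where
  "XI = {x \<in> (SIGMA i:UNIV. {..<K i}). fst x \<noteq> 0}"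

definition hI :: "nat \<times> nat \<Rightarrow> nat" where
  "hI = (\<lambda>x. fst x - 1)"

definition cI :: "nat \<times> nat \<Rightarrow> (nat \<times> nat) \<Rightarrow>\<^sub>0 'k" where
  "cI = (\<lambda>x. if fst x \<le> 1 then 0 else c x)"

lemmas J_frame = F.shift_frame[folded XI_def hI_def cI_def]

sublocale J: frame XI hI deg cI by (rule J_frame)

lemmas J_level_shift = F.shift_level[folded XI_def hI_def]
lemmas J_below_shift = F.shift_below[folded XI_def hI_def]
lemmas J_boundaries_shift = F.shift_boundaries[folded XI_def hI_def cI_def]

lemma J_belowD: "x \<in> J.below i b \<Longrightarrow> x \<in> J.level i \<and> mle (deg x) b"
  by (simp add: J.below_def J.level_def)

text \<open>The label \<open>x\<close> of homological degree \<open>0\<close> in \<open>J\<close> stands for the generator \<open>lam x\<close> times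
  \<open>x^(deg x)\<close> of \<open>I\<close>.\<close>

definition lam :: "nat \<times> nat \<Rightarrow> 'k" where "lam x = lookup (c x) (0, 0)"

lemma J_exact: J.exact by (rule F.shift_exact[OF exact, folded XI_def hI_def cI_def])

lemma J_level: "J.level i = Pair (Suc i) ` {..<K (Suc i)}"
  unfolding J_level_shift by (auto simp: F.level_def)

lemma J_minimal: J.minimal
  unfolding J.minimal_def
proof (intro ballI)
  fix x y assume x: "x \<in> XI" and y: "y \<in> keys (cI x)"
  then obtain i j where ij: "x = (Suc (Suc i), j)" "j < K (Suc (Suc i))"
    by (cases x; cases "fst x"; cases "fst x - 1") (auto simp: XI_def cI_def split: if_splits)
  then show "deg y \<noteq> deg x" using strict[of j i y] y by (simp add: cI_def)
qed

lemma below_zero: "F.below 0 b = {(0, 0)}"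
  using K0 deg0 by (auto simp: F.below_def)

lemma pairing_lam: "pairing lam u = lookup (lin_ext c u) (0, 0)"
  by (simp add: pairing_sum lookup_lin_ext lam_def)

text \<open>The components of \<open>I\<close> and of \<open>S/I\<close> have dimension at most one, so boundaries in homological
  degree \<open>0\<close> are the kernel of a single functional, as \<open>product_boundaries\<close> requires.\<close>

lemma pairing_J:
  assumes "keys u \<subseteq> J.below 0 b" shows "pairing lam u = 0 \<longleftrightarrow> u \<in> J.boundaries 0 b"
proof -
  have u: "keys u \<subseteq> F.below (Suc 0) b" using assms by (simp only: J_below_shift)
  have "keys (lin_ext c u) \<subseteq> {(0, 0)}" using F.keys_bd[OF u] by (simp only: below_zero)
  then have "lin_ext c u = 0 \<longleftrightarrow> lookup (lin_ext c u) (0, 0) = 0"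
    by (auto simp: poly_mapping_eq_iff fun_eq_iff in_keys_iff subset_iff)
  then show ?thesis using exact u by (simp add: J_boundaries_shift F.exact_def pairing_lam)
qed

lemma pairing_F:
  assumes "keys u \<subseteq> F.below 0 b"
  shows "pairing (\<lambda>_. if b \<in> expos I then 0 else 1) u = 0 \<longleftrightarrow> u \<in> F.boundaries 0 b"
proof -
  have k: "keys u \<subseteq> {(0, 0)}" using assms by (simp only: below_zero)
  have "pairing (\<lambda>_. if b \<in> expos I then 0 else 1) u = (if b \<in> expos I then 0 else lookup u (0, 0))"
    unfolding pairing_sum using k
    by (subst sum.mono_neutral_left[of "{(0, 0)}" "keys u"]) (auto simp: in_keys_iff)
  moreover have "u = 0 \<longleftrightarrow> lookup u (0, 0) = 0"
    using k by (auto simp: poly_mapping_eq_iff fun_eq_iff in_keys_iff subset_iff)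
  ultimately show ?thesis using k by (simp add: bd0)
qed

lemma lam_expos:
  assumes x: "x \<in> J.level 0" and nz: "lam x \<noteq> 0" shows "deg x \<in> expos I"
proof -
  have "c x \<in> F.boundaries 0 (deg x)"
    unfolding F.boundaries_def using x J_level
    by (intro image_eqI[of _ _ "single x 1"]) (auto simp: F.below_def)
  moreover have "c x \<noteq> 0" using nz by (auto simp: lam_def)
  ultimately show ?thesis by (simp add: bd0)
qed

lemma ex_lam:
  assumes "b \<in> expos I" shows "\<exists>p\<in>J.below 0 b. lam p \<noteq> 0"
proof -
  have "single (0, 0) 1 \<in> F.boundaries 0 b" using assms by (simp add: bd0)
  then obtain w where w: "keys w \<subseteq> F.below (Suc 0) b" "single (0, 0) 1 = lin_ext c w"
    unfolding F.boundaries_def by blast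
  have "pairing lam w = 1" unfolding pairing_lam w(2)[symmetric] by simp
  then have "(\<Sum>x\<in>keys w. lookup w x * lam x) \<noteq> 0" by (simp add: pairing_sum)
  then obtain p where "p \<in> keys w" "lookup w p * lam p \<noteq> 0" by (rule sum.not_neutral_contains_not_neutral)
  then show ?thesis using w(1) unfolding J_below_shift by auto
qed

definition mI :: "nat \<times> nat \<Rightarrow> ('n, 'k) mpoly" where "mI x = single (deg x) (lam x)"

lemma I_submodule: "submodule I poly_ring poly_module"
proof -
  have "submodule (S.supported (expos I)) poly_ring (poly_module :: (('n, 'k) mpoly, _) module)"
    by (rule S.supported_submodule) (rule expos_up[OF I])
  then show ?thesis using monomial_ideal_supported[OF I] by simp
qed

lemma mI_grading: "mI x \<in> poly_grading (deg x)"
  by (simp add: mI_def poly_grading_def)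

lemma mI_ideal: "x \<in> J.level 0 \<Longrightarrow> mI x \<in> I"
  using lam_expos[of x] by (subst monomial_ideal_iff_keys[OF I]) (auto simp: mI_def)

lemma mI_component:
  assumes "keys u \<subseteq> J.below 0 b"
  shows "lin_ext_to poly_module mI (homogenize deg b u) = single b (pairing lam u)"
proof -
  have "lin_ext_to poly_module mI (homogenize deg b u) = (\<Sum>x\<in>keys u. single (b - deg x) (lookup u x) * mI x)"
    unfolding lin_ext_to_def by (simp add: finsum_poly_module)
  also have "\<dots> = (\<Sum>x\<in>keys u. single b (lookup u x * lam x))"
  proof (intro sum.cong refl)
    fix x assume "x \<in> keys u"
    then have "mle (deg x) b" using assms J_belowD[of x 0 b] by blast
    then show "single (b - deg x) (lookup u x) * mI x = single b (lookup u x * lam x)"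
      by (simp add: mI_def mult_single)
  qed
  also have "\<dots> = single b (pairing lam u)"
    unfolding pairing_sum by (rule poly_mapping_eqI) (auto simp: lookup_sum lookup_single when_def)
  finally show ?thesis .
qed

lemma ideal_resolution:
  "resolution poly_ring (\<lambda>i. free_module (J.level i)) (\<lambda>_. J.diff) (lin_ext_to poly_module mI)
    (poly_module\<lparr>carrier := I\<rparr>)"
proof (rule S.frame_resolution_submodule[OF J_frame J_exact I_submodule])
  let ?Im = "lin_ext_to poly_module mI ` {v. keys v \<subseteq> J.level 0}"
  have Im: "submodule ?Im poly_ring poly_module"
    by (rule S.eps_image_submodule[of _ _ deg]) (rule mI_grading)
  show "I \<subseteq> ?Im"
  proof
    fix f assume f: "f \<in> I"
    show "f \<in> ?Im"
    proof (rule S.carrier_decompose_in_submodule[OF Im])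
      fix b assume "S.mcomp f b \<noteq> \<zero>\<^bsub>poly_module\<^esub>"
      then have "b \<in> keys f" by (auto simp: S_mcomp in_keys_iff)
      then have "b \<in> expos I" using f monomial_ideal_iff_keys[OF I] by blast
      then obtain p where p: "p \<in> J.below 0 b" "lam p \<noteq> 0" using ex_lam by blast
      let ?u = "single p (lookup f b / lam p)"
      have k: "keys ?u \<subseteq> J.below 0 b" using p(1) by simp
      have "pairing lam ?u = lookup f b" using p(2) by (simp add: pairing_sum)
      then have "S.mcomp f b = lin_ext_to poly_module mI (homogenize deg b ?u)"
        by (simp add: mI_component[OF k] S_mcomp)
      moreover have "keys (homogenize deg b ?u) \<subseteq> J.level 0"
        using k J_belowD by (auto simp: subset_iff)
      ultimately show "S.mcomp f b \<in> ?Im" by blast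
    qed simp
  qed
next
  fix b and u :: "(nat \<times> nat) \<Rightarrow>\<^sub>0 'k" assume u: "keys u \<subseteq> J.below 0 b"
  show "lin_ext_to poly_module mI (homogenize deg b u) = \<zero>\<^bsub>poly_module\<^esub> \<longleftrightarrow> u \<in> J.boundaries 0 b"
    by (simp only: mI_component[OF u] pairing_J[OF u, symmetric] poly_module_simps single_eq_0_iff)
qed (use mI_grading mI_ideal in auto)

lemma ideal_eps_graded:
  "lin_ext_to poly_module mI ` graded_part (J.level 0) (\<lambda>x. total_degree (deg x)) e
    \<subseteq> total_grading (poly_module\<lparr>carrier := I\<rparr>) (induced_grading poly_grading I) e"
  by (rule S.eps_graded[OF _ I_submodule]) (use mI_grading mI_ideal in auto)

lemma ideal_module: "Module.module poly_ring (poly_module\<lparr>carrier := I\<rparr>)"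
  by (rule submodule.submodule_is_module[OF I_submodule S.mod])

lemma ideal_has_minimal_resolution:
  "\<exists>\<beta> d \<epsilon>. minimal_graded_free_resolution (poly_module\<lparr>carrier := I\<rparr>)
    (total_grading (poly_module\<lparr>carrier := I\<rparr>) (induced_grading poly_grading I)) \<beta> d \<epsilon>"
  by (rule frame_list_resolution[OF J_frame J_minimal J_level _ ideal_resolution ideal_eps_graded])
    (simp add: inj_def)

lemma ideal_shifts:
  assumes "x \<in> J.level i"
  shows "total_degree (deg x) \<in> set (resolution_shifts (poly_module\<lparr>carrier := I\<rparr>)
    (total_grading (poly_module\<lparr>carrier := I\<rparr>) (induced_grading poly_grading I)) i)"
  by (rule shifts_of_minimal_resolution(2)[OF ideal_has_minimal_resolution ideal_module
        S.separated_total_grading[OF I_submodule] ideal_resolution,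
        where g = "\<lambda>_ x. total_degree (deg x)", OF ideal_eps_graded J.diff_graded
        J.minimal_diff[OF J_minimal] assms])

end

section \<open>Generators of a product\<close>

lemma contract_single: "contract l (single (x, y) k) = single y (k * l x)"
  by (simp add: contract_def)

lemma contract_add: "contract l (u + v) = contract l u + contract l v"
  by (simp add: contract_def lin_ext_add)

lemma contract_tens: "contract l (tens (single x a) u) = scal (a * l x) u"
proof -
  have "keys u \<subseteq> UNIV" by simp
  then show ?thesis
  proof (induction rule: poly_mapping_add_induct)
    case zero
    show ?case by (simp add: contract_def)
  next
    case (single y k)
    show ?case by (simp add: tens_single contract_single mult_ac)
  next
    case (add u v)
    then show ?case by (simp add: tens_add contract_add scal_add)
  qed
qed

context mgmod
begin

text \<open>The generator of the product that belongs to a pair: the multiple of the generator of \<open>M\<close> in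
  the degree of the pair, scaled by the coefficient of the generator of the first factor.\<close>

definition prod_gen :: "('x \<Rightarrow> 'n expo) \<Rightarrow> ('x \<Rightarrow> 'k) \<Rightarrow> ('y \<Rightarrow> 'n expo) \<Rightarrow> ('y \<Rightarrow> 'm) \<Rightarrow> 'x \<times> 'y \<Rightarrow> 'm" where
  "prod_gen d l d' m p = single (mlcm (d (fst p)) (d' (snd p)) - d' (snd p)) (l (fst p)) \<odot>\<^bsub>M\<^esub> m (snd p)"

lemma prod_gen_grading:
  assumes "m (snd p) \<in> G (d' (snd p))" shows "prod_gen d l d' m p \<in> G (prod_deg d d' p)"
proof -
  have "mle (d' (snd p)) (mlcm (d (fst p)) (d' (snd p)))" by (rule mlcm_ge)
  then show ?thesis
    using G_smult[OF assms, of "mlcm (d (fst p)) (d' (snd p)) - d' (snd p)" "l (fst p)"]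
    by (cases p) (simp add: prod_gen_def)
qed

text \<open>In degree \<open>b\<close> the product generators act as \<open>l \<otimes> id\<close> followed by the generators of \<open>M\<close>,
  since the two monomial factors \<open>x^(b - c)\<close> and \<open>x^(c - d)\<close>, with \<open>c\<close> the least common multiple,
  multiply to \<open>x^(b - d)\<close>.\<close>

lemma eps_prod_gen:
  assumes m: "\<And>y. y \<in> Y0 \<Longrightarrow> m y \<in> G (d' y)"
    and z: "keys z \<subseteq> {p. snd p \<in> Y0 \<and> mle (prod_deg d d' p) b}"
  shows "lin_ext_to M (prod_gen d l d' m) (homogenize (prod_deg d d') b z)
    = lin_ext_to M m (homogenize d' b (contract l z))"
  using z
proof (induction rule: poly_mapping_add_induct)
  case zero
  show ?case using eps_zero[of "{}"] by (simp add: contract_def lin_ext_to_def)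
next
  case (single p k)
  obtain x y where p: "p = (x, y)" by fastforce
  have y: "y \<in> Y0" and le: "mle (d x) b" "mle (d' y) b" using single p by auto
  let ?c = "mlcm (d x) (d' y)"
  have my: "m y \<in> carrier M" using m[OF y] G_carrier by blast
  have gp: "prod_gen d l d' m p \<in> carrier M" using prod_gen_grading[of m p d' d l] m[OF y] G_carrier p by auto
  have deg: "(b - ?c) + (?c - d' y) = b - d' y"
  proof (rule poly_mapping_eqI)
    fix i
    have "lookup (d x) i \<le> lookup b i" "lookup (d' y) i \<le> lookup b i" using le by (simp_all add: mle_def)
    then show "lookup ((b - ?c) + (?c - d' y)) i = lookup (b - d' y) i"
      by (simp add: lookup_add lookup_minus_nat)
  qed
  have "lin_ext_to M (prod_gen d l d' m) (homogenize (prod_deg d d') b (single p k))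
      = single (b - ?c) k \<odot>\<^bsub>M\<^esub> (single (?c - d' y) (l x) \<odot>\<^bsub>M\<^esub> m y)"
    using lin_ext_to_single[of M "prod_gen d l d' m" p "single (b - ?c) k", OF mod gp]
    by (simp add: homogenize_single p prod_gen_def)
  also have "\<dots> = single (b - d' y) (k * l x) \<odot>\<^bsub>M\<^esub> m y"
    using M.smult_assoc1[of "single (b - ?c) k" "single (?c - d' y) (l x)" "m y"] my
    by (simp add: mult_single deg)
  also have "\<dots> = lin_ext_to M m (homogenize d' b (contract l (single p k)))"
    using lin_ext_to_single[of M m y "single (b - d' y) (k * l x)", OF mod my]
    by (simp add: homogenize_single p contract_single)
  finally show ?case .
next
  case (add u v)
  let ?Z = "{p. snd p \<in> Y0}"
  have k: "keys u \<subseteq> ?Z" "keys v \<subseteq> ?Z" using add(1,2) by auto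
  have kc: "keys (contract l w) \<subseteq> Y0" if "keys w \<subseteq> ?Z" for w
    unfolding contract_def using that by (rule keys_lin_ext_subset) (auto split: if_splits)
  have mp: "\<And>p. p \<in> ?Z \<Longrightarrow> prod_gen d l d' m p \<in> G (prod_deg d d' p)"
    by (intro prod_gen_grading m) simp
  have 1: "lin_ext_to M (prod_gen d l d' m) (homogenize (prod_deg d d') b (u + v)) =
    lin_ext_to M (prod_gen d l d' m) (homogenize (prod_deg d d') b u) \<oplus>\<^bsub>M\<^esub>
    lin_ext_to M (prod_gen d l d' m) (homogenize (prod_deg d d') b v)"
    unfolding homogenize_add by (rule eps_add[of ?Z _ "prod_deg d d'"]) (use mp k in auto)
  have 2: "lin_ext_to M m (homogenize d' b (contract l (u + v))) =
    lin_ext_to M m (homogenize d' b (contract l u)) \<oplus>\<^bsub>M\<^esub> lin_ext_to M m (homogenize d' b (contract l v))"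
    unfolding contract_add homogenize_add by (rule eps_add[of Y0 _ d']) (use m kc[OF k(1)] kc[OF k(2)] in auto)
  show ?case unfolding 1 2 add(3,4) ..
qed

end

section \<open>Quotients\<close>

lemma (in mgmod) quotient_map:
  assumes N: "submodule N poly_ring M"
  defines "q \<equiv> \<lambda>x. N +>\<^bsub>M\<^esub> x"
  shows "q \<in> linear_maps poly_ring M (quotient_module M N)"
    and "carrier (quotient_module M N) = q ` carrier M"
    and "x \<in> carrier M \<Longrightarrow> q x = \<zero>\<^bsub>quotient_module M N\<^esub> \<longleftrightarrow> x \<in> N"
proof -
  have sg: "subgroup N (add_monoid M)" by (rule submodule.axioms(1)[OF N])
  have as: "abelian_subgroup N M"
    by (rule abelian_subgroupI3[OF additive_subgroup.intro[OF sg] M.abelian_group_axioms])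
  have NM: "N \<subseteq> carrier M" by (rule M.submoduleE(1)[OF N])
  show car: "carrier (quotient_module M N) = q ` carrier M"
    unfolding quotient_module_def q_def A_RCOSETS_def' by auto
  show "x \<in> carrier M \<Longrightarrow> q x = \<zero>\<^bsub>quotient_module M N\<^esub> \<longleftrightarrow> x \<in> N"
    using M.a_coset_join1[of N x] M.a_coset_join2[of x N] sg by (auto simp: quotient_module_def q_def)
  show "q \<in> linear_maps poly_ring M (quotient_module M N)"
  proof (rule linear_mapsI)
    fix x assume "x \<in> carrier M"
    then show "q x \<in> carrier (quotient_module M N)" unfolding car by (rule imageI)
  next
    fix x y assume "x \<in> carrier M" "y \<in> carrier M"
    then show "q (x \<oplus>\<^bsub>M\<^esub> y) = q x \<oplus>\<^bsub>quotient_module M N\<^esub> q y"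
      using abelian_subgroup.a_rcos_sum[OF as, of x y] by (simp add: quotient_module_def q_def)
  next
    fix f x assume x: "x \<in> carrier M"
    have "N +>\<^bsub>M\<^esub> (f \<odot>\<^bsub>M\<^esub> y) = N +>\<^bsub>M\<^esub> (f \<odot>\<^bsub>M\<^esub> x)" if y: "y \<in> N +>\<^bsub>M\<^esub> x" for y
    proof -
      obtain h where h: "h \<in> N" "y = h \<oplus>\<^bsub>M\<^esub> x" using y by (auto simp: a_r_coset_def')
      then have "f \<odot>\<^bsub>M\<^esub> y = f \<odot>\<^bsub>M\<^esub> h \<oplus>\<^bsub>M\<^esub> f \<odot>\<^bsub>M\<^esub> x"
        using M.smult_r_distr[of f h x] x NM by auto
      moreover have "f \<odot>\<^bsub>M\<^esub> h \<in> N" using M.submoduleE(4)[OF N, of f h] h(1) by simp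
      ultimately have "f \<odot>\<^bsub>M\<^esub> y \<in> N +>\<^bsub>M\<^esub> (f \<odot>\<^bsub>M\<^esub> x)" by (auto simp: a_r_coset_def')
      then show ?thesis using M.a_repr_independence[of "f \<odot>\<^bsub>M\<^esub> y" N "f \<odot>\<^bsub>M\<^esub> x"] x sg by simp
    qed
    moreover have "x \<in> N +>\<^bsub>M\<^esub> x"
      using x subgroup.one_closed[OF sg] by (auto simp: a_r_coset_def' intro!: bexI[of _ "\<zero>\<^bsub>M\<^esub>"])
    ultimately have "(\<Union>y\<in>N +>\<^bsub>M\<^esub> x. N +>\<^bsub>M\<^esub> (f \<odot>\<^bsub>M\<^esub> y)) = N +>\<^bsub>M\<^esub> (f \<odot>\<^bsub>M\<^esub> x)"
      by blast
    then show "q (f \<odot>\<^bsub>M\<^esub> x) = f \<odot>\<^bsub>quotient_module M N\<^esub> q x" by (simp add: quotient_module_def q_def)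
  qed
qed

section \<open>Projective dimension\<close>

lemma free_module_projective:
  "projective_module (free_module X :: (('n, 'k::field) mpoly, 'x \<Rightarrow>\<^sub>0 ('n, 'k) mpoly) module)"
  unfolding projective_module_def
proof (intro conjI exI ballI)
  \<comment> \<open>The basis of the covering free module has to lie in the module itself, so the basis vectors serve as labels.\<close>
  let ?b = "\<lambda>x. single x (1 :: ('n, 'k) mpoly)"
  let ?s = "lin_ext (\<lambda>x. single (?b x) 1) :: ('x \<Rightarrow>\<^sub>0 ('n, 'k) mpoly) \<Rightarrow> _"
  let ?r = "lin_ext (\<lambda>b. b) :: (('x \<Rightarrow>\<^sub>0 ('n, 'k) mpoly) \<Rightarrow>\<^sub>0 ('n, 'k) mpoly) \<Rightarrow> _"
  show "Module.module poly_ring (free_module X :: (('n, 'k) mpoly, _) module)" by (rule free_module_is_module)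
  show "?s \<in> linear_maps poly_ring (free_module X) (free_module (?b ` X))" by (rule lin_ext_linear) auto
  show "?r \<in> linear_maps poly_ring (free_module (?b ` X)) (free_module X)" by (rule lin_ext_linear) auto
  fix v
  have "?r (?s v) = lin_ext ?b v"
    unfolding lin_ext_def[of "\<lambda>x. single (?b x) 1"] lin_ext_def[of ?b] by (simp add: lin_ext_sum)
  also have "\<dots> = v" unfolding lin_ext_def using poly_mapping_sum_singles[of "keys v" v] by simp
  finally show "?r (?s v) = v" .
qed

lemma free_resolution_length:
  fixes X :: "nat \<Rightarrow> 'x set" and L :: "(('n, 'k::field) mpoly, 'a) module" and g :: "nat \<Rightarrow> 'x"
  assumes F: "resolution poly_ring (\<lambda>i. free_module (X i)) d \<epsilon> L" and g: "inj g" "range g = UNIV"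
    and empty: "\<And>i. i > p \<Longrightarrow> X i = {}"
  shows "has_projective_resolution_of_length L p"
proof -
  have "resolution poly_ring (\<lambda>i. free_module (g -` X i))
    (\<lambda>i v. pull_labels g (d i (push_labels g v))) (\<lambda>v. \<epsilon> (push_labels g v)) L"
    by (rule resolution_relabel[OF F, of "\<lambda>_. g"]) (use g in auto)
  moreover have "projective_module (free_module (g -` X i) :: (('n, 'k) mpoly, nat \<Rightarrow>\<^sub>0 ('n, 'k) mpoly) module)" for i
    by (rule free_module_projective)
  moreover have "carrier (free_module (g -` X i) :: (('n, 'k) mpoly, nat \<Rightarrow>\<^sub>0 ('n, 'k) mpoly) module)
      = {\<zero>\<^bsub>(free_module (g -` X i) :: (('n, 'k) mpoly, nat \<Rightarrow>\<^sub>0 ('n, 'k) mpoly) module)\<^esub>}" if "i > p" for i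
    using empty[OF that] by simp
  ultimately show ?thesis
    unfolding has_projective_resolution_of_length_def
    by (intro exI[of _ "\<lambda>i. free_module (g -` X i)"] exI[of _ "\<lambda>i v. pull_labels g (d i (push_labels g v))"]
        exI[of _ "\<lambda>v. \<epsilon> (push_labels g v)"] conjI allI impI)
qed

lemma minimal_resolution_empty:
  fixes X :: "nat \<Rightarrow> 'x set" and L :: "(('n,'k::field) mpoly, 'a) module"
  assumes F: "resolution poly_ring (\<lambda>i. free_module (X i)) d \<epsilon> L"
    and L: "Module.module poly_ring L" and minimal: "minimal_differentials X d"
    and p: "has_projective_resolution_of_length L p" and i: "i > p"
  shows "X i = {}"
proof -
  obtain P :: "nat \<Rightarrow> (('n, 'k) mpoly, nat \<Rightarrow>\<^sub>0 ('n, 'k) mpoly) module" and d' \<epsilon>' where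
    P: "resolution poly_ring P d' \<epsilon>' L" "\<forall>i. projective_module (P i)" "\<forall>i>p. carrier (P i) = {\<zero>\<^bsub>P i\<^esub>}"
    using p unfolding has_projective_resolution_of_length_def by (elim exE conjE)
  show ?thesis
    by (rule minimal_resolution_length[OF F L minimal P(1) P(2)[rule_format] P(3)[rule_format, OF i]])
qed

lemma minimal_resolution_zero_module:
  fixes X :: "nat \<Rightarrow> 'x set" and L :: "(('n,'k::field) mpoly, 'a) module"
  assumes F: "resolution poly_ring (\<lambda>i. free_module (X i)) d \<epsilon> L"
    and L: "Module.module poly_ring L" and minimal: "minimal_differentials X d"
    and zero: "carrier L = {\<zero>\<^bsub>L\<^esub>}"
  shows "X i = {}"
proof -
  interpret L: Module.module poly_ring L by (rule L)
  let ?P = "\<lambda>i :: nat. free_module {} :: (('n, 'k) mpoly, nat \<Rightarrow>\<^sub>0 ('n, 'k) mpoly) module"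
  have "resolution poly_ring ?P (\<lambda>_ _. 0) (\<lambda>_. \<zero>\<^bsub>L\<^esub>) L"
    by (rule resolutionI) (auto simp: free_module_is_module zero linear_maps_def)
  then show ?thesis
    by (rule minimal_resolution_length[OF F L minimal _ free_module_projective]) simp
qed

lemma proj_dim_ge: "- 1 \<le> proj_dim L"
proof -
  have "(- 1 :: ereal) \<le> Inf {ereal (real p) |p. has_projective_resolution_of_length L p}"
    by (rule Inf_greatest) (auto intro: order_trans[of _ "0 :: ereal"])
  then show ?thesis by (simp add: proj_dim_def)
qed

lemma proj_dim_le:
  "has_projective_resolution_of_length L p \<Longrightarrow> proj_dim L \<le> ereal (real p)"
proof -
  assume "has_projective_resolution_of_length L p"
  then have "Inf {ereal (real p) |p. has_projective_resolution_of_length L p} \<le> ereal (real p)"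
    by (intro Inf_lower) blast
  moreover have "(- 1 :: ereal) \<le> ereal (real p)" by (rule order_trans[of _ 0]) auto
  ultimately show ?thesis by (simp add: proj_dim_def)
qed

lemma proj_dim_attained:
  assumes "carrier L \<noteq> {\<zero>\<^bsub>L\<^esub>}" "proj_dim L \<noteq> \<infinity>"
  shows "\<exists>p. has_projective_resolution_of_length L p \<and> proj_dim L = ereal (real p)"
proof -
  let ?H = "has_projective_resolution_of_length L"
  have eq: "proj_dim L = Inf {ereal (real p) |p. ?H p}" using assms(1) by (simp add: proj_dim_def)
  have "\<exists>p. ?H p"
  proof (rule ccontr)
    assume "\<nexists>p. ?H p"
    then have "{ereal (real p) |p. ?H p} = {}" by blast
    then show False using eq assms(2) by (simp add: top_ereal_def)
  qed
  then have H: "?H (LEAST p. ?H p)" by (rule LeastI_ex)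
  moreover have "ereal (real (LEAST p. ?H p)) \<le> proj_dim L"
    unfolding eq by (rule Inf_greatest) (auto intro: Least_le)
  ultimately show ?thesis using proj_dim_le[OF H] by (intro exI[of _ "LEAST p. ?H p"]) auto
qed

section \<open>Regularity\<close>

lemma regularity_le:
  assumes "\<And>i b. b \<in> set (resolution_shifts L (total_grading L G) i) \<Longrightarrow> ereal (real b) \<le> R + ereal (real i)"
  shows "regularity L G \<le> R"
  unfolding regularity_def highest_shift_def
proof (rule SUP_least)
  fix i :: nat
  have "(SUP b\<in>set (resolution_shifts L (total_grading L G) i). ereal (real b)) \<le> R + ereal (real i)"
    using assms by (intro SUP_least)
  then show "(SUP b\<in>set (resolution_shifts L (total_grading L G) i). ereal (real b)) - ereal (real i) \<le> R"
    by (simp add: ereal_minus_le)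
qed

lemma regularity_ge:
  assumes "b \<in> set (resolution_shifts L (total_grading L G) i)"
  shows "ereal (real b) - ereal (real i) \<le> regularity L G"
proof -
  have "ereal (real b) - ereal (real i) \<le> highest_shift L (total_grading L G) i - ereal (real i)"
    unfolding highest_shift_def using assms by (intro ereal_minus_mono SUP_upper) auto
  also have "\<dots> \<le> regularity L G" unfolding regularity_def by (rule SUP_upper) simp
  finally show ?thesis .
qed

section \<open>The resolutions of \<open>IM\<close> and \<open>M/IM\<close>\<close>

lemma (in mgmod) submodule_has_minimal_resolution:
  assumes N: "submodule N poly_ring M" and hom: "\<forall>x\<in>N. \<forall>a. mcomp x a \<in> N"
    and A: "finite A" "A \<subseteq> N" "N \<subseteq> module_span poly_ring M A"
  shows "\<exists>\<beta> d \<epsilon>. minimal_graded_free_resolution (M\<lparr>carrier := N\<rparr>)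
    (total_grading (M\<lparr>carrier := N\<rparr>) (induced_grading G N)) \<beta> d \<epsilon>"
proof -
  obtain K and deg :: "nat \<times> nat \<Rightarrow> 'n expo" and c m where
    fr: "frame (SIGMA i:UNIV. {..<K i}) fst deg c" and ex: "frame.exact (SIGMA i:UNIV. {..<K i}) fst deg c"
    and min: "frame.minimal (SIGMA i:UNIV. {..<K i}) deg c"
    and m: "\<forall>x\<in>Pair 0 ` {..<K 0}. m x \<in> G (deg x) \<and> m x \<in> N"
    and surj: "N \<subseteq> lin_ext_to M m ` {v. keys v \<subseteq> Pair 0 ` {..<K 0}}"
    and bd: "\<forall>b u. keys u \<subseteq> frame.below (SIGMA i:UNIV. {..<K i}) fst deg 0 b \<longrightarrow>
      (lin_ext_to M m (homogenize deg b u) = \<zero>\<^bsub>M\<^esub> \<longleftrightarrow>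
        u \<in> frame.boundaries (SIGMA i:UNIV. {..<K i}) fst deg c 0 b)"
    using submodule_minimal_frame[OF N hom A] by (elim exE conjE)
  note lev = level_labels[OF fr]
  have mG: "\<And>x. x \<in> frame.level (SIGMA i:UNIV. {..<K i}) fst 0 \<Longrightarrow> m x \<in> G (deg x)"
    and mN: "\<And>x. x \<in> frame.level (SIGMA i:UNIV. {..<K i}) fst 0 \<Longrightarrow> m x \<in> N"
    using m by (simp_all only: lev)
  have res: "resolution poly_ring (\<lambda>i. free_module (frame.level (SIGMA i:UNIV. {..<K i}) fst i))
    (\<lambda>_. frame.diff deg c) (lin_ext_to M m) (M\<lparr>carrier := N\<rparr>)"
    by (rule frame_resolution_submodule[OF fr ex N mG mN surj[folded lev] bd[rule_format]])
  show ?thesis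
    by (rule frame_list_resolution[OF fr min lev _ res eps_graded[OF mG N mN]]) (simp add: inj_def)
qed

text \<open>The frame of \<open>I\<close> together with a minimal frame of \<open>M\<close>, whose generators are \<open>m\<close>. In the
  sublocale \<open>JP\<close> the frame of \<open>M\<close> is multiplied with the frame of \<open>I\<close>, and in \<open>FP\<close> with that of
  \<open>S/I\<close>.\<close>

locale ideal_module = A: ideal_frame I K deg c + mgmod M G
  for I :: "('n::finite, 'k::field) mpoly set" and K and deg :: "nat \<times> nat \<Rightarrow> 'n expo" and c
    and M :: "(('n, 'k) mpoly, 'm) module" and G +
  fixes K2 :: "nat \<Rightarrow> nat" and deg2 :: "nat \<times> nat \<Rightarrow> 'n expo" and c2 :: "nat \<times> nat \<Rightarrow> (nat \<times> nat) \<Rightarrow>\<^sub>0 'k"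
    and m :: "nat \<times> nat \<Rightarrow> 'm"
  assumes fr2: "frame (SIGMA i:UNIV. {..<K2 i}) fst deg2 c2"
    and exact2: "frame.exact (SIGMA i:UNIV. {..<K2 i}) fst deg2 c2"
    and minimal2: "frame.minimal (SIGMA i:UNIV. {..<K2 i}) deg2 c2"
    and m2: "\<And>x. x \<in> frame.level (SIGMA i:UNIV. {..<K2 i}) fst 0 \<Longrightarrow> m x \<in> G (deg2 x)"
    and surj2: "carrier M \<subseteq> lin_ext_to M m ` {v. keys v \<subseteq> frame.level (SIGMA i:UNIV. {..<K2 i}) fst 0}"
    and bd2: "\<And>b u. keys u \<subseteq> frame.below (SIGMA i:UNIV. {..<K2 i}) fst deg2 0 b \<Longrightarrow>
      lin_ext_to M m (homogenize deg2 b u) = \<zero>\<^bsub>M\<^esub> \<longleftrightarrow>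
        u \<in> frame.boundaries (SIGMA i:UNIV. {..<K2 i}) fst deg2 c2 0 b"
    and IM: "ideal_smult poly_ring I M = supported (expos I)"
begin

sublocale G2: frame "SIGMA i:UNIV. {..<K2 i}" fst deg2 c2 by (rule fr2)
sublocale JP: frame_pair A.XI A.hI deg A.cI "SIGMA i:UNIV. {..<K2 i}" fst deg2 c2
  by (intro frame_pair.intro A.J_frame fr2)
sublocale FP: frame_pair "SIGMA i:UNIV. {..<K i}" fst deg c "SIGMA i:UNIV. {..<K2 i}" fst deg2 c2
  by (intro frame_pair.intro A.fr fr2)

abbreviation "N \<equiv> supported (expos I)"
abbreviation "L \<equiv> M\<lparr>carrier := N\<rparr>"

lemma up: "a \<in> expos I \<Longrightarrow> mle a b \<Longrightarrow> b \<in> expos I"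
  by (rule expos_up[OF A.I])

lemma N_submodule: "submodule N poly_ring M"
  by (rule supported_submodule) (rule up)

lemma M_carrier_submodule: "M\<lparr>carrier := carrier M\<rparr> = M" "induced_grading G (carrier M) = G"
  using G_carrier by (auto simp: induced_grading_def fun_eq_iff)

lemma m_in_carrier: "x \<in> G2.level 0 \<Longrightarrow> m x \<in> carrier M"
  using m2 G_carrier by blast

lemma M_resolution:
  "resolution poly_ring (\<lambda>i. free_module (G2.level i)) (\<lambda>_. G2.diff) (lin_ext_to M m) M"
  using frame_resolution_submodule[OF fr2 exact2 M.carrier_is_submodule m2 m_in_carrier surj2 bd2]
  by (simp only: M_carrier_submodule)

lemma M_eps_graded:
  "lin_ext_to M m ` graded_part (G2.level 0) (\<lambda>x. total_degree (deg2 x)) e \<subseteq> total_grading M G e"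
  using eps_graded[OF m2 M.carrier_is_submodule m_in_carrier, where e = e]
  by (simp only: M_carrier_submodule)

lemma M_shifts:
  assumes "x \<in> G2.level i"
  shows "total_degree (deg2 x) \<in> set (resolution_shifts M (total_grading M G) i)"
proof -
  have ex: "\<exists>\<beta> d \<epsilon>. minimal_graded_free_resolution M (total_grading M G) \<beta> d \<epsilon>"
    by (rule frame_list_resolution[OF fr2 minimal2 level_labels[OF fr2] _ M_resolution M_eps_graded])
      (simp add: inj_def)
  have sep: "separated M (total_grading M G)"
    using separated_total_grading[OF M.carrier_is_submodule] by (simp only: M_carrier_submodule)
  show ?thesis
    by (rule shifts_of_minimal_resolution(2)[OF ex mod sep M_resolution,
        where g = "\<lambda>_ x. total_degree (deg2 x)", OF M_eps_graded G2.diff_graded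
        G2.minimal_diff[OF minimal2] assms])
qed

lemma G2_empty: "has_projective_resolution_of_length M p \<Longrightarrow> i > p \<Longrightarrow> G2.level i = {}"
  by (rule minimal_resolution_empty[OF M_resolution mod G2.minimal_diff[OF minimal2]])

lemma prod_gen_level:
  assumes "snd p \<in> G2.level 0" shows "prod_gen d l deg2 m p \<in> G (prod_deg d deg2 p)"
  by (rule prod_gen_grading) (rule m2[OF assms])

subsection \<open>The resolution of \<open>IM\<close>\<close>

abbreviation "mJ \<equiv> prod_gen deg A.lam deg2 m"

lemma JP_level0: "p \<in> JP.P.level 0 \<Longrightarrow> fst p \<in> A.J.level 0 \<and> snd p \<in> G2.level 0"
  by (simp add: JP.level_prod)

lemma JP_below0: "p \<in> JP.P.below 0 b \<Longrightarrow>
    fst p \<in> A.J.below 0 b \<and> snd p \<in> G2.below 0 b \<and> p \<in> JP.P.level 0 \<and> mle (prod_deg deg deg2 p) b"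
  using JP.below_prod[of p 0 b] by (simp add: JP.P.below_def JP.P.level_def)

lemma G2_belowD: "x \<in> G2.below i b \<Longrightarrow> x \<in> G2.level i \<and> mle (deg2 x) b"
  by (simp add: G2.below_def G2.level_def)

lemma mJ_grading: "p \<in> JP.P.level 0 \<Longrightarrow> mJ p \<in> G (prod_deg deg deg2 p)"
  using JP_level0 by (intro prod_gen_level) blast

lemma mJ_N:
  assumes p: "p \<in> JP.P.level 0" shows "mJ p \<in> N"
proof -
  have g: "mJ p \<in> G (prod_deg deg deg2 p)" by (rule mJ_grading[OF p])
  have "prod_deg deg deg2 p \<in> expos I" if "mJ p \<noteq> \<zero>\<^bsub>M\<^esub>"
  proof -
    have "m (snd p) \<in> carrier M" using JP_level0[OF p] m2 G_carrier by blast
    then have "A.lam (fst p) \<noteq> 0" using that M.smult_l_null by (auto simp: prod_gen_def)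
    then have "deg (fst p) \<in> expos I" using A.lam_expos JP_level0[OF p] by blast
    then show ?thesis by (rule up) (cases p, simp add: mlcm_ge)
  qed
  then have "mcomp (mJ p) b = \<zero>\<^bsub>M\<^esub>" if "b \<notin> expos I" for b
    using that by (auto simp: mcomp_homogeneous[OF g])
  then show ?thesis using G_carrier[OF g] by (simp add: supported_def)
qed

lemma mJ_eps:
  assumes "keys z \<subseteq> JP.P.below 0 b"
  shows "lin_ext_to M mJ (homogenize (prod_deg deg deg2) b z) = lin_ext_to M m (homogenize deg2 b (contract A.lam z))"
proof (rule eps_prod_gen[of "G2.level 0" m deg2, OF m2])
  show "keys z \<subseteq> {p. snd p \<in> G2.level 0 \<and> mle (prod_deg deg deg2 p) b}"
    using assms JP_below0 G2_belowD by blast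
qed

lemma contract_below:
  assumes "\<And>p. p \<in> keys z \<Longrightarrow> snd p \<in> B" shows "keys (contract l z) \<subseteq> B"
  unfolding contract_def
  by (rule keys_lin_ext_subset[of _ "keys z"]) (use assms in \<open>auto split: if_splits\<close>)

lemma JP_image_submodule: "submodule (lin_ext_to M mJ ` {v. keys v \<subseteq> JP.P.level 0}) poly_ring M"
  by (rule eps_image_submodule) (rule mJ_grading)

lemma mJ_surj: "N \<subseteq> lin_ext_to M mJ ` {v. keys v \<subseteq> JP.P.level 0}"
proof
  fix y assume y: "y \<in> N"
  then have yc: "y \<in> carrier M" by (simp add: supported_def)
  show "y \<in> lin_ext_to M mJ ` {v. keys v \<subseteq> JP.P.level 0}"
  proof (rule carrier_decompose_in_submodule[OF JP_image_submodule yc])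
    fix b assume "mcomp y b \<noteq> \<zero>\<^bsub>M\<^esub>"
    then have "b \<in> expos I" using y by (auto simp: supported_def)
    then obtain p where p: "p \<in> A.J.below 0 b" "A.lam p \<noteq> 0" using A.ex_lam by blast
    obtain v where v: "keys v \<subseteq> G2.level 0" "y = lin_ext_to M m v" using surj2 yc by blast
    let ?u = "component deg2 b v"
    have ku: "keys ?u \<subseteq> G2.below 0 b"
      using keys_component[of deg2 b v] v(1) by (auto simp: G2.below_def G2.level_def)
    let ?z = "tens (single p (1 / A.lam p)) ?u"
    have kz: "keys ?z \<subseteq> JP.P.below (0 + 0) b"
      by (rule JP.keys_tens_below[OF _ ku]) (use p in simp)
    have "mcomp y b = lin_ext_to M m (homogenize deg2 b ?u)"
      unfolding v(2) by (rule mcomp_eps[of "G2.level 0" m deg2, OF m2 v(1)])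
    also have "?u = contract A.lam ?z" using p(2) by (simp add: contract_tens)
    also have "lin_ext_to M m (homogenize deg2 b (contract A.lam ?z)) =
        lin_ext_to M mJ (homogenize (prod_deg deg deg2) b ?z)"
      using mJ_eps[of ?z b] kz by simp
    finally have eq: "mcomp y b = lin_ext_to M mJ (homogenize (prod_deg deg deg2) b ?z)" .
    have "keys (homogenize (prod_deg deg deg2) b ?z) \<subseteq> JP.P.level 0"
      unfolding keys_homogenize using kz JP_below0 by auto
    then show "mcomp y b \<in> lin_ext_to M mJ ` {v. keys v \<subseteq> JP.P.level 0}" unfolding eq by blast
  qed
qed

text \<open>By \<open>eps_prod_gen\<close> and \<open>product_boundaries\<close>, \<open>lam \<otimes> id\<close> identifies both the relations of the
  product generators and the boundaries of the product with those of \<open>M\<close>.\<close>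

lemma IM_resolution:
  "resolution poly_ring (\<lambda>i. free_module (JP.P.level i)) (\<lambda>_. JP.P.diff) (lin_ext_to M mJ) L"
proof (rule frame_resolution_submodule[OF JP.P.frame_axioms JP.product_exact[OF A.J_exact exact2]
      N_submodule mJ_grading mJ_N mJ_surj])
  fix b and z :: "((nat \<times> nat) \<times> (nat \<times> nat)) \<Rightarrow>\<^sub>0 'k" assume z: "keys z \<subseteq> JP.P.below 0 b"
  have kc: "keys (contract A.lam z) \<subseteq> G2.below 0 b" using z JP_below0 by (intro contract_below) blast
  have "lin_ext_to M mJ (homogenize (prod_deg deg deg2) b z) = \<zero>\<^bsub>M\<^esub> \<longleftrightarrow> contract A.lam z \<in> G2.boundaries 0 b"
    unfolding mJ_eps[OF z] by (rule bd2[OF kc])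
  also have "\<dots> \<longleftrightarrow> z \<in> JP.P.boundaries 0 b"
    by (rule JP.product_boundaries[OF A.J_exact exact2 A.pairing_J z, symmetric])
  finally show "lin_ext_to M mJ (homogenize (prod_deg deg deg2) b z) = \<zero>\<^bsub>M\<^esub> \<longleftrightarrow> z \<in> JP.P.boundaries 0 b" .
qed

lemma IM_eps_graded:
  "lin_ext_to M mJ ` graded_part (JP.P.level 0) (\<lambda>p. total_degree (prod_deg deg deg2 p)) e
    \<subseteq> total_grading L (induced_grading G N) e"
  by (rule eps_graded[OF mJ_grading N_submodule mJ_N])

text \<open>The product generators show that \<open>IM\<close> is generated by finitely many homogeneous elements.\<close>

lemma IM_has_minimal_resolution:
  "\<exists>\<beta> d \<epsilon>. minimal_graded_free_resolution L (total_grading L (induced_grading G N)) \<beta> d \<epsilon>"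
proof (rule submodule_has_minimal_resolution[OF N_submodule])
  show "\<forall>x\<in>N. \<forall>a. mcomp x a \<in> N"
  proof (intro ballI allI)
    fix x a assume x: "x \<in> N"
    then have "mcomp x a \<in> G a" using mcomp_G by (simp add: supported_def)
    then show "mcomp x a \<in> N" using x G_carrier by (auto simp: supported_def mcomp_homogeneous)
  qed
  have "JP.P.level 0 \<subseteq> A.J.level 0 \<times> G2.level 0" using JP_level0 by (auto simp: mem_Times_iff)
  moreover have "finite (A.J.level 0 \<times> G2.level 0)"
    unfolding A.J_level level_labels[OF fr2] by simp
  ultimately show "finite (mJ ` JP.P.level 0)" by (intro finite_imageI) (rule finite_subset)
  show "mJ ` JP.P.level 0 \<subseteq> N" using mJ_N by blast
  show "N \<subseteq> module_span poly_ring M (mJ ` JP.P.level 0)"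
    unfolding module_span_def
  proof (rule Inter_greatest, elim CollectE conjE)
    fix N' assume N': "submodule N' poly_ring M" "mJ ` JP.P.level 0 \<subseteq> N'"
    have "lin_ext_to M mJ v \<in> N'" if "keys v \<subseteq> JP.P.level 0" for v
      by (rule eps_in_submodule[of "JP.P.level 0" mJ "prod_deg deg deg2", OF mJ_grading N'(1)]) (use N'(2) that in auto)
    then show "N \<subseteq> N'" using mJ_surj by auto
  qed
qed

lemma IM_shifts:
  assumes "b \<in> set (resolution_shifts L (total_grading L (induced_grading G N)) i)"
  shows "\<exists>j k x y. i = j + k \<and> x \<in> A.J.level j \<and> y \<in> G2.level k \<and> b \<le> total_degree (deg x) + total_degree (deg2 y)"
proof -
  have "\<exists>p\<in>JP.P.level i. total_degree (prod_deg deg deg2 p) = b"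
    by (rule shifts_of_minimal_resolution(1)[OF IM_has_minimal_resolution
          submodule.submodule_is_module[OF N_submodule mod] separated_total_grading[OF N_submodule]
          IM_resolution, where g = "\<lambda>_ p. total_degree (prod_deg deg deg2 p)", OF IM_eps_graded JP.P.diff_graded assms])
  then obtain p where p: "p \<in> JP.P.level i" "total_degree (prod_deg deg deg2 p) = b" by blast
  then obtain j k where "i = j + k" "fst p \<in> A.J.level j" "snd p \<in> G2.level k" using JP.level_prod by blast
  moreover have "b \<le> total_degree (deg (fst p)) + total_degree (deg2 (snd p))"
    using p(2) total_degree_mlcm[of "deg (fst p)" "deg2 (snd p)"] by (cases p) simp
  ultimately show ?thesis by blast
qed

text \<open>By \<open>IM_shifts\<close> a shift of \<open>IM\<close> in homological degree \<open>j + k\<close> is at most the sum of a shift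
  of \<open>I\<close> in degree \<open>j\<close> and one of \<open>M\<close> in degree \<open>k\<close>.\<close>

theorem regularity_IM:
  "regularity L (induced_grading G N) \<le>
    regularity (poly_module\<lparr>carrier := I\<rparr>) (induced_grading poly_grading I) + regularity M G"
    (is "_ \<le> ?r1 + ?r2")
proof (rule regularity_le)
  fix i b assume "b \<in> set (resolution_shifts L (total_grading L (induced_grading G N)) i)"
  then obtain j k x y where i: "i = j + k" and x: "x \<in> A.J.level j" and y: "y \<in> G2.level k"
    and b: "b \<le> total_degree (deg x) + total_degree (deg2 y)" using IM_shifts by blast
  let ?x = "total_degree (deg x)" let ?y = "total_degree (deg2 y)"
  have "ereal (real ?x) - ereal (real j) \<le> ?r1" by (rule regularity_ge[OF A.ideal_shifts[OF x]])
  moreover have "ereal (real ?y) - ereal (real k) \<le> ?r2" by (rule regularity_ge[OF M_shifts[OF y]])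
  ultimately have "(ereal (real ?x) - ereal (real j)) + (ereal (real ?y) - ereal (real k)) \<le> ?r1 + ?r2"
    by (rule add_mono)
  then have "(ereal (real ?x) - ereal (real j)) + (ereal (real ?y) - ereal (real k)) + ereal (real i)
      \<le> ?r1 + ?r2 + ereal (real i)" by (rule add_right_mono)
  moreover have "ereal (real b) \<le> (ereal (real ?x) - ereal (real j)) + (ereal (real ?y) - ereal (real k)) + ereal (real i)"
    using b i by simp
  ultimately show "ereal (real b) \<le> ?r1 + ?r2 + ereal (real i)" by (rule order_trans[rotated])
qed

subsection \<open>The resolution of \<open>M/IM\<close>\<close>

abbreviation "mF \<equiv> prod_gen deg (\<lambda>_. 1) deg2 m"

lemma FP_level0: "p \<in> FP.P.level 0 \<Longrightarrow> snd p \<in> G2.level 0"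
  by (simp add: FP.level_prod)

lemma FP_below0: "p \<in> FP.P.below 0 b \<Longrightarrow>
    snd p \<in> G2.below 0 b \<and> p \<in> FP.P.level 0 \<and> mle (prod_deg deg deg2 p) b"
  using FP.below_prod[of p 0 b] by (simp add: FP.P.below_def FP.P.level_def)

lemma mF_grading: "p \<in> FP.P.level 0 \<Longrightarrow> mF p \<in> G (prod_deg deg deg2 p)"
  using FP_level0 by (intro prod_gen_level)

text \<open>In degrees \<open>b\<close> with \<open>x\<^sup>b \<in> I\<close> the quotient is zero, and so is the functional that describes
  the boundaries of \<open>S/I\<close>. In the other degrees the quotient is \<open>M\<^sub>b\<close>, and the functional is \<open>1\<close>
  on the single label.\<close>

lemma quotient_resolution:
  "resolution poly_ring (\<lambda>i. free_module (FP.P.level i)) (\<lambda>_. FP.P.diff)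
    (\<lambda>v. N +>\<^bsub>M\<^esub> lin_ext_to M mF v) (quotient_module M N)"
proof (rule FP.P.frame_resolution[OF FP.product_exact[OF A.exact exact2]])
  note q = quotient_map[OF N_submodule]
  let ?e = "lin_ext_to M mF"
  have lin: "?e \<in> linear_maps poly_ring (free_module (FP.P.level 0)) M"
    by (rule eps_linear) (rule mF_grading)
  show "(\<lambda>v. N +>\<^bsub>M\<^esub> ?e v) \<in> linear_maps poly_ring (free_module (FP.P.level 0)) (quotient_module M N)"
    by (rule linear_maps_comp[OF lin q(1)])
  have "carrier M \<subseteq> ?e ` {v. keys v \<subseteq> FP.P.level 0}"
  proof -
    have "submodule (?e ` {v. keys v \<subseteq> FP.P.level 0}) poly_ring M"
      by (rule eps_image_submodule) (rule mF_grading)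
    moreover have "m y \<in> ?e ` {v. keys v \<subseteq> FP.P.level 0}" if y: "y \<in> G2.level 0" for y
    proof -
      have "(0, 0) \<in> (SIGMA i:UNIV. {..<K i})" using A.K0 by simp
      then have p: "((0, 0), y) \<in> FP.P.level 0"
        using y by (simp add: FP.level_prod A.F.level_def)
      have my: "m y \<in> carrier M" using m2[OF y] G_carrier by blast
      have "mlcm 0 (deg2 y) - deg2 y = 0" by (rule poly_mapping_eqI) (simp add: lookup_minus_nat)
      then have "mF ((0, 0), y) = m y"
        using M.smult_one[OF my] by (simp add: prod_gen_def A.deg0)
      then have "?e (single ((0, 0), y) 1) = m y"
        using lin_ext_to_single[of M mF "((0, 0), y)" 1, OF mod] my M.smult_one[OF my] by simp
      then show ?thesis using p by (intro image_eqI[of _ _ "single ((0, 0), y) 1"]) auto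
    qed
    ultimately have "lin_ext_to M m v \<in> ?e ` {v. keys v \<subseteq> FP.P.level 0}" if "keys v \<subseteq> G2.level 0" for v
      using that by (intro eps_in_submodule[of "G2.level 0" m deg2, OF m2]) auto
    then show ?thesis using surj2 by auto
  qed
  then show "carrier (quotient_module M N) \<subseteq> (\<lambda>v. N +>\<^bsub>M\<^esub> ?e v) ` {v. keys v \<subseteq> FP.P.level 0}"
    unfolding q(2) by auto
  fix v :: "((nat \<times> nat) \<times> (nat \<times> nat)) \<Rightarrow>\<^sub>0 ('n, 'k) mpoly"
  assume v: "keys v \<subseteq> FP.P.level 0"
  have ev: "?e v \<in> carrier M" using linear_mapsD(1)[OF lin, of v] v by simp
  have "N +>\<^bsub>M\<^esub> ?e v = \<zero>\<^bsub>quotient_module M N\<^esub> \<longleftrightarrow> ?e v \<in> N" by (rule q(3)[OF ev])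
  also have "\<dots> \<longleftrightarrow> (\<forall>b. b \<notin> expos I \<longrightarrow> mcomp (?e v) b = \<zero>\<^bsub>M\<^esub>)" using ev by (simp add: supported_def)
  also have "\<dots> \<longleftrightarrow> (\<forall>b. component (prod_deg deg deg2) b v \<in> FP.P.boundaries 0 b)"
  proof (rule all_cong1)
    fix b
    let ?z = "component (prod_deg deg deg2) b v"
    let ?l = "\<lambda>_ :: nat \<times> nat. if b \<in> expos I then 0 else 1 :: 'k"
    have z: "keys ?z \<subseteq> FP.P.below 0 b"
      using keys_component[of "prod_deg deg deg2" b v] v by (auto simp: FP.P.below_def FP.P.level_def)
    have bd: "?z \<in> FP.P.boundaries 0 b \<longleftrightarrow> contract ?l ?z \<in> G2.boundaries 0 b"
      by (rule FP.product_boundaries[OF A.exact exact2 A.pairing_F z])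
    show "(b \<notin> expos I \<longrightarrow> mcomp (?e v) b = \<zero>\<^bsub>M\<^esub>) \<longleftrightarrow> ?z \<in> FP.P.boundaries 0 b"
    proof (cases "b \<in> expos I")
      case True
      then have "contract ?l ?z = lin_ext (\<lambda>_. 0) ?z" unfolding contract_def by (intro lin_ext_eqI[of _ UNIV]) auto
      then have "contract ?l ?z = 0" by (simp add: lin_ext_def)
      moreover have "0 \<in> G2.boundaries 0 b" unfolding G2.boundaries_def by (intro image_eqI[of _ _ 0]) auto
      ultimately show ?thesis using bd True by simp
    next
      case False
      have kc: "keys (contract (\<lambda>_. 1) ?z) \<subseteq> G2.below 0 b" using z FP_below0 by (intro contract_below) blast
      have "mcomp (?e v) b = ?e (homogenize (prod_deg deg deg2) b ?z)"
        by (rule mcomp_eps[of "FP.P.level 0" mF "prod_deg deg deg2", OF mF_grading v])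
      also have "\<dots> = lin_ext_to M m (homogenize deg2 b (contract (\<lambda>_. 1) ?z))"
      proof (rule eps_prod_gen[of "G2.level 0" m deg2, OF m2])
        show "keys ?z \<subseteq> {p. snd p \<in> G2.level 0 \<and> mle (prod_deg deg deg2 p) b}"
          using z FP_below0 G2_belowD by blast
      qed
      finally show ?thesis using bd False bd2[OF kc] by simp
    qed
  qed
  finally show "N +>\<^bsub>M\<^esub> ?e v = \<zero>\<^bsub>quotient_module M N\<^esub> \<longleftrightarrow>
      (\<forall>b. component (prod_deg deg deg2) b v \<in> FP.P.boundaries 0 b)" .
qed

lemma quotient_length:
  assumes p: "has_projective_resolution_of_length M p" and r: "\<And>i. i > r \<Longrightarrow> A.F.level i = {}"
  shows "has_projective_resolution_of_length (quotient_module M N) (p + r)"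
proof (rule free_resolution_length[OF quotient_resolution])
  \<comment> \<open>An enumeration of the labels of the product, which are pairs of pairs of natural numbers.\<close>
  let ?g = "\<lambda>n. map_prod prod_decode prod_decode (prod_decode n)"
  show "inj ?g"
  proof (rule injI)
    fix x y assume eq: "?g x = ?g y"
    have "inj (prod_decode :: nat \<Rightarrow> nat \<times> nat)" by (rule inj_prod_decode)
    then show "x = y" using eq prod.inj_map[of prod_decode prod_decode] by (metis injD)
  qed
  have "range ?g = map_prod prod_decode prod_decode ` range prod_decode" by (simp add: image_image)
  also have "\<dots> = UNIV" using surj_prod_decode by (simp add: map_prod_surj)
  finally show "range ?g = UNIV" .
  fix i assume "p + r < i"
  then have "A.F.level j = {} \<or> G2.level k = {}" if "i = j + k" for j k
    using r[of j] G2_empty[OF p, of k] that by (cases "j > r") auto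
  then show "FP.P.level i = {}" using FP.level_prod by blast
qed

text \<open>The frame of \<open>S/I\<close> extends one homological degree beyond the minimal frame of \<open>I\<close>. Zero
  modules, of projective dimension \<open>-1\<close>, are treated separately; for \<open>I = 0\<close> the frame of \<open>S/I\<close> is
  concentrated in homological degree \<open>0 = proj_dim I + 1\<close>.\<close>

theorem proj_dim_quotient:
  "proj_dim (quotient_module M N) \<le> proj_dim M + proj_dim (poly_module\<lparr>carrier := I\<rparr>) + 1"
proof (cases "carrier (quotient_module M N) = {\<zero>\<^bsub>quotient_module M N\<^esub>}")
  case True
  have "(- 1 :: ereal) + - 1 + 1 \<le> proj_dim M + proj_dim (poly_module\<lparr>carrier := I\<rparr>) + 1"
    by (intro add_mono proj_dim_ge order_refl)
  moreover have "(- 1 :: ereal) + - 1 + 1 = - 1" by (simp add: one_ereal_def)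
  ultimately show ?thesis using True by (simp add: proj_dim_def)
next
  case nonzero: False
  let ?I = "poly_module\<lparr>carrier := I\<rparr>"
  have M0: "carrier M \<noteq> {\<zero>\<^bsub>M\<^esub>}"
  proof
    assume z: "carrier M = {\<zero>\<^bsub>M\<^esub>}"
    have "\<zero>\<^bsub>M\<^esub> \<in> N" using subgroup.one_closed[OF submodule.axioms(1)[OF N_submodule]] by simp
    then have "N +>\<^bsub>M\<^esub> \<zero>\<^bsub>M\<^esub> = \<zero>\<^bsub>quotient_module M N\<^esub>" using quotient_map(3)[OF N_submodule, of "\<zero>\<^bsub>M\<^esub>"] by simp
    then show False using nonzero quotient_map(2)[OF N_submodule] z by simp
  qed
  show ?thesis
  proof (cases "proj_dim M = \<infinity> \<or> proj_dim ?I = \<infinity>")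
    case True
    then show ?thesis using proj_dim_ge[of M] proj_dim_ge[of ?I] by auto
  next
    case False
    obtain p where p: "has_projective_resolution_of_length M p" "proj_dim M = ereal (real p)"
      using proj_dim_attained[OF M0] False by blast
    note J = A.ideal_resolution A.ideal_module A.J.minimal_diff[OF A.J_minimal]
    have "\<exists>r. (\<forall>i>r. A.F.level i = {}) \<and> proj_dim ?I + 1 = ereal (real r)"
    proof (cases "carrier ?I = {\<zero>\<^bsub>?I\<^esub>}")
      case True
      have "A.F.level i = {}" if "i > 0" for i
        using minimal_resolution_zero_module[OF J True, of "i - 1"] that by (simp add: A.J_level_shift)
      moreover have "proj_dim ?I + 1 = ereal (real 0)" using True by (simp add: proj_dim_def one_ereal_def)
      ultimately show ?thesis by (intro exI[of _ 0]) blast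
    next
      case nz: False
      obtain q where q: "has_projective_resolution_of_length ?I q" "proj_dim ?I = ereal (real q)"
        using proj_dim_attained[OF nz] False by blast
      have "A.F.level i = {}" if "i > Suc q" for i
        using minimal_resolution_empty[OF J q(1), of "i - 1"] that by (simp add: A.J_level_shift)
      moreover have "proj_dim ?I + 1 = ereal (real (Suc q))" using q(2) by (simp add: one_ereal_def)
      ultimately show ?thesis by (intro exI[of _ "Suc q"]) blast
    qed
    then obtain r where r: "\<forall>i>r. A.F.level i = {}" "proj_dim ?I + 1 = ereal (real r)" by blast
    have "proj_dim (quotient_module M N) \<le> ereal (real (p + r))"
      by (rule proj_dim_le[OF quotient_length[OF p(1) r(1)[rule_format]]])
    also have "\<dots> = proj_dim M + (proj_dim ?I + 1)" unfolding p(2) r(2) by simp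
    finally show ?thesis by (simp add: add.assoc)
  qed
qed

end

theorem corollary1p3:
  fixes I :: "('n::finite, 'k::field) mpoly set"
    and M :: "(('n, 'k) mpoly, 'm) module"
    and G :: "('n \<Rightarrow>\<^sub>0 nat) \<Rightarrow> 'm set"
  assumes "monomial_ideal I"
    and "multigraded M G"
    and "finitely_generated poly_ring M"
    and "Gens M G \<inter> Gens_ideal I = {}"
  shows "proj_dim (quotient_module M (ideal_smult poly_ring I M))
           \<le> proj_dim M + proj_dim (poly_module\<lparr>carrier := I\<rparr>) + 1
       \<and> regularity (M\<lparr>carrier := ideal_smult poly_ring I M\<rparr>) (induced_grading G (ideal_smult poly_ring I M))
           \<le> regularity (poly_module\<lparr>carrier := I\<rparr>) (induced_grading poly_grading I)
              + regularity M G"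
proof -
  interpret mgmod M G by unfold_locales (rule assms(2))
  obtain A where A: "finite A" "A \<subseteq> carrier M" "module_span poly_ring M A = carrier M"
    using assms(3) unfolding finitely_generated_def by blast
  have hom: "\<forall>x\<in>carrier M. \<forall>a. mcomp x a \<in> carrier M" using mcomp_carrier by blast
  obtain K2 and deg2 :: "nat \<times> nat \<Rightarrow> 'n expo" and c2 and m :: "nat \<times> nat \<Rightarrow> 'm" where
    fr: "frame (SIGMA i:UNIV. {..<K2 i}) fst deg2 c2" and ex: "frame.exact (SIGMA i:UNIV. {..<K2 i}) fst deg2 c2"
    and min: "frame.minimal (SIGMA i:UNIV. {..<K2 i}) deg2 c2"
    and m: "\<forall>x\<in>Pair 0 ` {..<K2 0}. m x \<in> G (deg2 x) \<and> m x \<in> carrier M"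
    and surj: "carrier M \<subseteq> lin_ext_to M m ` {v. keys v \<subseteq> Pair 0 ` {..<K2 0}}"
    and bd: "\<forall>b u. keys u \<subseteq> frame.below (SIGMA i:UNIV. {..<K2 i}) fst deg2 0 b \<longrightarrow>
      (lin_ext_to M m (homogenize deg2 b u) = \<zero>\<^bsub>M\<^esub> \<longleftrightarrow>
        u \<in> frame.boundaries (SIGMA i:UNIV. {..<K2 i}) fst deg2 c2 0 b)"
    and span: "carrier M \<subseteq> module_span poly_ring M (m ` Pair 0 ` {..<K2 0})"
    and proper: "\<forall>B. B \<subset> m ` Pair 0 ` {..<K2 0} \<longrightarrow> \<not> carrier M \<subseteq> module_span poly_ring M B"
    using submodule_minimal_frame[OF M.carrier_is_submodule hom A(1,2) equalityD2[OF A(3)]]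
    by (elim exE conjE)
  let ?B = "m ` Pair 0 ` {..<K2 0}"
  have "minimal_homogeneous_generators M G ?B"
    unfolding minimal_homogeneous_generators_def
  proof (intro conjI allI impI)
    show "?B \<subseteq> (\<Union>a. G a)" using m by blast
    have "module_span poly_ring M ?B \<subseteq> carrier M"
      unfolding module_span_def using m M.carrier_is_submodule by (intro Inter_lower) auto
    then show "module_span poly_ring M ?B = carrier M" using span by (rule equalityI)
    show "module_span poly_ring M C \<noteq> carrier M" if "C \<subset> ?B" for C
      using proper[rule_format, OF that] by auto
  qed
  then have gens: "i \<in> Gens M G" if "x \<in> Pair 0 ` {..<K2 0}" "lookup (deg2 x) i > 0" for x i
    unfolding Gens_def using bspec[OF m that(1)] that by blast
  have disj: "i \<notin> Gens_ideal I" if "x \<in> Pair 0 ` {..<K2 0}" "lookup (deg2 x) i > 0" for x i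
    using gens[OF that] assms(4) by blast
  have IM: "ideal_smult poly_ring I M = supported (expos I)"
  proof (rule ideal_smult_supported[OF assms(1) _ _ surj])
    show "\<And>x. x \<in> Pair 0 ` {..<K2 0} \<Longrightarrow> m x \<in> G (deg2 x)" using m by blast
    show "\<And>x i. x \<in> Pair 0 ` {..<K2 0} \<Longrightarrow> 0 < lookup (deg2 x) i \<Longrightarrow> i \<notin> Gens_ideal I" by (rule disj)
  qed
  obtain K and deg :: "nat \<times> nat \<Rightarrow> 'n expo" and c :: "nat \<times> nat \<Rightarrow> (nat \<times> nat) \<Rightarrow>\<^sub>0 'k" where F:
    "frame (SIGMA i:UNIV. {..<K i}) fst deg c" "K 0 = 1" "deg (0, 0) = 0"
    "frame.exact (SIGMA i:UNIV. {..<K i}) fst deg c"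
    "\<forall>b. frame.boundaries (SIGMA i:UNIV. {..<K i}) fst deg c 0 b
      = {u. keys u \<subseteq> {(0, 0)} \<and> (u \<noteq> 0 \<longrightarrow> b \<in> expos I)}"
    "\<forall>i j. j < K (Suc (Suc i)) \<longrightarrow> (\<forall>y\<in>keys (c (Suc (Suc i), j)). deg y \<noteq> deg (Suc (Suc i), j))"
    using ideal_frame_exists[OF assms(1)] by (elim exE conjE)
  have "ideal_frame I K deg c"
    by (rule ideal_frame.intro[OF assms(1) F(1-4) F(5)[rule_format] F(6)[rule_format]])
  moreover have "ideal_module_axioms I M G K2 deg2 c2 m"
    unfolding ideal_module_axioms_def level_labels[OF fr]
    using fr ex min m surj bd IM by blast
  ultimately interpret ideal_module I K deg c M G K2 deg2 c2 m
    by (intro ideal_module.intro mgmod_axioms)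
  show ?thesis unfolding IM using proj_dim_quotient regularity_IM by blast
qed

end
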